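(* Let $\Omega\subset\mathbb{R}^2$ be a convex open domain with compact closure containing the origin, and let $\sigma$ be arclength measure on $\partial\Omega$. Define $$\mathcal{M}f(x)=\sup_{k\in\mathbb{Z}}\Big|\int_{\partial\Omega} f(x-2^k y)\,d\sigma(y)\Big|.$$ For $\theta\in S^1$ let $\ell^+(\theta)$ be the unique affine line perpendicular to $\theta$ meeting $\partial\Omega$ such that $\Omega\subset\{y-t\theta: t>0,\ y\in\ell^+(\theta)\}$, and $\ell^-(\theta)$ the unique affine line perpendicular to $\theta$ meeting $\partial\Omega$ such that $\Omega\subset\{y+t\theta: t>0,\ y\in\ell^-(\theta)\}$. For $\delta>0$ let $\mathcal{C}^\pm(\theta,\delta)=\{y\in\partial\Omega:\mathrm{dist}(y,\ell^\pm(\theta))\le\delta\}$ and $\Lambda(\theta,\delta)=\max_\pm\sigma(\mathcal{C}^\pm(\theta,\delta))$. Let $\delta_0>0$ be such that for all $\theta\in S^1$ and all $\delta<\delta_0$ the arcs $\mathcal{C}^+(\theta,\delta)$ and $\mathcal{C}^-(\theta,\delta)$ are disjoint. Then $\mathcal{M}$ is bounded on $L^2(\mathbb{R}^2)$ if and only if $$\sup_{\theta\in S^1}\int_0^{\delta_0}\Lambda(\theta,\delta)^2\,\frac{d\delta}{\delta}<\infty.$$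
   Context: Such a $\delta_0>0$ always exists by compactness. *)

theory Defs
  imports "HOL-Analysis.Analysis"
begin

text \<open>One-dimensional Hausdorff (outer) measure, normalised so that it is
  arclength on rectifiable curves (covering by countably many bounded sets of
  diameter at most d, summing diameters, then letting d tend to 0).\<close>

definition H1_delta :: "real \<Rightarrow> ('a::metric_space) set \<Rightarrow> ennreal" where
  "H1_delta d A =
     (INF C \<in> {C :: nat \<Rightarrow> 'a set. A \<subseteq> (\<Union>i. C i) \<and>
                 (\<forall>i. bounded (C i) \<and> diameter (C i) \<le> d)}.
        (\<Sum>i. ennreal (diameter (C i))))"

definition H1 :: "('a::metric_space) set \<Rightarrow> ennreal" where
  "H1 A = (SUP d \<in> {0<..}. H1_delta d A)"

definition arclength :: "(real^2) set \<Rightarrow> (real^2) measure" where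
  "arclength \<Omega> = measure_of UNIV (sets borel) (\<lambda>A. H1 (A \<inter> frontier \<Omega>))"

definition maxop :: "(real^2) set \<Rightarrow> (real^2 \<Rightarrow> real) \<Rightarrow> real^2 \<Rightarrow> ennreal" where
  "maxop \<Omega> f x =
     (SUP k :: int. ennreal \<bar>integral\<^sup>L (arclength \<Omega>) (\<lambda>y. f (x - (2 powr real_of_int k) *\<^sub>R y))\<bar>)"

definition L2_bounded :: "(real^2) set \<Rightarrow> bool" where
  "L2_bounded \<Omega> \<longleftrightarrow> (\<exists>C::real. \<forall>f :: real^2 \<Rightarrow> real.
      f \<in> borel_measurable lborel \<longrightarrow> integrable lborel (\<lambda>x. (f x)\<^sup>2) \<longrightarrow>
      (\<integral>\<^sup>+ x. (maxop \<Omega> f x)\<^sup>2 \<partial>lborel) \<le> ennreal C * (\<integral>\<^sup>+ x. ennreal ((f x)\<^sup>2) \<partial>lborel))"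

definition ell_plus :: "(real^2) set \<Rightarrow> real^2 \<Rightarrow> (real^2) set" where
  "ell_plus \<Omega> \<theta> = (THE L. (\<exists>c. L = {y. y \<bullet> \<theta> = c}) \<and> L \<inter> frontier \<Omega> \<noteq> {} \<and>
      \<Omega> \<subseteq> {y - t *\<^sub>R \<theta> | y t. t > 0 \<and> y \<in> L})"

definition ell_minus :: "(real^2) set \<Rightarrow> real^2 \<Rightarrow> (real^2) set" where
  "ell_minus \<Omega> \<theta> = (THE L. (\<exists>c. L = {y. y \<bullet> \<theta> = c}) \<and> L \<inter> frontier \<Omega> \<noteq> {} \<and>
      \<Omega> \<subseteq> {y + t *\<^sub>R \<theta> | y t. t > 0 \<and> y \<in> L})"

definition cap_plus :: "(real^2) set \<Rightarrow> real^2 \<Rightarrow> real \<Rightarrow> (real^2) set" where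
  "cap_plus \<Omega> \<theta> \<delta> = {y \<in> frontier \<Omega>. infdist y (ell_plus \<Omega> \<theta>) \<le> \<delta>}"

definition cap_minus :: "(real^2) set \<Rightarrow> real^2 \<Rightarrow> real \<Rightarrow> (real^2) set" where
  "cap_minus \<Omega> \<theta> \<delta> = {y \<in> frontier \<Omega>. infdist y (ell_minus \<Omega> \<theta>) \<le> \<delta>}"

definition Lambda :: "(real^2) set \<Rightarrow> real^2 \<Rightarrow> real \<Rightarrow> real" where
  "Lambda \<Omega> \<theta> \<delta> = max (measure (arclength \<Omega>) (cap_plus \<Omega> \<theta> \<delta>))
                         (measure (arclength \<Omega>) (cap_minus \<Omega> \<theta> \<delta>))"

end

theory Submission
  imports Defs "HOL-Probability.Characteristic_Functions"
begin

text \<open>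
  Necessity. Test the maximal operator on the indicator of the strip of half-width \<open>\<epsilon>\<close> orthogonal to \<open>\<theta>\<close>.
  On the slab of width \<open>\<epsilon>\<close> below the \<open>2^k\<close>-dilate of the supporting line, the average over the
  \<open>2^k\<close>-dilate of the boundary sees the whole cap of height \<open>2^(-k) \<epsilon>\<close>. These slabs are disjoint, so the
  squares of the cap lengths at dyadic heights are summable uniformly in \<open>\<theta>\<close>.

  Sufficiency. Apart from edges orthogonal to \<open>\<theta>\<close>, which lie in the caps, the boundary consists of four
  arcs that are graphs of concave monotone functions of the height in direction \<open>\<theta>\<close>. Moving along such an
  arc by half a period \<open>s = pi / r\<close> of height, towards the end farthest out orthogonally to \<open>\<theta>\<close>, is a
  contraction, so the image of arclength under the height function decreases in that direction, and its Fourier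
  transform at \<open>r\<close> is at most the length of the part of the arc within height \<open>s\<close> of its other end. Hence
  the Fourier transform of arclength at \<open>r \<theta>\<close> is \<open>O(\<Lambda>(\<theta>, pi / r))\<close>. Subtract from arclength the multiple
  of the uniform measure on the unit disc with the same total mass: the dyadic square function of the
  difference is bounded by Plancherel's theorem, and the maximal function of the disc averages is bounded
  by a \<open>T T*\<close> argument.
\<close>

section \<open>Metric outer measures\<close>

locale metric_outer_measure =
  fixes \<mu> :: "'a::metric_space set \<Rightarrow> ennreal"
  assumes empty: "\<mu> {} = 0"
    and mono: "A \<subseteq> B \<Longrightarrow> \<mu> A \<le> \<mu> B"
    and UN_le: "\<mu> (\<Union>i::nat. E i) \<le> (\<Sum>i. \<mu> (E i))"
    and separated: "0 < e \<Longrightarrow> (\<And>x y. x \<in> A \<Longrightarrow> y \<in> B \<Longrightarrow> e \<le> dist x y) \<Longrightarrow> \<mu> A + \<mu> B \<le> \<mu> (A \<union> B)"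
begin

lemma Un_le: "\<mu> (A \<union> B) \<le> \<mu> A + \<mu> B"
  using UN_le[of "binaryset A B"] by (simp add: UN_binaryset_eq suminf_binaryset_eq empty)

lemma sum_le_of_separated:
  fixes E :: "nat \<Rightarrow> 'a set"
  assumes "\<And>n. \<exists>e>0. \<forall>k<n. \<forall>x\<in>E k. \<forall>y\<in>E n. e \<le> dist x y"
  shows "(\<Sum>k<n. \<mu> (E k)) \<le> \<mu> (\<Union>k<n. E k)"
proof (induction n)
  case (Suc n)
  obtain e where e: "0 < e" "\<And>k x y. k < n \<Longrightarrow> x \<in> E k \<Longrightarrow> y \<in> E n \<Longrightarrow> e \<le> dist x y"
    using assms[of n] by blast
  have "(\<Sum>k<Suc n. \<mu> (E k)) \<le> \<mu> (\<Union>k<n. E k) + \<mu> (E n)"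
    using Suc by (simp add: add_right_mono)
  also have "\<dots> \<le> \<mu> ((\<Union>k<n. E k) \<union> E n)"
    by (rule separated[OF e(1)]) (use e(2) in blast)
  also have "\<dots> = \<mu> (\<Union>k<Suc n. E k)"
    by (simp add: lessThan_Suc Un_commute)
  finally show ?case .
qed (simp add: empty)

end

definition shell :: "'a::metric_space set \<Rightarrow> nat \<Rightarrow> 'a set" where
  "shell F k = {x. 1 / real (k + 2) \<le> infdist x F \<and> infdist x F < 1 / real (k + 1)}"

lemma infdist_diff_le_dist: "infdist x F - infdist y F \<le> dist x y"
  using infdist_triangle[of x F y] by simp

lemma Compl_subset_shells:
  assumes "closed F" "F \<noteq> {}"
  shows "- F \<subseteq> {x. 1 / real (n + 1) \<le> infdist x F} \<union> (\<Union>k. shell F (k + n))"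
proof
  fix x assume "x \<in> - F"
  then have pos: "0 < infdist x F" using assms infdist_pos_not_in_closed by auto
  show "x \<in> {x. 1 / real (n + 1) \<le> infdist x F} \<union> (\<Union>k. shell F (k + n))"
  proof (cases "1 / real (n + 1) \<le> infdist x F")
    case False
    then have inverse_gt: "real (n + 1) < 1 / infdist x F"
      using pos by (simp add: field_simps)
    define k where "k = nat \<lceil>1 / infdist x F\<rceil> - (n + 2)"
    have k: "real (k + n + 1) < 1 / infdist x F" "1 / infdist x F \<le> real (k + n + 2)"
      unfolding k_def using inverse_gt by linarith+
    then have "x \<in> shell F (k + n)"
      using pos by (simp add: shell_def field_simps)
    then show ?thesis by blast
  qed simp
qed

lemma nonadjacent_shells_separated:
  assumes "j + 2 \<le> k" "x \<in> shell F j" "y \<in> shell F k"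
  shows "1 / real k - 1 / real (k + 1) \<le> dist x y"
proof -
  have "1 / real k \<le> 1 / real (j + 2)" using assms(1) by (intro divide_left_mono) auto
  then have "1 / real k - 1 / real (k + 1) \<le> infdist x F - infdist y F"
    using assms(2,3) by (auto simp: shell_def)
  then show ?thesis using infdist_diff_le_dist order_trans by blast
qed

lemma (in metric_outer_measure) suminf_shells_le: "(\<Sum>k. \<mu> (X \<inter> shell F k)) \<le> 2 * \<mu> X"
proof (rule suminf_le_const[OF summableI])
  fix n
  have same_parity: "(\<Sum>k<n. \<mu> (X \<inter> shell F (2 * k + j))) \<le> \<mu> X" for j
  proof -
    have "(\<Sum>k<n. \<mu> (X \<inter> shell F (2 * k + j))) \<le> \<mu> (\<Union>k<n. X \<inter> shell F (2 * k + j))"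
    proof (rule sum_le_of_separated)
      fix n
      show "\<exists>e>0. \<forall>k<n. \<forall>x\<in>X \<inter> shell F (2 * k + j). \<forall>y\<in>X \<inter> shell F (2 * n + j). e \<le> dist x y"
      proof (cases "n = 0")
        case False
        then have "0 < 1 / real (2 * n + j) - 1 / real (2 * n + j + 1)"
          by (simp add: frac_less2)
        then show ?thesis
          by (intro exI[of _ "1 / real (2 * n + j) - 1 / real (2 * n + j + 1)"] conjI allI impI ballI
              nonadjacent_shells_separated) auto
      qed (auto intro: exI[of _ 1])
    qed
    also have "\<dots> \<le> \<mu> X" by (rule mono) blast
    finally show ?thesis .
  qed
  have "(\<Sum>k<n. \<mu> (X \<inter> shell F k)) \<le> (\<Sum>k<2*n. \<mu> (X \<inter> shell F k))"
    by (intro sum_mono2) auto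
  also have "\<dots> = (\<Sum>k<n. \<mu> (X \<inter> shell F (2 * k + 0))) + (\<Sum>k<n. \<mu> (X \<inter> shell F (2 * k + 1)))"
    by (induction n) (auto simp: ac_simps)
  also have "\<dots> \<le> \<mu> X + \<mu> X"
    by (intro add_mono same_parity)
  finally show "(\<Sum>k<n. \<mu> (X \<inter> shell F k)) \<le> 2 * \<mu> X" by (simp add: mult_2)
qed

lemma (in metric_outer_measure) Int_add_Diff_le_tail:
  assumes "closed F" "F \<noteq> {}"
  shows "\<mu> (X \<inter> F) + \<mu> (X - F) \<le> \<mu> X + (\<Sum>k. \<mu> (X \<inter> shell F (k + n)))"
proof -
  define far where "far = X \<inter> {x. 1 / real (n + 1) \<le> infdist x F}"
  have "X - F \<subseteq> far \<union> (\<Union>k. X \<inter> shell F (k + n))"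
    using Compl_subset_shells[OF assms, of n] by (auto simp: far_def)
  then have "\<mu> (X - F) \<le> \<mu> (far \<union> (\<Union>k. X \<inter> shell F (k + n)))"
    by (rule mono)
  also have "\<dots> \<le> \<mu> far + (\<Sum>k. \<mu> (X \<inter> shell F (k + n)))"
    by (intro order_trans[OF Un_le] add_left_mono UN_le)
  finally have "\<mu> (X - F) \<le> \<mu> far + (\<Sum>k. \<mu> (X \<inter> shell F (k + n)))" .
  then have "\<mu> (X \<inter> F) + \<mu> (X - F) \<le> (\<mu> (X \<inter> F) + \<mu> far) + (\<Sum>k. \<mu> (X \<inter> shell F (k + n)))"
    by (simp add: add.assoc add_left_mono)
  also have "\<mu> (X \<inter> F) + \<mu> far \<le> \<mu> ((X \<inter> F) \<union> far)"
  proof (rule separated)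
    fix x y assume "x \<in> X \<inter> F" "y \<in> far"
    then show "1 / real (n + 1) \<le> dist x y"
      using infdist_diff_le_dist[of y F x] by (simp add: far_def dist_commute)
  qed simp
  also have "\<dots> \<le> \<mu> X" by (rule mono) (auto simp: far_def)
  finally show ?thesis by (simp add: add_right_mono)
qed

text \<open>Caratheodory's criterion: the shells around \<open>F\<close> are summable because those that are not adjacent
  are separated, so their tails do not contribute in the limit.\<close>

lemma (in metric_outer_measure) closed_Int_add_Diff:
  assumes "closed F"
  shows "\<mu> (X \<inter> F) + \<mu> (X - F) = \<mu> X"
proof (rule antisym)
  show "\<mu> X \<le> \<mu> (X \<inter> F) + \<mu> (X - F)"
    using Un_le[of "X \<inter> F" "X - F"] by (simp add: Int_Diff_Un)
  show "\<mu> (X \<inter> F) + \<mu> (X - F) \<le> \<mu> X"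
  proof (cases "F = {} \<or> \<mu> X = top")
    case False
    define total where "total = (\<Sum>k. \<mu> (X \<inter> shell F k))"
    have "total < top"
      using suminf_shells_le[of X F] False
      by (auto simp: total_def ennreal_mult_less_top less_top intro: le_less_trans)
    have "(\<mu> (X \<inter> F) + \<mu> (X - F)) + (\<Sum>k<n. \<mu> (X \<inter> shell F k)) \<le> \<mu> X + total" for n
    proof -
      have "(\<mu> (X \<inter> F) + \<mu> (X - F)) + (\<Sum>k<n. \<mu> (X \<inter> shell F k))
          \<le> (\<mu> X + (\<Sum>k. \<mu> (X \<inter> shell F (k + n)))) + (\<Sum>k<n. \<mu> (X \<inter> shell F k))"
        using Int_add_Diff_le_tail[OF assms] False by (intro add_right_mono) auto
      then show ?thesis
        by (simp add: total_def suminf_offset[of "\<lambda>k. \<mu> (X \<inter> shell F k)" n] summableI add.assoc)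
    qed
    moreover have "(\<lambda>n. (\<mu> (X \<inter> F) + \<mu> (X - F)) + (\<Sum>k<n. \<mu> (X \<inter> shell F k)))
        \<longlonglongrightarrow> (\<mu> (X \<inter> F) + \<mu> (X - F)) + total"
      unfolding total_def by (intro tendsto_add tendsto_const summable_LIMSEQ summableI)
    ultimately have "(\<mu> (X \<inter> F) + \<mu> (X - F)) + total \<le> \<mu> X + total"
      by (intro LIMSEQ_le_const2) auto
    then show ?thesis
      using \<open>total < top\<close> by (auto simp: add.commute[of _ total] ennreal_add_left_cancel_le)
  qed (auto simp: empty)
qed

lemma (in metric_outer_measure) measure_space_borel:
  "measure_space UNIV (sets (borel :: 'a measure)) \<mu>"
proof -
  interpret sigma_algebra UNIV "Pow UNIV :: 'a set set" by (rule sigma_algebra_Pow)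
  have "outer_measure_space (Pow UNIV) \<mu>"
    unfolding outer_measure_space_def positive_def increasing_def countably_subadditive_def
    by (auto intro: mono UN_le simp: empty)
  then have Caratheodory: "measure_space UNIV (lambda_system UNIV (Pow UNIV) \<mu>) \<mu>"
    by (rule caratheodory_lemma)
  then have "sigma_algebra UNIV (lambda_system UNIV (Pow UNIV) \<mu>)"
    by (simp add: measure_space_def)
  moreover have "F \<in> lambda_system UNIV (Pow UNIV) \<mu>" if "closed F" for F
    unfolding lambda_system_eq using closed_Int_add_Diff[OF that] by simp
  then have "Collect closed \<subseteq> lambda_system UNIV (Pow UNIV) \<mu>" by blast
  ultimately have "sets (borel :: 'a measure) \<subseteq> lambda_system UNIV (Pow UNIV) \<mu>"
    unfolding borel_eq_closed by (subst sets_measure_of) (simp, rule sigma_algebra.sigma_sets_subset)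
  then show ?thesis
    using sets.sigma_algebra_axioms[of "borel :: 'a measure"] by (intro measure_down[OF Caratheodory]) auto
qed

section \<open>Arclength as a Borel measure\<close>

lemma diameter_le_metric:
  fixes S :: "'a::metric_space set"
  assumes "0 \<le> d" "\<And>x y. x \<in> S \<Longrightarrow> y \<in> S \<Longrightarrow> dist x y \<le> d"
  shows "diameter S \<le> d"
  using assms by (auto simp: diameter_def intro!: cSUP_least)

definition fine_cover :: "real \<Rightarrow> 'a::metric_space set \<Rightarrow> (nat \<Rightarrow> 'a set) \<Rightarrow> bool" where
  "fine_cover d A C \<longleftrightarrow> A \<subseteq> (\<Union>i. C i) \<and> (\<forall>i. bounded (C i) \<and> diameter (C i) \<le> d)"

definition cover_length :: "(nat \<Rightarrow> 'a::metric_space set) \<Rightarrow> ennreal" where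
  "cover_length C = (\<Sum>i. ennreal (diameter (C i)))"

lemma H1_delta_eq: "H1_delta d A = (INF C\<in>{C. fine_cover d A C}. cover_length C)"
  unfolding H1_delta_def fine_cover_def cover_length_def ..

lemma H1_delta_le_cover_length: "fine_cover d A C \<Longrightarrow> H1_delta d A \<le> cover_length C"
  unfolding H1_delta_eq by (rule INF_lower) simp

lemma le_H1_delta: "(\<And>C. fine_cover d A C \<Longrightarrow> l \<le> cover_length C) \<Longrightarrow> l \<le> H1_delta d A"
  unfolding H1_delta_eq by (rule INF_greatest) simp

lemma H1_delta_mono: "A \<subseteq> B \<Longrightarrow> H1_delta d A \<le> H1_delta d B"
  by (rule le_H1_delta) (auto intro!: H1_delta_le_cover_length simp: fine_cover_def)

lemma H1_delta_antimono: "d \<le> e \<Longrightarrow> H1_delta e A \<le> H1_delta d A"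
  by (rule le_H1_delta, rule H1_delta_le_cover_length) (auto simp: fine_cover_def intro: order_trans)

lemma H1_delta_le_H1: "0 < d \<Longrightarrow> H1_delta d A \<le> H1 A"
  unfolding H1_def by (intro SUP_upper) auto

lemma H1_mono: "A \<subseteq> B \<Longrightarrow> H1 A \<le> H1 B"
  unfolding H1_def by (intro SUP_mono) (auto intro: H1_delta_mono)

lemma H1_empty: "H1 {} = 0"
proof -
  have "H1_delta d {} \<le> 0" if "0 < d" for d
    using H1_delta_le_cover_length[of d "{}" "\<lambda>_. {}"] that by (simp add: fine_cover_def cover_length_def)
  then show ?thesis
    unfolding H1_def by (metis (mono_tags, lifting) SUP_least greaterThan_iff le_zero_eq)
qed

lemma fine_cover_UN:
  assumes "\<And>i. fine_cover d (E i) (C i)"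
  shows "fine_cover d (\<Union>i. E i) (\<lambda>n. case_prod C (prod_decode n))"
proof -
  have "(\<Union>i. E i) \<subseteq> (\<Union>n. case_prod C (prod_decode n))"
  proof
    fix x assume "x \<in> (\<Union>i. E i)"
    then obtain i j where "x \<in> C i j" using assms unfolding fine_cover_def by fast
    then have "x \<in> case_prod C (prod_decode (prod_encode (i, j)))" by simp
    then show "x \<in> (\<Union>n. case_prod C (prod_decode n))" by (rule UN_I[OF UNIV_I])
  qed
  then show ?thesis
    using assms by (auto simp: fine_cover_def split: prod.split)
qed

lemma cover_length_UN:
  "cover_length (\<lambda>n. case_prod C (prod_decode n)) = (\<Sum>i. cover_length (C i))"
  unfolding cover_length_def
  using suminf_ennreal_2dimen[of "\<lambda>i. \<Sum>j. ennreal (diameter (C i j))" "\<lambda>p. ennreal (diameter (case_prod C p))"]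
  by (simp add: comp_def)

lemma H1_delta_UN:
  fixes E :: "nat \<Rightarrow> 'a::metric_space set"
  shows "H1_delta d (\<Union>i. E i) \<le> (\<Sum>i. H1_delta d (E i))"
proof (rule ennreal_le_epsilon)
  fix e :: real assume fin: "(\<Sum>i. H1_delta d (E i)) < top" and e: "0 < e"
  have "\<exists>C. fine_cover d (E i) C \<and> cover_length C \<le> H1_delta d (E i) + e * (1/2) ^ Suc i" for i
  proof -
    have "H1_delta d (E i) < H1_delta d (E i) + ennreal (e * (1/2) ^ Suc i)"
      using e ennreal_suminf_lessD[OF fin] by (simp add: ennreal_less_iff less_top)
    then show ?thesis
      unfolding H1_delta_eq INF_less_iff by (auto intro: less_imp_le)
  qed
  then obtain C where C: "\<And>i. fine_cover d (E i) (C i)"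
      "\<And>i. cover_length (C i) \<le> H1_delta d (E i) + e * (1/2) ^ Suc i"
    by metis
  have "H1_delta d (\<Union>i. E i) \<le> (\<Sum>i. cover_length (C i))"
    unfolding cover_length_UN[symmetric] by (intro H1_delta_le_cover_length fine_cover_UN C)
  also have "\<dots> \<le> (\<Sum>i. H1_delta d (E i) + e * (1/2) ^ Suc i)"
    by (intro suminf_le allI C summableI)
  also have "\<dots> = (\<Sum>i. H1_delta d (E i)) + (\<Sum>i. ennreal e * ennreal ((1/2) ^ Suc i))"
    using e by (subst suminf_add[symmetric])
       (auto simp del: ennreal_suminf_cmult simp add: ennreal_mult[symmetric])
  also have "\<dots> = (\<Sum>i. H1_delta d (E i)) + e"
    unfolding ennreal_suminf_cmult
    by (subst suminf_ennreal_eq[OF zero_le_power power_half_series]) auto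
  finally show "H1_delta d (\<Union>i. E i) \<le> (\<Sum>i. H1_delta d (E i)) + ennreal e" .
qed

lemma H1_UN:
  fixes E :: "nat \<Rightarrow> 'a::metric_space set"
  shows "H1 (\<Union>i. E i) \<le> (\<Sum>i. H1 (E i))"
  unfolding H1_def[of "\<Union>i. E i"]
proof (rule SUP_least)
  fix d :: real assume "d \<in> {0<..}"
  then have "(\<Sum>i. H1_delta d (E i)) \<le> (\<Sum>i. H1 (E i))"
    by (intro suminf_le summableI allI H1_delta_le_H1) auto
  then show "H1_delta d (\<Union>i. E i) \<le> (\<Sum>i. H1 (E i))"
    using H1_delta_UN order_trans by blast
qed

lemma H1_delta_separated:
  assumes "0 < d" "d < e" and sep: "\<And>x y. x \<in> A \<Longrightarrow> y \<in> B \<Longrightarrow> e \<le> dist x y"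
  shows "H1_delta d A + H1_delta d B \<le> H1_delta d (A \<union> B)"
proof (rule le_H1_delta)
  fix C assume C: "fine_cover d (A \<union> B) C"
  define meeting where "meeting S i = (if C i \<inter> S \<noteq> {} then C i else {})" for S i
  have meets_one: "C i \<inter> A = {} \<or> C i \<inter> B = {}" for i
  proof (rule ccontr)
    assume "\<not> ?thesis"
    then obtain x y where "x \<in> C i" "x \<in> A" "y \<in> C i" "y \<in> B" by auto
    moreover have "bounded (C i)" "diameter (C i) \<le> d" using C by (auto simp: fine_cover_def)
    ultimately have "e \<le> dist x y" "dist x y \<le> d"
      using sep diameter_bounded_bound[of "C i" x y] by auto
    then show False using assms by simp
  qed
  have "fine_cover d A (meeting A)" "fine_cover d B (meeting B)"
    using C \<open>0 < d\<close> by (auto simp: fine_cover_def meeting_def, blast+)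
  then have "H1_delta d A + H1_delta d B \<le> cover_length (meeting A) + cover_length (meeting B)"
    by (intro add_mono H1_delta_le_cover_length)
  also have "\<dots> = (\<Sum>i. ennreal (diameter (meeting A i)) + ennreal (diameter (meeting B i)))"
    unfolding cover_length_def by (rule suminf_add) auto
  also have "\<dots> \<le> cover_length C"
    unfolding cover_length_def
  proof (intro suminf_le summableI allI)
    fix i
    show "ennreal (diameter (meeting A i)) + ennreal (diameter (meeting B i)) \<le> ennreal (diameter (C i))"
      using meets_one[of i] by (auto simp: meeting_def)
  qed
  finally show "H1_delta d A + H1_delta d B \<le> cover_length C" .
qed

lemma H1_separated:
  assumes "0 < e" and "\<And>x y. x \<in> A \<Longrightarrow> y \<in> B \<Longrightarrow> e \<le> dist x y"
  shows "H1 A + H1 B \<le> H1 (A \<union> B)"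
proof -
  have "H1 A + H1 B = (SUP d\<in>{0<..}. H1_delta d A + H1_delta d B)"
    unfolding H1_def
  proof (rule SUP_add_directed_ennreal[symmetric])
    fix i j :: real assume "i \<in> {0<..}" "j \<in> {0<..}"
    then show "\<exists>k\<in>{0<..}. H1_delta i A + H1_delta j B \<le> H1_delta k A + H1_delta k B"
      by (intro bexI[of _ "min i j"] add_mono H1_delta_antimono) auto
  qed
  also have "\<dots> \<le> H1 (A \<union> B)"
  proof (rule SUP_least)
    fix d :: real assume d: "d \<in> {0<..}"
    have "H1_delta d A + H1_delta d B \<le> H1_delta (min d (e/2)) A + H1_delta (min d (e/2)) B"
      by (intro add_mono H1_delta_antimono) auto
    also have "\<dots> \<le> H1_delta (min d (e/2)) (A \<union> B)"
      using d assms by (intro H1_delta_separated[of _ e]) auto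
    also have "\<dots> \<le> H1 (A \<union> B)"
      using d assms by (intro H1_delta_le_H1) auto
    finally show "H1_delta d A + H1_delta d B \<le> H1 (A \<union> B)" .
  qed
  finally show ?thesis .
qed

interpretation H1: metric_outer_measure H1
  by (intro metric_outer_measure.intro H1_empty H1_mono H1_UN H1_separated)

lemma sets_arclength [simp, measurable_cong]: "sets (arclength \<Omega>) = sets borel"
  unfolding arclength_def
  using sets.sigma_sets_eq[of "borel :: (real^2) measure"] by (simp add: sets_measure_of_conv)

lemma space_arclength [simp]: "space (arclength \<Omega>) = UNIV"
  unfolding arclength_def by (simp add: space_measure_of_conv)

lemma emeasure_arclength:
  assumes "A \<in> sets borel"
  shows "emeasure (arclength \<Omega>) A = H1 (A \<inter> frontier \<Omega>)"
  unfolding arclength_def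
proof (rule emeasure_measure_of_sigma)
  have additive: "countably_additive (sets (borel :: (real^2) measure)) H1"
    using H1.measure_space_borel[where 'a="real^2"] by (simp add: measure_space_def)
  show "sigma_algebra UNIV (sets (borel :: (real^2) measure))"
    using sets.sigma_algebra_axioms[of "borel :: (real^2) measure"] by simp
  show "positive (sets borel) (\<lambda>A. H1 (A \<inter> frontier \<Omega>))"
    by (simp add: positive_def H1_empty)
  show "countably_additive (sets borel) (\<lambda>A. H1 (A \<inter> frontier \<Omega>))"
    unfolding countably_additive_def
  proof (intro allI impI)
    fix A :: "nat \<Rightarrow> (real^2) set"
    assume A: "range A \<subseteq> sets borel" "disjoint_family A" "\<Union> (range A) \<in> sets borel"
    have "(\<Sum>i. H1 (A i \<inter> frontier \<Omega>)) = H1 (\<Union>i. A i \<inter> frontier \<Omega>)"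
      using A by (intro additive[unfolded countably_additive_def, rule_format])
        (auto simp: disjoint_family_on_def intro!: sets.Int)
    then show "(\<Sum>i. H1 (A i \<inter> frontier \<Omega>)) = H1 (\<Union> (range A) \<inter> frontier \<Omega>)"
      by simp
  qed
qed (use assms in auto)

lemma fine_cover_lipschitz_image:
  assumes f: "L-lipschitz_on A f" and C: "fine_cover d A C"
  shows "fine_cover (L * d) (f ` A) (\<lambda>i. f ` (C i \<inter> A))"
    and "cover_length (\<lambda>i. f ` (C i \<inter> A)) \<le> ennreal L * cover_length C"
proof -
  have L: "0 \<le> L" by (rule lipschitz_on_nonneg[OF f])
  have bdd: "bounded (C i)" and diameter_C: "diameter (C i) \<le> d" for i
    using C by (auto simp: fine_cover_def)
  have dist_image: "dist x y \<le> L * diameter (C i)" if "x \<in> f ` (C i \<inter> A)" "y \<in> f ` (C i \<inter> A)" for x y i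
  proof -
    from that obtain a b where ab: "x = f a" "y = f b" "a \<in> C i" "b \<in> C i" "a \<in> A" "b \<in> A"
      by auto
    have "dist x y \<le> L * dist a b" using lipschitz_onD[OF f] ab by auto
    also have "\<dots> \<le> L * diameter (C i)"
      by (intro mult_left_mono L diameter_bounded_bound[OF bdd] ab)
    finally show ?thesis .
  qed
  have diameter_image: "diameter (f ` (C i \<inter> A)) \<le> L * diameter (C i)" for i
    by (rule diameter_le_metric) (use L diameter_ge_0[OF bdd] dist_image in auto)
  have "bounded (f ` (C i \<inter> A))" for i
    unfolding bounded_two_points using dist_image by blast
  moreover have "diameter (f ` (C i \<inter> A)) \<le> L * d" for i
    using diameter_image[of i] mult_left_mono[OF diameter_C L, of i] by linarith
  moreover have "f ` A \<subseteq> (\<Union>i. f ` (C i \<inter> A))"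
    using C by (fastforce simp: fine_cover_def)
  ultimately show "fine_cover (L * d) (f ` A) (\<lambda>i. f ` (C i \<inter> A))"
    by (simp add: fine_cover_def)
  have "cover_length (\<lambda>i. f ` (C i \<inter> A)) \<le> (\<Sum>i. ennreal L * ennreal (diameter (C i)))"
    unfolding cover_length_def
    using L diameter_image diameter_ge_0[OF bdd]
    by (intro suminf_le summableI allI) (simp add: ennreal_leI flip: ennreal_mult)
  then show "cover_length (\<lambda>i. f ` (C i \<inter> A)) \<le> ennreal L * cover_length C"
    by (simp add: cover_length_def)
qed

lemma H1_lipschitz_image_le:
  assumes "L-lipschitz_on A f" and L: "0 < L"
  shows "H1 (f ` A) \<le> ennreal L * H1 A"
  unfolding H1_def[of "f ` A"]
proof (rule SUP_least)
  fix d :: real assume "d \<in> {0<..}"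
  then have d: "0 < d / L" using L by simp
  have "H1_delta d (f ` A) / ennreal L \<le> H1_delta (d / L) A"
  proof (rule le_H1_delta)
    fix C assume C: "fine_cover (d / L) A C"
    have "H1_delta d (f ` A) \<le> ennreal L * cover_length C"
      using fine_cover_lipschitz_image[OF assms(1) C] L H1_delta_le_cover_length order_trans by fastforce
    then show "H1_delta d (f ` A) / ennreal L \<le> cover_length C"
      using L by (intro divide_le_posI_ennreal) auto
  qed
  also have "\<dots> \<le> H1 A" using d by (rule H1_delta_le_H1)
  finally have "ennreal L * (H1_delta d (f ` A) / ennreal L) \<le> ennreal L * H1 A"
    by (rule mult_left_mono) simp
  then show "H1_delta d (f ` A) \<le> ennreal L * H1 A"
    using L by (simp add: ennreal_times_divide mult_divide_eq_ennreal mult.commute[of _ "H1_delta d (f ` A)"])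
qed

lemma H1_inv_contraction_le:
  assumes "\<And>x y. x \<in> A \<Longrightarrow> y \<in> A \<Longrightarrow> dist x y \<le> dist (f x) (f y)"
  shows "H1 A \<le> H1 (f ` A)"
proof -
  have inj: "inj_on f A" using assms by (force intro!: inj_onI)
  have "1-lipschitz_on (f ` A) (inv_into A f)"
    using assms inj by (intro lipschitz_onI) auto
  then have "H1 (inv_into A f ` (f ` A)) \<le> H1 (f ` A)"
    using H1_lipschitz_image_le by fastforce
  then show ?thesis using inj by simp
qed

lemma H1_unit_interval_finite: "H1 {0..1::real} < \<infinity>"
proof -
  have "H1_delta d {0..1::real} \<le> 2" if d: "0 < d" for d :: real
  proof -
    obtain m where "1 / real (Suc m) < d" using nat_approx_posE[OF d] .
    then obtain n :: nat where n: "0 < n" "1 / real n \<le> d" by (metis less_imp_le zero_less_Suc)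
    define C where "C i = (if i \<le> n then {real i / n .. real (Suc i) / n} else {})" for i
    have diameter_C: "diameter (C i) = (if i \<le> n then 1 / n else 0)" for i
      using n by (auto simp: C_def divide_simps)
    have "x \<in> C (nat \<lfloor>x * n\<rfloor>)" if x: "x \<in> {0..1}" for x :: real
    proof -
      have "0 \<le> x * n" "x * n \<le> n" using x by (auto simp: mult_left_le_one_le)
      then have "nat \<lfloor>x * n\<rfloor> \<le> n" "real (nat \<lfloor>x * n\<rfloor>) \<le> x * n" "x * n \<le> real (Suc (nat \<lfloor>x * n\<rfloor>))"
        by linarith+
      then show ?thesis using n by (simp add: C_def field_simps)
    qed
    then have "{0..1} \<subseteq> (\<Union>i. C i)" by blast
    moreover have "bounded (C i)" for i by (simp add: C_def)
    ultimately have "fine_cover d {0..1} C"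
      using n d by (simp add: fine_cover_def diameter_C)
    then have "H1_delta d {0..1::real} \<le> cover_length C" by (rule H1_delta_le_cover_length)
    also have "\<dots> = (\<Sum>i\<le>n. ennreal (1 / n))"
      unfolding cover_length_def by (subst suminf_finite[of "{..n}"]) (auto simp: diameter_C)
    also have "\<dots> = ennreal (real (Suc n) / n)"
      by (subst sum_ennreal) simp_all
    also have "\<dots> \<le> ennreal 2" using n by (intro ennreal_leI) (simp add: field_simps)
    finally show ?thesis by simp
  qed
  then have "H1 {0..1::real} \<le> 2" unfolding H1_def by (intro SUP_least) auto
  then show ?thesis by (simp add: le_less_trans)
qed

lemma cmod_cis_minus_one_le: "cmod (cis t - 1) \<le> \<bar>t\<bar>"
  using iexp_approx1[of t 0] by (simp add: cis_conv_exp)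

definition circle :: "real \<Rightarrow> real \<Rightarrow> real^2" where
  "circle R t = vector [R * cos t, R * sin t]"

lemma lipschitz_circle:
  assumes "0 \<le> R"
  shows "R-lipschitz_on X (circle R)"
proof (rule lipschitz_onI[OF _ assms])
  fix s t :: real
  have "cis s - cis t = cis t * (cis (s - t) - 1)"
    by (simp add: right_diff_distrib cis_mult)
  then have "cmod (cis s - cis t) \<le> dist s t"
    using cmod_cis_minus_one_le[of "s - t"] by (simp add: norm_mult dist_real_def)
  moreover have "dist (circle R s) (circle R t) = R * cmod (cis s - cis t)"
    using assms
    by (simp add: circle_def dist_norm norm_vec_def L2_set_def sum_2 cmod_def real_sqrt_mult power_mult_distrib
        flip: right_diff_distrib distrib_left)
  ultimately show "dist (circle R s) (circle R t) \<le> R * dist s t"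
    using assms by (simp add: mult_left_mono)
qed

lemma sphere_subset_circle:
  assumes "0 < R"
  shows "sphere 0 R \<subseteq> circle R ` {0..2 * pi}"
proof
  fix x :: "real^2" assume "x \<in> sphere 0 R"
  then have "(x $ 1)\<^sup>2 + (x $ 2)\<^sup>2 = R\<^sup>2"
    by (auto simp: norm_vec_def L2_set_def sum_2)
  then have "(x $ 1 / R)\<^sup>2 + (x $ 2 / R)\<^sup>2 = 1"
    using assms by (simp add: power_divide flip: add_divide_distrib)
  then obtain t where t: "0 \<le> t" "t \<le> 2 * pi" "x $ 1 / R = cos t" "x $ 2 / R = sin t"
    using sincos_total_2pi_le by blast
  then have "x = circle R t"
    using assms by (simp add: circle_def vec_eq_iff forall_2 field_simps)
  then show "x \<in> circle R ` {0..2 * pi}" using t by auto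
qed

lemma H1_sphere_finite:
  assumes "0 < R"
  shows "H1 (sphere (0::real^2) R) < \<infinity>"
proof -
  have "x \<in> (\<lambda>t. 2 * pi * t) ` {0..1}" if "x \<in> {0..2 * pi}" for x
    using that by (intro image_eqI[of _ _ "x / (2 * pi)"]) auto
  then have "sphere 0 R \<subseteq> circle R ` (\<lambda>t. 2 * pi * t) ` {0..1}"
    using sphere_subset_circle[OF assms] by blast
  then have "H1 (sphere (0::real^2) R) \<le> H1 (circle R ` (\<lambda>t. 2 * pi * t) ` {0..1})" by (rule H1_mono)
  also have "\<dots> \<le> ennreal R * H1 ((\<lambda>t. 2 * pi * t) ` {0..1})"
    using assms by (intro H1_lipschitz_image_le lipschitz_circle) auto
  also have "\<dots> \<le> ennreal R * (ennreal (2 * pi) * H1 {0..1::real})"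
    by (intro mult_left_mono H1_lipschitz_image_le lipschitz_onI)
       (auto simp: dist_real_def abs_mult simp flip: right_diff_distrib)
  also have "\<dots> < \<infinity>" using H1_unit_interval_finite by (simp add: ennreal_mult_less_top)
  finally show ?thesis .
qed

lemma frontier_subset_closest_point_sphere:
  fixes S :: "'a::euclidean_space set"
  assumes "convex S" "open S" and R: "closure S \<subseteq> ball 0 R"
  shows "frontier S \<subseteq> closest_point (closure S) ` sphere 0 R"
proof
  fix p assume "p \<in> frontier S"
  then have p: "p \<in> closure S" "p \<notin> S" using \<open>open S\<close> by (auto simp: frontier_def interior_open)
  then have "S \<noteq> {}" by auto
  then obtain n b where n: "n \<noteq> 0" "\<forall>x\<in>S. n \<bullet> x \<le> b" "b \<le> n \<bullet> p"
    using separating_hyperplane_sets[of S "{p}"] p(2) \<open>convex S\<close> by auto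
  have "closure S \<subseteq> {x. n \<bullet> x \<le> b}"
    using n by (intro closure_minimal closed_halfspace_le) auto
  then have normal: "n \<bullet> q \<le> n \<bullet> p" if "q \<in> closure S" for q using that n by auto
  have "p \<in> interior (ball 0 R)" using p(1) R by auto
  then obtain d where d: "0 < d" "p + d *\<^sub>R n \<in> frontier (ball 0 R)"
    using ray_to_frontier[OF bounded_ball _ n(1)] by metis
  have "dist (p + d *\<^sub>R n) p \<le> dist (p + d *\<^sub>R n) q" if "q \<in> closure S" for q
  proof -
    have "(p + d *\<^sub>R n - q) \<bullet> (p + d *\<^sub>R n - q)
        = (p - q) \<bullet> (p - q) + 2 * d * (n \<bullet> p - n \<bullet> q) + (d *\<^sub>R n) \<bullet> (d *\<^sub>R n)"
      by (simp add: inner_add inner_diff inner_commute algebra_simps)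
    also have "\<dots> \<ge> (d *\<^sub>R n) \<bullet> (d *\<^sub>R n)" using normal[OF that] d by simp
    finally show ?thesis by (simp only: dist_norm norm_le add_diff_cancel_left')
  qed
  then have "p = closest_point (closure S) (p + d *\<^sub>R n)"
    using \<open>convex S\<close> p(1) by (intro closest_point_unique) (auto intro: convex_closure)
  moreover have "norm p < R" using p(1) R by auto
  then have "0 < R" using norm_ge_zero by (rule le_less_trans[rotated])
  ultimately show "p \<in> closest_point (closure S) ` sphere 0 R"
    using d(2) by (auto simp: frontier_ball)
qed

lemma H1_convex_frontier_finite:
  fixes S :: "(real^2) set"
  assumes "convex S" "open S" "bounded S"
  shows "H1 (frontier S) < \<infinity>"
proof (cases "S = {}")
  case False
  obtain R where R: "0 < R" "closure S \<subseteq> ball 0 R"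
    using bounded_closure[OF \<open>bounded S\<close>] bounded_subset_ballD by blast
  have "1-lipschitz_on (sphere 0 R) (closest_point (closure S))"
    using assms False by (intro lipschitz_onI) (simp_all add: closest_point_lipschitz convex_closure)
  then have "H1 (closest_point (closure S) ` sphere 0 R) \<le> H1 (sphere (0::real^2) R)"
    using H1_lipschitz_image_le by fastforce
  then have "H1 (frontier S) \<le> H1 (sphere (0::real^2) R)"
    using H1_mono[OF frontier_subset_closest_point_sphere[OF assms(1,2) R(2)]] order_trans by blast
  then show ?thesis using H1_sphere_finite[OF R(1)] by (rule le_less_trans)
qed (simp add: H1_empty)

section \<open>A Plancherel inequality\<close>

lemma measurable_cis [measurable]: "cis \<in> borel_measurable borel"
  by (intro borel_measurable_continuous_onI continuous_intros)

lemma integral_lborel_affine: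
  fixes f :: "'a::euclidean_space \<Rightarrow> 'b::{banach, second_countable_topology}"
  assumes [measurable]: "f \<in> borel_measurable borel" and c: "c \<noteq> 0"
  shows "(\<integral>x. f x \<partial>lborel) = \<bar>c\<bar>^DIM('a) *\<^sub>R (\<integral>x. f (t + c *\<^sub>R x) \<partial>lborel)"
  by (subst lborel_affine[OF c, of t]) (simp add: integral_density integral_distr)

lemma nn_integral_lborel_affine:
  fixes f :: "'a::euclidean_space \<Rightarrow> ennreal"
  assumes [measurable]: "f \<in> borel_measurable borel" and c: "c \<noteq> 0"
  shows "(\<integral>\<^sup>+x. f x \<partial>lborel) = \<bar>c\<bar>^DIM('a) * (\<integral>\<^sup>+x. f (t + c *\<^sub>R x) \<partial>lborel)"
  by (subst lborel_affine[OF c, of t])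
     (simp add: nn_integral_density nn_integral_distr nn_integral_cmult ennreal_power)

lemma integrable_lborel_affine:
  fixes f :: "'a::euclidean_space \<Rightarrow> 'b::{banach, second_countable_topology}"
  assumes f: "integrable lborel f" and c: "c \<noteq> 0"
  shows "integrable lborel (\<lambda>x. f (t + c *\<^sub>R x))"
proof -
  have [measurable]: "f \<in> borel_measurable borel" using f by auto
  have "(\<integral>\<^sup>+x. norm (f x) \<partial>lborel) < \<infinity>" using f by (simp add: integrable_iff_bounded)
  then have "\<bar>c\<bar>^DIM('a) * (\<integral>\<^sup>+x. norm (f (t + c *\<^sub>R x)) \<partial>lborel) < \<infinity>"
    by (subst (asm) nn_integral_lborel_affine[OF _ c, of _ t]) (auto simp: ennreal_power)
  then have "(\<integral>\<^sup>+x. norm (f (t + c *\<^sub>R x)) \<partial>lborel) < \<infinity>"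
    using c by (auto simp: ennreal_mult_less_top)
  then show ?thesis by (intro integrableI_bounded) auto
qed

lemma lborel_translate:
  fixes f :: "'a::euclidean_space \<Rightarrow> 'b::{banach, second_countable_topology}"
  assumes "integrable lborel f"
  shows "integrable lborel (\<lambda>x. f (x - a))" "(\<integral>x. f (x - a) \<partial>lborel) = (\<integral>x. f x \<partial>lborel)"
    "integrable lborel (\<lambda>x. f (a - x))" "(\<integral>x. f (a - x) \<partial>lborel) = (\<integral>x. f x \<partial>lborel)"
  using assms integrable_lborel_affine[OF assms, of 1 "-a"] integrable_lborel_affine[OF assms, of "-1" a]
    integral_lborel_affine[of f 1 "-a"] integral_lborel_affine[of f "-1" a]
  by (auto dest: borel_measurable_integrable)

lemma integrable_lborel_pair_mult:
  fixes f :: "'a::euclidean_space \<Rightarrow> real" and g :: "'b::euclidean_space \<Rightarrow> real"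
  assumes f: "integrable lborel f" and g: "integrable lborel g"
  shows "integrable (lborel \<Otimes>\<^sub>M lborel) (\<lambda>(x, y). f x * g y)"
proof (rule lborel_pair.Fubini_integrable)
  have [measurable]: "f \<in> borel_measurable borel" "g \<in> borel_measurable borel" using f g by auto
  show "(\<lambda>(x, y). f x * g y) \<in> borel_measurable (lborel \<Otimes>\<^sub>M lborel)" by measurable
qed (use f g in \<open>auto simp: abs_mult\<close>)

lemma integrable_lborel_pair_shear_mult:
  fixes f g :: "'a::euclidean_space \<Rightarrow> real"
  assumes f: "integrable lborel f" and g: "integrable lborel g"
  shows "integrable (lborel \<Otimes>\<^sub>M lborel) (\<lambda>(x, w). f x * g (x - w))"
proof (rule lborel_pair.Fubini_integrable)
  have [measurable]: "f \<in> borel_measurable borel" "g \<in> borel_measurable borel" using f g by auto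
  show "(\<lambda>(x, w). f x * g (x - w)) \<in> borel_measurable (lborel \<Otimes>\<^sub>M lborel)" by measurable
qed (use f g lborel_translate(3)[OF g] lborel_translate(4)[of "\<lambda>w. \<bar>g w\<bar>"] in \<open>auto simp: abs_mult\<close>)

definition ft :: "('a::euclidean_space \<Rightarrow> real) \<Rightarrow> 'a \<Rightarrow> complex" where
  "ft f \<xi> = (\<integral>x. complex_of_real (f x) * cis (\<xi> \<bullet> x) \<partial>lborel)"

lemma integrable_mult_cis:
  assumes f: "integrable lborel f"
  shows "integrable lborel (\<lambda>x. complex_of_real (f x) * cis (\<xi> \<bullet> x))"
proof -
  have [measurable]: "f \<in> borel_measurable borel" using f by auto
  show ?thesis by (rule Bochner_Integration.integrable_bound[OF f]) (auto simp: norm_mult)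
qed

lemma ft_dilation:
  fixes f :: "'a::euclidean_space \<Rightarrow> real"
  assumes [measurable]: "f \<in> borel_measurable borel" and e: "0 < e"
  shows "ft (\<lambda>x. f (e *\<^sub>R x)) \<xi> = ft f (\<xi> /\<^sub>R e) / complex_of_real (e ^ DIM('a))"
proof -
  have "ft f (\<xi> /\<^sub>R e) = e ^ DIM('a) *\<^sub>R (\<integral>x. complex_of_real (f (e *\<^sub>R x)) * cis ((\<xi> /\<^sub>R e) \<bullet> (e *\<^sub>R x)) \<partial>lborel)"
    unfolding ft_def using e by (subst integral_lborel_affine[of _ e 0]) auto
  also have "(\<lambda>x. cis ((\<xi> /\<^sub>R e) \<bullet> (e *\<^sub>R x))) = (\<lambda>x. cis (\<xi> \<bullet> x))"
    using e by (simp flip: mult.assoc)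
  finally show ?thesis using e by (simp add: ft_def scaleR_conv_of_real)
qed

lemma integrable_multiplication_kernel:
  fixes f h :: "'a::euclidean_space \<Rightarrow> real"
  assumes f: "integrable lborel f" and h: "integrable lborel h"
  shows "integrable (lborel \<Otimes>\<^sub>M lborel) (\<lambda>(x, \<xi>). complex_of_real (f x * h \<xi>) * cis (\<xi> \<bullet> x))"
proof (rule Bochner_Integration.integrable_bound[OF integrable_lborel_pair_mult[OF f h]])
  have [measurable]: "f \<in> borel_measurable borel" "h \<in> borel_measurable borel" using f h by auto
  show "(\<lambda>(x, \<xi>). complex_of_real (f x * h \<xi>) * cis (\<xi> \<bullet> x)) \<in> borel_measurable (lborel \<Otimes>\<^sub>M lborel)"
    by measurable
qed (auto simp: norm_mult)

lemma integral_ft_mult: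
  fixes f h :: "'a::euclidean_space \<Rightarrow> real"
  assumes f: "integrable lborel f" and h: "integrable lborel h"
  shows "integrable lborel (\<lambda>\<xi>. ft f \<xi> * complex_of_real (h \<xi>))"
    and "(\<integral>\<xi>. ft f \<xi> * complex_of_real (h \<xi>) \<partial>lborel) = (\<integral>x. complex_of_real (f x) * ft h x \<partial>lborel)"
proof -
  note kernel = integrable_multiplication_kernel[OF f h]
  have over_x: "(\<integral>x. complex_of_real (f x * h \<xi>) * cis (\<xi> \<bullet> x) \<partial>lborel) = ft f \<xi> * complex_of_real (h \<xi>)" for \<xi>
  proof -
    have "(\<integral>x. complex_of_real (f x * h \<xi>) * cis (\<xi> \<bullet> x) \<partial>lborel)
        = (\<integral>x. (complex_of_real (f x) * cis (\<xi> \<bullet> x)) * complex_of_real (h \<xi>) \<partial>lborel)"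
      by (intro Bochner_Integration.integral_cong) auto
    then show ?thesis unfolding ft_def by (simp only: integral_mult_left_zero)
  qed
  have over_\<xi>: "(\<integral>\<xi>. complex_of_real (f x * h \<xi>) * cis (\<xi> \<bullet> x) \<partial>lborel) = complex_of_real (f x) * ft h x" for x
  proof -
    have "(\<integral>\<xi>. complex_of_real (f x * h \<xi>) * cis (\<xi> \<bullet> x) \<partial>lborel)
        = (\<integral>\<xi>. complex_of_real (f x) * (complex_of_real (h \<xi>) * cis (x \<bullet> \<xi>)) \<partial>lborel)"
      by (intro Bochner_Integration.integral_cong) (auto simp: inner_commute)
    then show ?thesis unfolding ft_def by (simp only: integral_mult_right_zero)
  qed
  show "integrable lborel (\<lambda>\<xi>. ft f \<xi> * complex_of_real (h \<xi>))"
    using lborel_pair.integrable_snd[OF kernel] unfolding over_x .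
  show "(\<integral>\<xi>. ft f \<xi> * complex_of_real (h \<xi>) \<partial>lborel) = (\<integral>x. complex_of_real (f x) * ft h x \<partial>lborel)"
    using lborel_pair.Fubini_integral[OF kernel] unfolding over_x over_\<xi> .
qed

definition gauss :: "'a::euclidean_space \<Rightarrow> real" where
  "gauss x = exp (- (norm x)\<^sup>2 / 2)"

definition gauss_mass :: "'a::euclidean_space itself \<Rightarrow> real" where
  "gauss_mass _ = sqrt (2 * pi) ^ DIM('a)"

lemma gauss_nonneg [simp]: "0 \<le> gauss x"
  by (simp add: gauss_def)

lemma gauss_mass_pos: "0 < gauss_mass TYPE('a::euclidean_space)"
  by (simp add: gauss_mass_def)

lemma measurable_gauss [measurable]: "gauss \<in> borel_measurable borel"
  unfolding gauss_def by measurable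

lemma exp_square_mult_cis:
  "integrable lborel (\<lambda>x::real. complex_of_real (exp (- x\<^sup>2 / 2)) * cis (t * x))"
  "(\<integral>x. complex_of_real (exp (- x\<^sup>2 / 2)) * cis (t * x) \<partial>lborel)
     = complex_of_real (sqrt (2 * pi) * exp (- t\<^sup>2 / 2))"
proof -
  have exp_eq_density: "exp (- x\<^sup>2 / 2) = sqrt (2 * pi) * std_normal_density x" for x :: real
    by (simp add: std_normal_density_def)
  have integrable_exp: "integrable lborel (\<lambda>x. exp (- x\<^sup>2 / 2 :: real))"
    unfolding exp_eq_density by (intro integrable_mult_right integrable_normal_density) auto
  show "integrable lborel (\<lambda>x::real. complex_of_real (exp (- x\<^sup>2 / 2)) * cis (t * x))"
    by (rule Bochner_Integration.integrable_bound[OF integrable_exp]) (auto simp: norm_mult)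
  have "complex_of_real (exp (- t\<^sup>2 / 2)) = char std_normal_distribution t"
    by (simp add: char_std_normal_distribution)
  also have "\<dots> = (\<integral>x. std_normal_density x *\<^sub>R iexp (t * x) \<partial>lborel)"
    unfolding char_def by (subst integral_density) (auto simp: normal_density_nonneg)
  finally have "complex_of_real (sqrt (2 * pi) * exp (- t\<^sup>2 / 2))
      = complex_of_real (sqrt (2 * pi)) * (\<integral>x. std_normal_density x *\<^sub>R iexp (t * x) \<partial>lborel)"
    by simp
  also have "\<dots> = (\<integral>x. complex_of_real (sqrt (2 * pi)) * (std_normal_density x *\<^sub>R iexp (t * x)) \<partial>lborel)"
    by (rule integral_mult_right_zero[symmetric])
  also have "\<dots> = (\<integral>x. complex_of_real (exp (- x\<^sup>2 / 2)) * cis (t * x) \<partial>lborel)"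
    unfolding exp_eq_density
    by (intro Bochner_Integration.integral_cong) (auto simp: scaleR_conv_of_real cis_conv_exp)
  finally show "(\<integral>x. complex_of_real (exp (- x\<^sup>2 / 2)) * cis (t * x) \<partial>lborel)
     = complex_of_real (sqrt (2 * pi) * exp (- t\<^sup>2 / 2))" by simp
qed

lemma cis_sum: "finite A \<Longrightarrow> cis (\<Sum>x\<in>A. f x) = (\<Prod>x\<in>A. cis (f x))"
  by (induction A rule: finite_induct) (auto simp flip: cis_mult)

lemma gauss_eq_prod: "gauss x = (\<Prod>b\<in>Basis. exp (- (x \<bullet> b)\<^sup>2 / 2))"
proof -
  have "- (norm x)\<^sup>2 / 2 = (\<Sum>b\<in>Basis. - (x \<bullet> b)\<^sup>2 / 2)"
    unfolding power2_norm_eq_inner euclidean_inner[of x x]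
    by (simp add: sum_divide_distrib sum_negf power2_eq_square)
  then show ?thesis by (simp add: gauss_def exp_sum)
qed

lemma ft_gauss: "ft gauss t = complex_of_real (gauss_mass TYPE('a) * gauss (t::'a::euclidean_space))"
proof -
  interpret product_sigma_finite "\<lambda>_::'a. lborel :: real measure" ..
  have "ft gauss t = (\<integral>x. (\<Prod>b\<in>Basis. complex_of_real (exp (- (x \<bullet> b)\<^sup>2 / 2)) * cis ((t \<bullet> b) * (x \<bullet> b))) \<partial>lborel)"
  proof -
    have "cis (t \<bullet> x) = (\<Prod>b\<in>Basis. cis ((t \<bullet> b) * (x \<bullet> b)))" for x
      by (subst euclidean_inner) (simp add: cis_sum)
    then show ?thesis by (simp add: ft_def gauss_eq_prod prod.distrib)
  qed
  also have "\<dots> = (\<integral>f. (\<Prod>b\<in>Basis. complex_of_real (exp (- (f b)\<^sup>2 / 2)) * cis ((t \<bullet> b) * f b))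
      \<partial>(\<Pi>\<^sub>M b\<in>(Basis::'a set). lborel))"
  proof (subst lborel_eq, subst integral_distr)
    show "(\<integral>f. (\<Prod>b\<in>Basis. complex_of_real (exp (- ((\<Sum>c\<in>Basis. f c *\<^sub>R c) \<bullet> b)\<^sup>2 / 2)) *
            cis ((t \<bullet> b) * ((\<Sum>c\<in>Basis. f c *\<^sub>R c) \<bullet> b))) \<partial>(\<Pi>\<^sub>M b\<in>(Basis::'a set). lborel))
        = (\<integral>f. (\<Prod>b\<in>Basis. complex_of_real (exp (- (f b)\<^sup>2 / 2)) * cis ((t \<bullet> b) * f b))
            \<partial>(\<Pi>\<^sub>M b\<in>(Basis::'a set). lborel))"
      by (intro Bochner_Integration.integral_cong refl prod.cong)
         (simp_all add: inner_sum_left inner_Basis if_distrib sum.delta cong: if_cong)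
  qed measurable
  also have "\<dots> = (\<Prod>b\<in>(Basis::'a set). \<integral>x. complex_of_real (exp (- x\<^sup>2 / 2)) * cis ((t \<bullet> b) * x) \<partial>lborel)"
    by (rule product_integral_prod[OF _ exp_square_mult_cis(1)]) simp
  also have "\<dots> = complex_of_real (gauss_mass TYPE('a) * gauss t)"
    unfolding exp_square_mult_cis(2) gauss_eq_prod gauss_mass_def
    by (simp add: prod.distrib del: of_real_mult flip: of_real_prod)
  finally show ?thesis .
qed

lemma integrable_gauss: "integrable lborel (gauss :: 'a::euclidean_space \<Rightarrow> real)"
proof -
  have "ft gauss (0::'a) \<noteq> 0"
    using gauss_mass_pos[where 'a='a] by (simp add: ft_gauss gauss_def)
  then have "integrable lborel (\<lambda>x::'a. complex_of_real (gauss x))"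
    using not_integrable_integral_eq[of lborel "\<lambda>x::'a. complex_of_real (gauss x)"]
    by (auto simp: ft_def simp del: integral_complex_of_real)
  then show ?thesis using integrable_Re by fastforce
qed

lemma integral_gauss: "integral\<^sup>L lborel (gauss :: 'a::euclidean_space \<Rightarrow> real) = gauss_mass TYPE('a)"
proof -
  have "complex_of_real (\<integral>x. gauss x \<partial>(lborel::'a measure)) = complex_of_real (gauss_mass TYPE('a))"
    using ft_gauss[of "0::'a"] by (simp add: ft_def gauss_def[of 0])
  then show ?thesis by (simp only: of_real_eq_iff)
qed

definition autocorrelation :: "('a::euclidean_space \<Rightarrow> real) \<Rightarrow> 'a \<Rightarrow> real" where
  "autocorrelation g w = (\<integral>x. g x * g (x - w) \<partial>lborel)"

lemma integrable_autocorrelation: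
  assumes g: "integrable lborel g"
  shows "integrable lborel (autocorrelation g)"
  using lborel_pair.integrable_snd[OF integrable_lborel_pair_shear_mult[OF g g]]
  by (simp add: autocorrelation_def[abs_def])

lemma ft_autocorrelation:
  assumes g: "integrable lborel g"
  shows "ft (autocorrelation g) \<xi> = complex_of_real ((cmod (ft g \<xi>))\<^sup>2)"
proof -
  have [measurable]: "g \<in> borel_measurable borel" using g by auto
  let ?k = "\<lambda>x w. complex_of_real (g x * g (x - w)) * cis (\<xi> \<bullet> w)"
  have integrable_kernel: "integrable (lborel \<Otimes>\<^sub>M lborel) (\<lambda>(x, w). ?k x w)"
    by (rule Bochner_Integration.integrable_bound[OF integrable_lborel_pair_shear_mult[OF g g]])
       (measurable, auto simp: norm_mult)
  have "ft (autocorrelation g) \<xi> = (\<integral>w. \<integral>x. ?k x w \<partial>lborel \<partial>lborel)"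
    unfolding ft_def autocorrelation_def
    by (simp flip: integral_complex_of_real)
  also have "\<dots> = (\<integral>x. \<integral>w. ?k x w \<partial>lborel \<partial>lborel)"
    by (rule lborel_pair.Fubini_integral[OF integrable_kernel])
  also have "\<dots> = (\<integral>x. (complex_of_real (g x) * cis (\<xi> \<bullet> x)) * cnj (ft g \<xi>) \<partial>lborel)"
  proof (rule Bochner_Integration.integral_cong[OF refl])
    fix x
    have "(\<integral>w. ?k x w \<partial>lborel)
        = (\<integral>w. (complex_of_real (g x) * cis (\<xi> \<bullet> x)) * cnj (complex_of_real (g (x - w)) * cis (\<xi> \<bullet> (x - w)))
            \<partial>lborel)"
      by (intro Bochner_Integration.integral_cong refl)
         (simp add: cis_cnj inner_diff_right mult_ac cis_mult)
    also have "\<dots> = (complex_of_real (g x) * cis (\<xi> \<bullet> x))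
        * cnj (\<integral>w. complex_of_real (g (x - w)) * cis (\<xi> \<bullet> (x - w)) \<partial>lborel)"
      by (simp only: integral_mult_right_zero Bochner_Integration.integral_cnj)
    also have "(\<integral>w. complex_of_real (g (x - w)) * cis (\<xi> \<bullet> (x - w)) \<partial>lborel) = ft g \<xi>"
      unfolding ft_def by (rule lborel_translate(4)[OF integrable_mult_cis[OF g]])
    finally show "(\<integral>w. ?k x w \<partial>lborel) = (complex_of_real (g x) * cis (\<xi> \<bullet> x)) * cnj (ft g \<xi>)" .
  qed
  also have "\<dots> = ft g \<xi> * cnj (ft g \<xi>)"
    unfolding ft_def[of g \<xi>] by (rule integral_mult_left_zero)
  finally show ?thesis by (simp only: complex_norm_square)
qed

lemma integral_ft_square_gauss:
  fixes g :: "'a::euclidean_space \<Rightarrow> real"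
  assumes g: "integrable lborel g" and e: "0 < e"
  shows "integrable lborel (\<lambda>\<xi>. (cmod (ft g \<xi>))\<^sup>2 * gauss (e *\<^sub>R \<xi>))"
    and "(\<integral>\<xi>. (cmod (ft g \<xi>))\<^sup>2 * gauss (e *\<^sub>R \<xi>) \<partial>lborel)
       = gauss_mass TYPE('a) * (\<integral>z. autocorrelation g (e *\<^sub>R z) * gauss z \<partial>lborel)"
proof -
  let ?A = "autocorrelation g"
  have A: "integrable lborel ?A" by (rule integrable_autocorrelation[OF g])
  then have [measurable]: "?A \<in> borel_measurable borel" by auto
  have dilated_gauss: "integrable lborel (\<lambda>\<xi>::'a. gauss (e *\<^sub>R \<xi>))"
    using integrable_lborel_affine[OF integrable_gauss, of e 0] e by simp
  have product: "ft ?A \<xi> * complex_of_real (gauss (e *\<^sub>R \<xi>))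
      = complex_of_real ((cmod (ft g \<xi>))\<^sup>2 * gauss (e *\<^sub>R \<xi>))" for \<xi>
    by (simp add: ft_autocorrelation[OF g])
  show "integrable lborel (\<lambda>\<xi>. (cmod (ft g \<xi>))\<^sup>2 * gauss (e *\<^sub>R \<xi>))"
    using integrable_Re[OF integral_ft_mult(1)[OF A dilated_gauss]] unfolding product by simp
  have "complex_of_real (\<integral>\<xi>. (cmod (ft g \<xi>))\<^sup>2 * gauss (e *\<^sub>R \<xi>) \<partial>lborel)
      = (\<integral>x. complex_of_real (?A x) * ft (\<lambda>\<xi>. gauss (e *\<^sub>R \<xi>)) x \<partial>lborel)"
    using integral_ft_mult(2)[OF A dilated_gauss] unfolding product integral_complex_of_real .
  also have "\<dots> = complex_of_real (\<integral>x. ?A x * (gauss_mass TYPE('a) * gauss (x /\<^sub>R e) / e ^ DIM('a)) \<partial>lborel)"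
    unfolding ft_dilation[OF measurable_gauss e] ft_gauss by (simp flip: integral_complex_of_real)
  finally have "(\<integral>\<xi>. (cmod (ft g \<xi>))\<^sup>2 * gauss (e *\<^sub>R \<xi>) \<partial>lborel)
      = (\<integral>x. ?A x * (gauss_mass TYPE('a) * gauss (x /\<^sub>R e) / e ^ DIM('a)) \<partial>lborel)"
    by (simp only: of_real_eq_iff)
  also have "\<dots> = e ^ DIM('a) *\<^sub>R (\<integral>z. ?A (e *\<^sub>R z) * (gauss_mass TYPE('a) * gauss z / e ^ DIM('a)) \<partial>lborel)"
    using e by (subst integral_lborel_affine[of _ e 0]) auto
  also have "\<dots> = (\<integral>z. gauss_mass TYPE('a) * (?A (e *\<^sub>R z) * gauss z) \<partial>lborel)"
    unfolding integral_scaleR_right[symmetric] using e by (intro Bochner_Integration.integral_cong) auto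
  finally show "(\<integral>\<xi>. (cmod (ft g \<xi>))\<^sup>2 * gauss (e *\<^sub>R \<xi>) \<partial>lborel)
       = gauss_mass TYPE('a) * (\<integral>z. ?A (e *\<^sub>R z) * gauss z \<partial>lborel)"
    by (simp only: integral_mult_right_zero)
qed

definition Cc :: "('a::euclidean_space \<Rightarrow> real) \<Rightarrow> bool" where
  "Cc f \<longleftrightarrow> continuous_on UNIV f \<and> (\<exists>R. \<forall>x. R < norm x \<longrightarrow> f x = 0)"

lemma Cc_measurable: "Cc f \<Longrightarrow> f \<in> borel_measurable borel"
  by (auto simp: Cc_def intro: borel_measurable_continuous_onI)

lemma Cc_bound:
  assumes "Cc f"
  obtains B R where "0 \<le> B" "0 \<le> R" "\<And>x. \<bar>f x\<bar> \<le> B" "\<And>x. R < norm x \<Longrightarrow> f x = 0"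
proof -
  obtain R where R: "\<And>x. R < norm x \<Longrightarrow> f x = 0" using assms by (auto simp: Cc_def)
  have "bounded (f ` cball 0 R)"
    using assms by (intro compact_imp_bounded compact_continuous_image)
      (auto simp: Cc_def intro: continuous_on_subset)
  then obtain B where B: "\<And>x. x \<in> cball 0 R \<Longrightarrow> \<bar>f x\<bar> \<le> B"
    unfolding bounded_iff by (metis image_eqI real_norm_def)
  show thesis
  proof (rule that[of "max 0 B" "max 0 R"])
    show "\<bar>f x\<bar> \<le> max 0 B" for x
      using B[of x] R[of x] by (cases "norm x \<le> R") auto
  qed (use R in auto)
qed

lemma integrable_bounded_support:
  fixes f :: "'a::euclidean_space \<Rightarrow> 'b::{banach, second_countable_topology}"
  assumes [measurable]: "f \<in> borel_measurable borel"
    and "\<And>x. norm (f x) \<le> B" "\<And>x. R < norm x \<Longrightarrow> f x = 0"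
  shows "integrable lborel f"
proof (rule Bochner_Integration.integrable_bound)
  show "integrable lborel (\<lambda>x::'a. B * indicator (cball 0 R) x)"
    by (intro integrable_mult_right integrable_real_indicator)
       (use emeasure_bounded_finite[of "cball 0 R :: 'a set"] in auto)
  show "AE x in lborel. norm (f x) \<le> norm (B * indicator (cball 0 R) x :: real)"
    using assms(2,3) by (intro AE_I2) (auto simp: indicator_def intro: order_trans[OF _ abs_ge_self])
qed auto

lemma Cc_integrable: "Cc f \<Longrightarrow> integrable lborel f"
  by (metis Cc_bound Cc_measurable integrable_bounded_support real_norm_def)

lemma Cc_mult: "Cc f \<Longrightarrow> continuous_on UNIV g \<Longrightarrow> Cc (\<lambda>x. f x * g x)"
  by (auto simp: Cc_def intro!: continuous_intros)

lemma Cc_square_integrable: "Cc f \<Longrightarrow> integrable lborel (\<lambda>x. (f x)\<^sup>2)"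
  unfolding power2_eq_square by (intro Cc_integrable Cc_mult) (auto simp: Cc_def)

lemma integrable_autocorrelation_integrand:
  assumes "Cc g"
  shows "integrable lborel (\<lambda>x. g x * g (x - w))"
proof -
  obtain B where B: "\<And>x. \<bar>g x\<bar> \<le> B" using Cc_bound[OF assms] by metis
  have [measurable]: "g \<in> borel_measurable borel" by (rule Cc_measurable[OF assms])
  have "integrable lborel (\<lambda>x. g x * B)" using Cc_integrable[OF assms] by simp
  then show ?thesis
    by (rule Bochner_Integration.integrable_bound)
       (auto simp: abs_mult intro!: mult_left_mono order_trans[OF B abs_ge_self])
qed

lemma autocorrelation_le:
  assumes "Cc g"
  shows "\<bar>autocorrelation g w\<bar> \<le> (\<integral>x. (g x)\<^sup>2 \<partial>lborel)"
proof -
  note square = Cc_square_integrable[OF assms]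
  have "\<bar>autocorrelation g w\<bar> \<le> (\<integral>x. \<bar>g x * g (x - w)\<bar> \<partial>lborel)"
    unfolding autocorrelation_def by (rule integral_abs_bound)
  also have "\<dots> \<le> (\<integral>x. ((g x)\<^sup>2 + (g (x - w))\<^sup>2) / 2 \<partial>lborel)"
  proof (rule integral_mono)
    show "integrable lborel (\<lambda>x. \<bar>g x * g (x - w)\<bar>)"
      using integrable_autocorrelation_integrand[OF assms] by simp
    show "integrable lborel (\<lambda>x. ((g x)\<^sup>2 + (g (x - w))\<^sup>2) / 2)"
      using square lborel_translate(1)[OF square] by auto
    show "\<bar>g x * g (x - w)\<bar> \<le> ((g x)\<^sup>2 + (g (x - w))\<^sup>2) / 2" for x
      using sum_squares_bound[of "\<bar>g x\<bar>" "\<bar>g (x - w)\<bar>"] by (simp add: abs_mult)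
  qed
  also have "\<dots> = (\<integral>x. (g x)\<^sup>2 \<partial>lborel)"
    using square lborel_translate(1,2)[OF square] by simp
  finally show ?thesis .
qed

lemma autocorrelation_tendsto:
  assumes "Cc g" and w: "w \<longlonglongrightarrow> 0"
  shows "(\<lambda>n. autocorrelation g (w n)) \<longlonglongrightarrow> (\<integral>x. (g x)\<^sup>2 \<partial>lborel)"
proof -
  obtain B where B: "\<And>x. \<bar>g x\<bar> \<le> B" using Cc_bound[OF assms(1)] by metis
  have [measurable]: "g \<in> borel_measurable borel" by (rule Cc_measurable[OF assms(1)])
  show ?thesis
    unfolding autocorrelation_def
  proof (rule integral_dominated_convergence)
    show "integrable lborel (\<lambda>x. \<bar>g x\<bar> * B)" using Cc_integrable[OF assms(1)] by simp
    show "AE x in lborel. norm (g x * g (x - w n)) \<le> \<bar>g x\<bar> * B" for n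
      by (intro AE_I2) (auto simp: abs_mult intro!: mult_left_mono B)
    have "(\<lambda>n. g x * g (x - w n)) \<longlonglongrightarrow> g x * g (x - 0)" for x
    proof -
      have "isCont g (x - 0)" using assms(1) by (auto simp: Cc_def continuous_on_eq_continuous_at)
      then show ?thesis by (intro tendsto_intros isCont_tendsto_compose[of _ g] w)
    qed
    then show "AE x in lborel. (\<lambda>n. g x * g (x - w n)) \<longlonglongrightarrow> (g x)\<^sup>2"
      by (simp add: power2_eq_square)
  qed measurable
qed

lemma integrable_autocorrelation_gauss:
  fixes g :: "'a::euclidean_space \<Rightarrow> real"
  assumes "Cc g"
  shows "integrable lborel (\<lambda>z. autocorrelation g (e *\<^sub>R z) * gauss z)"
proof (rule Bochner_Integration.integrable_bound)
  have [measurable]: "autocorrelation g \<in> borel_measurable borel"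
    using integrable_autocorrelation[OF Cc_integrable[OF assms]] by auto
  show "(\<lambda>z. autocorrelation g (e *\<^sub>R z) * gauss z) \<in> borel_measurable lborel" by measurable
  show "integrable lborel (\<lambda>z::'a. (\<integral>x. (g x)\<^sup>2 \<partial>lborel) * gauss z)"
    by (intro integrable_mult_right integrable_gauss)
qed (auto simp: abs_mult intro!: mult_right_mono autocorrelation_le[OF assms])

lemma autocorrelation_gauss_le:
  fixes g :: "'a::euclidean_space \<Rightarrow> real"
  assumes "Cc g"
  shows "(\<integral>z. autocorrelation g (e *\<^sub>R z) * gauss z \<partial>lborel) \<le> gauss_mass TYPE('a) * (\<integral>x. (g x)\<^sup>2 \<partial>lborel)"
proof -
  have "(\<integral>z. autocorrelation g (e *\<^sub>R z) * gauss z \<partial>lborel) \<le> (\<integral>z. (\<integral>x. (g x)\<^sup>2 \<partial>lborel) * gauss (z::'a) \<partial>lborel)"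
    using abs_le_D1[OF autocorrelation_le[OF assms]]
    by (intro integral_mono integrable_autocorrelation_gauss assms mult_right_mono integrable_mult_right
        integrable_gauss) auto
  then show ?thesis by (simp add: integral_gauss mult.commute)
qed

lemma autocorrelation_gauss_tendsto:
  fixes g :: "'a::euclidean_space \<Rightarrow> real"
  assumes "Cc g" and e: "e \<longlonglongrightarrow> 0"
  shows "(\<lambda>n. \<integral>z. autocorrelation g (e n *\<^sub>R z) * gauss z \<partial>lborel) \<longlonglongrightarrow> gauss_mass TYPE('a) * (\<integral>x. (g x)\<^sup>2 \<partial>lborel)"
proof -
  let ?I = "\<integral>x. (g x)\<^sup>2 \<partial>lborel"
  have [measurable]: "autocorrelation g \<in> borel_measurable borel"
    using integrable_autocorrelation[OF Cc_integrable[OF assms(1)]] by auto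
  have "(\<lambda>n. \<integral>z. autocorrelation g (e n *\<^sub>R z) * gauss z \<partial>lborel) \<longlonglongrightarrow> (\<integral>z. ?I * gauss (z::'a) \<partial>lborel)"
  proof (rule integral_dominated_convergence)
    show "integrable lborel (\<lambda>z::'a. ?I * gauss z)"
      by (intro integrable_mult_right integrable_gauss)
    show "AE z in lborel. norm (autocorrelation g (e n *\<^sub>R z) * gauss z) \<le> ?I * gauss z" for n
      by (intro AE_I2) (auto simp: abs_mult intro!: mult_right_mono autocorrelation_le[OF assms(1)])
    have "(\<lambda>n. e n *\<^sub>R z) \<longlonglongrightarrow> 0" for z :: 'a using tendsto_scaleR[OF e tendsto_const[of z]] by simp
    then show "AE z in lborel. (\<lambda>n. autocorrelation g (e n *\<^sub>R z) * gauss z) \<longlonglongrightarrow> ?I * gauss z"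
      by (intro AE_I2 tendsto_mult tendsto_const autocorrelation_tendsto assms(1))
  qed measurable
  then show ?thesis by (simp add: integral_gauss mult.commute)
qed

lemma ft_square_gauss_sum_le:
  fixes f :: "'a::euclidean_space \<Rightarrow> real"
  assumes f: "integrable lborel f" and g: "\<And>k. k \<in> K \<Longrightarrow> integrable lborel (g k)"
    and pointwise: "\<And>\<xi>. (\<Sum>k\<in>K. (cmod (ft (g k) \<xi>))\<^sup>2) \<le> C * (cmod (ft f \<xi>))\<^sup>2" and e: "0 < e"
  shows "(\<Sum>k\<in>K. \<integral>z. autocorrelation (g k) (e *\<^sub>R z) * gauss z \<partial>lborel)
      \<le> C * (\<integral>z. autocorrelation f (e *\<^sub>R z) * gauss z \<partial>lborel)"
proof -
  let ?N = "gauss_mass TYPE('a)"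
  have "?N * (\<Sum>k\<in>K. \<integral>z. autocorrelation (g k) (e *\<^sub>R z) * gauss z \<partial>lborel)
      = (\<Sum>k\<in>K. \<integral>\<xi>. (cmod (ft (g k) \<xi>))\<^sup>2 * gauss (e *\<^sub>R \<xi>) \<partial>lborel)"
    unfolding sum_distrib_left by (intro sum.cong refl integral_ft_square_gauss(2)[symmetric] e g)
  also have "\<dots> = (\<integral>\<xi>. (\<Sum>k\<in>K. (cmod (ft (g k) \<xi>))\<^sup>2 * gauss (e *\<^sub>R \<xi>)) \<partial>lborel)"
    by (intro Bochner_Integration.integral_sum[symmetric] integral_ft_square_gauss(1) e g)
  also have "\<dots> \<le> (\<integral>\<xi>. C * ((cmod (ft f \<xi>))\<^sup>2 * gauss (e *\<^sub>R \<xi>)) \<partial>lborel)"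
  proof (rule integral_mono)
    show "integrable lborel (\<lambda>\<xi>. \<Sum>k\<in>K. (cmod (ft (g k) \<xi>))\<^sup>2 * gauss (e *\<^sub>R \<xi>))"
      by (intro Bochner_Integration.integrable_sum integral_ft_square_gauss(1) e g)
    show "integrable lborel (\<lambda>\<xi>. C * ((cmod (ft f \<xi>))\<^sup>2 * gauss (e *\<^sub>R \<xi>)))"
      by (intro integrable_mult_right integral_ft_square_gauss(1) e f)
    show "(\<Sum>k\<in>K. (cmod (ft (g k) \<xi>))\<^sup>2 * gauss (e *\<^sub>R \<xi>)) \<le> C * ((cmod (ft f \<xi>))\<^sup>2 * gauss (e *\<^sub>R \<xi>))" for \<xi>
      using mult_right_mono[OF pointwise[of \<xi>] gauss_nonneg[of "e *\<^sub>R \<xi>"]]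
      by (simp add: sum_distrib_right mult.assoc)
  qed
  also have "\<dots> = ?N * (C * (\<integral>z. autocorrelation f (e *\<^sub>R z) * gauss z \<partial>lborel))"
    by (simp add: integral_ft_square_gauss(2)[OF f e])
  finally show ?thesis using gauss_mass_pos[where 'a='a] by simp
qed

text \<open>This replaces Plancherel's theorem: the integral of \<open>|ft g|\<^sup>2\<close> damped by a wide Gaussian is a Gaussian
  average of the autocorrelation of \<open>g\<close>, which is at most its value \<open>\<parallel>g\<parallel>\<^sup>2\<close> at the origin and tends to it as the
  damping is removed.\<close>

lemma sum_L2_le_of_ft_le:
  fixes f :: "'a::euclidean_space \<Rightarrow> real"
  assumes f: "Cc f" and g: "\<And>k. k \<in> K \<Longrightarrow> Cc (g k)" and C: "0 \<le> C"
    and pointwise: "\<And>\<xi>. (\<Sum>k\<in>K. (cmod (ft (g k) \<xi>))\<^sup>2) \<le> C * (cmod (ft f \<xi>))\<^sup>2"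
  shows "(\<Sum>k\<in>K. \<integral>x. (g k x)\<^sup>2 \<partial>lborel) \<le> C * (\<integral>x. (f x)\<^sup>2 \<partial>lborel)"
proof -
  let ?N = "gauss_mass TYPE('a)"
  define e :: "nat \<Rightarrow> real" where "e n = 1 / real (Suc n)" for n
  have e: "0 < e n" for n by (simp add: e_def)
  have e_to_0: "e \<longlonglongrightarrow> 0" unfolding e_def using LIMSEQ_inverse_real_of_nat by (simp add: inverse_eq_divide)
  have "(\<Sum>k\<in>K. \<integral>z. autocorrelation (g k) (e n *\<^sub>R z) * gauss z \<partial>lborel) \<le> C * (?N * (\<integral>x. (f x)\<^sup>2 \<partial>lborel))" for n
    using ft_square_gauss_sum_le[of f K g C, OF _ _ pointwise e[of n]]
      mult_left_mono[OF autocorrelation_gauss_le[OF f, of "e n"] C]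
    by (simp add: Cc_integrable f g)
  moreover have "(\<lambda>n. \<Sum>k\<in>K. \<integral>z. autocorrelation (g k) (e n *\<^sub>R z) * gauss z \<partial>lborel)
      \<longlonglongrightarrow> (\<Sum>k\<in>K. ?N * (\<integral>x. (g k x)\<^sup>2 \<partial>lborel))"
    by (intro tendsto_sum autocorrelation_gauss_tendsto g e_to_0)
  ultimately have "(\<Sum>k\<in>K. ?N * (\<integral>x. (g k x)\<^sup>2 \<partial>lborel)) \<le> C * (?N * (\<integral>x. (f x)\<^sup>2 \<partial>lborel))"
    by (intro LIMSEQ_le_const2) auto
  then show ?thesis
    using gauss_mass_pos[where 'a='a] by (simp add: sum_distrib_left[symmetric] mult.left_commute)
qed

section \<open>The dyadic maximal function of ball averages\<close>

definition L2_sq :: "('a::euclidean_space \<Rightarrow> ennreal) \<Rightarrow> ennreal" where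
  "L2_sq h = (\<integral>\<^sup>+x. (h x)\<^sup>2 \<partial>lborel)"

lemma L2_sq_mono: "(\<And>x. g x \<le> h x) \<Longrightarrow> L2_sq g \<le> L2_sq h"
  unfolding L2_sq_def by (intro nn_integral_mono power_mono_ennreal)

lemma L2_sq_cmult:
  "h \<in> borel_measurable borel \<Longrightarrow> L2_sq (\<lambda>x. c * h x) = c\<^sup>2 * L2_sq h"
  unfolding L2_sq_def by (simp add: power_mult_distrib nn_integral_cmult)

lemma square_add_le_ennreal: "(a + b)\<^sup>2 \<le> 2 * a\<^sup>2 + 2 * (b::ennreal)\<^sup>2"
proof -
  have "(a + b)\<^sup>2 = (a\<^sup>2 + b\<^sup>2) + 2 * a * b" by (rule power2_sum)
  also have "\<dots> \<le> (a\<^sup>2 + b\<^sup>2) + (a\<^sup>2 + b\<^sup>2)"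
    by (intro add_left_mono sum_of_squares_ge_ennreal)
  also have "\<dots> = 2 * a\<^sup>2 + 2 * b\<^sup>2" by (simp add: mult_2 ac_simps)
  finally show ?thesis .
qed

lemma L2_sq_add_le:
  assumes [measurable]: "g \<in> borel_measurable borel" "h \<in> borel_measurable borel"
  shows "L2_sq (\<lambda>x. g x + h x) \<le> 2 * L2_sq g + 2 * L2_sq h"
proof -
  have "L2_sq (\<lambda>x. g x + h x) \<le> (\<integral>\<^sup>+x. 2 * (g x)\<^sup>2 + 2 * (h x)\<^sup>2 \<partial>lborel)"
    unfolding L2_sq_def by (intro nn_integral_mono square_add_le_ennreal)
  then show ?thesis by (simp add: L2_sq_def nn_integral_add nn_integral_cmult)
qed

lemma L2_sq_SUP_le_sum:
  assumes "finite K" and h: "\<And>k. k \<in> K \<Longrightarrow> h k \<in> borel_measurable borel"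
  shows "L2_sq (\<lambda>x. SUP k\<in>K. h k x) \<le> (\<Sum>k\<in>K. L2_sq (h k))"
proof (cases "K = {}")
  case False
  have "(SUP k\<in>K. h k x)\<^sup>2 \<le> (\<Sum>k\<in>K. (h k x)\<^sup>2)" for x
  proof -
    have "(SUP k\<in>K. h k x) \<in> (\<lambda>k. h k x) ` K"
      using Max_in[of "(\<lambda>k. h k x) ` K"] \<open>finite K\<close> False by (simp add: Max_Sup)
    then obtain k where k: "k \<in> K" "(SUP k\<in>K. h k x) = h k x" by blast
    then show ?thesis
      using \<open>finite K\<close> member_le_sum[OF k(1), of "\<lambda>k. (h k x)\<^sup>2"] by simp
  qed
  then have "L2_sq (\<lambda>x. SUP k\<in>K. h k x) \<le> (\<integral>\<^sup>+x. (\<Sum>k\<in>K. (h k x)\<^sup>2) \<partial>lborel)"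
    unfolding L2_sq_def by (rule nn_integral_mono)
  also have "\<dots> = (\<Sum>k\<in>K. L2_sq (h k))"
    unfolding L2_sq_def using h by (intro nn_integral_sum) auto
  finally show ?thesis .
qed (simp add: L2_sq_def bot_ennreal)

lemma nn_integral_lborel_translate:
  fixes f :: "'a::euclidean_space \<Rightarrow> ennreal"
  assumes [measurable]: "f \<in> borel_measurable borel"
  shows "(\<integral>\<^sup>+x. f (x - a) \<partial>lborel) = (\<integral>\<^sup>+x. f x \<partial>lborel)"
  using nn_integral_lborel_affine[of f 1 "-a"] by auto

definition dilation_avg :: "'a::euclidean_space measure \<Rightarrow> real \<Rightarrow> ('a \<Rightarrow> ennreal) \<Rightarrow> 'a \<Rightarrow> ennreal" where
  "dilation_avg M r h x = (\<integral>\<^sup>+y. h (x - r *\<^sub>R y) \<partial>M)"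

lemma measurable_dilation_avg:
  assumes M: "finite_measure M" and [measurable_cong]: "sets M = sets borel"
    and [measurable]: "h \<in> borel_measurable borel"
  shows "dilation_avg M r h \<in> borel_measurable borel"
proof -
  interpret M: finite_measure M by fact
  interpret pair_sigma_finite M "lborel :: 'a measure" ..
  show ?thesis unfolding dilation_avg_def[abs_def] by measurable
qed

lemma L2_sq_dilation_avg_le:
  fixes h :: "'a::euclidean_space \<Rightarrow> ennreal"
  assumes M: "finite_measure M" and [measurable_cong]: "sets M = sets borel"
    and [measurable]: "h \<in> borel_measurable borel"
  shows "L2_sq (dilation_avg M r h) \<le> (emeasure M (space M))\<^sup>2 * L2_sq h"
proof -
  interpret M: finite_measure M by fact
  interpret pair_sigma_finite M "lborel :: 'a measure" ..
  let ?m = "emeasure M (space M)"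
  have "(dilation_avg M r h x)\<^sup>2 \<le> ?m * (\<integral>\<^sup>+y. (h (x - r *\<^sub>R y))\<^sup>2 \<partial>M)" for x
    unfolding dilation_avg_def
    using Cauchy_Schwarz_nn_integral[of "\<lambda>_. 1" M "\<lambda>y. h (x - r *\<^sub>R y)"] by simp
  then have "L2_sq (dilation_avg M r h) \<le> (\<integral>\<^sup>+x. ?m * (\<integral>\<^sup>+y. (h (x - r *\<^sub>R y))\<^sup>2 \<partial>M) \<partial>lborel)"
    unfolding L2_sq_def by (rule nn_integral_mono)
  also have "\<dots> = ?m * (\<integral>\<^sup>+x. \<integral>\<^sup>+y. (h (x - r *\<^sub>R y))\<^sup>2 \<partial>M \<partial>lborel)"
    by (intro nn_integral_cmult) measurable
  also have "(\<integral>\<^sup>+x. \<integral>\<^sup>+y. (h (x - r *\<^sub>R y))\<^sup>2 \<partial>M \<partial>lborel) = (\<integral>\<^sup>+y. \<integral>\<^sup>+x. (h (x - r *\<^sub>R y))\<^sup>2 \<partial>lborel \<partial>M)"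
    by (intro Fubini') measurable
  also have "\<dots> = (\<integral>\<^sup>+y. L2_sq h \<partial>M)"
    unfolding L2_sq_def by (intro nn_integral_cong nn_integral_lborel_translate) measurable
  also have "\<dots> = ?m * L2_sq h"
    by (simp add: mult.commute)
  finally show ?thesis by (simp add: power2_eq_square mult.assoc)
qed

lemma cball_borel [measurable]: "cball (a::'a::euclidean_space) r \<in> sets borel"
  by (simp add: borel_closed)

definition ball_vol :: "'a::euclidean_space itself \<Rightarrow> real" where
  "ball_vol _ = measure lborel (cball (0::'a) 1)"

lemma ball_vol_pos: "0 < ball_vol TYPE('a::euclidean_space)"
  unfolding ball_vol_def using content_cball_pos[of 1 "0::'a"] by simp

lemma emeasure_unit_cball: "emeasure lborel (cball (0::'a::euclidean_space) 1) = ball_vol TYPE('a)"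
  unfolding ball_vol_def
  by (intro emeasure_eq_ennreal_measure) (use emeasure_bounded_finite[of "cball (0::'a) 1"] in auto)

definition unit_ball_measure :: "'a::euclidean_space measure" where
  "unit_ball_measure = uniform_measure lborel (cball 0 1)"

lemma sets_unit_ball_measure [simp, measurable_cong]: "sets unit_ball_measure = sets borel"
  and space_unit_ball_measure [simp]: "space unit_ball_measure = UNIV"
  by (simp_all add: unit_ball_measure_def)

interpretation unit_ball: prob_space "unit_ball_measure :: 'a::euclidean_space measure"
  unfolding unit_ball_measure_def using ball_vol_pos[where 'a='a]
  by (intro prob_space_uniform_measure) (auto simp: emeasure_unit_cball)

definition ball_kernel :: "real \<Rightarrow> 'a::euclidean_space \<Rightarrow> ennreal" where
  "ball_kernel r z = ennreal (of_bool (norm z \<le> r) / (ball_vol TYPE('a) * r ^ DIM('a)))"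

lemma measurable_ball_kernel_pair:
  "(\<lambda>(r, z). ball_kernel r z) \<in> borel_measurable (borel \<Otimes>\<^sub>M borel)"
  unfolding ball_kernel_def by measurable

lemma measurable_ball_kernel [measurable (raw)]:
  assumes "f \<in> borel_measurable M" "g \<in> borel_measurable M"
  shows "(\<lambda>x. ball_kernel (f x) (g x)) \<in> borel_measurable M"
  using measurable_compose[OF measurable_Pair[OF assms] measurable_ball_kernel_pair] by simp

lemma ball_kernel_minus_commute: "ball_kernel r (x - y) = ball_kernel r (y - x)"
  by (simp add: ball_kernel_def norm_minus_commute)

definition ball_avg :: "real \<Rightarrow> ('a::euclidean_space \<Rightarrow> ennreal) \<Rightarrow> 'a \<Rightarrow> ennreal" where
  "ball_avg r h x = (\<integral>\<^sup>+y. ball_kernel r (x - y) * h y \<partial>lborel)"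

lemma measurable_ball_avg [measurable (raw)]:
  assumes [measurable]: "h \<in> borel_measurable borel" "f \<in> borel_measurable M" "g \<in> borel_measurable M"
  shows "(\<lambda>x. ball_avg (f x) h (g x)) \<in> borel_measurable M"
  unfolding ball_avg_def by measurable

lemma ball_avg_eq_dilation_avg:
  fixes h :: "'a::euclidean_space \<Rightarrow> ennreal"
  assumes [measurable]: "h \<in> borel_measurable borel" and r: "0 < r"
  shows "ball_avg r h x = dilation_avg unit_ball_measure r h x"
proof -
  let ?V = "ball_vol TYPE('a)" and ?B = "cball (0::'a) 1"
  have V: "0 < ?V" by (rule ball_vol_pos)
  have "ball_avg r h x = r ^ DIM('a) * (\<integral>\<^sup>+y. ball_kernel r (x - (x + (- r) *\<^sub>R y)) * h (x + (- r) *\<^sub>R y) \<partial>lborel)"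
    unfolding ball_avg_def using r by (subst nn_integral_lborel_affine[of _ "- r" x]) (auto simp: ennreal_power)
  also have "\<dots> = (\<integral>\<^sup>+y. r ^ DIM('a) * (ball_kernel r (r *\<^sub>R y) * h (x - r *\<^sub>R y)) \<partial>lborel)"
    by (subst nn_integral_cmult) auto
  also have "\<dots> = (\<integral>\<^sup>+y. (h (x - r *\<^sub>R y) * indicator ?B y) * ennreal (1 / ?V) \<partial>lborel)"
  proof (intro nn_integral_cong)
    fix y :: 'a
    have "ennreal (r ^ DIM('a)) * ball_kernel r (r *\<^sub>R y) = indicator ?B y * ennreal (1 / ?V)"
      using r V by (auto simp: ball_kernel_def indicator_def ennreal_mult[symmetric])
    then show "ennreal (r ^ DIM('a)) * (ball_kernel r (r *\<^sub>R y) * h (x - r *\<^sub>R y))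
       = (h (x - r *\<^sub>R y) * indicator ?B y) * ennreal (1 / ?V)"
      by (metis (no_types, lifting) mult.assoc mult.commute)
  qed
  also have "\<dots> = (\<integral>\<^sup>+y. h (x - r *\<^sub>R y) * indicator ?B y \<partial>lborel) / ennreal ?V"
    using V by (simp add: nn_integral_multc divide_ennreal_def inverse_ennreal inverse_eq_divide)
  also have "\<dots> = dilation_avg unit_ball_measure r h x"
    unfolding unit_ball_measure_def dilation_avg_def
    by (subst nn_integral_uniform_measure) (auto simp: emeasure_unit_cball)
  finally show ?thesis .
qed

lemma nn_integral_ball_kernel:
  assumes "0 < r"
  shows "(\<integral>\<^sup>+y. ball_kernel r (x - y) \<partial>lborel) = 1"
  using ball_avg_eq_dilation_avg[OF _ assms, of "\<lambda>_. 1" x] unit_ball.emeasure_space_1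
  by (simp add: ball_avg_def dilation_avg_def)

lemma L2_sq_ball_avg_le:
  fixes h :: "'a::euclidean_space \<Rightarrow> ennreal"
  assumes "h \<in> borel_measurable borel" and r: "0 < r"
  shows "L2_sq (ball_avg r h) \<le> L2_sq h"
proof -
  have "ball_avg r h = dilation_avg unit_ball_measure r h"
    using ball_avg_eq_dilation_avg[OF assms] by blast
  then show ?thesis
    using L2_sq_dilation_avg_le[OF unit_ball.finite_measure_axioms sets_unit_ball_measure assms(1), of r]
    unfolding unit_ball.emeasure_space_1 by simp
qed

lemma ball_kernel_double:
  fixes z :: "'a::euclidean_space"
  assumes "0 < s"
  shows "2 ^ DIM('a) * ball_kernel (2 * s) z
      = ennreal (of_bool (norm z \<le> 2 * s) / (ball_vol TYPE('a) * s ^ DIM('a)))"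
proof -
  have "2 ^ DIM('a) * ball_kernel (2 * s) z
      = ennreal (2 ^ DIM('a) * (of_bool (norm z \<le> 2 * s) / (ball_vol TYPE('a) * (2 * s) ^ DIM('a))))"
    unfolding ball_kernel_def using assms ball_vol_pos[where 'a='a]
    by (subst ennreal_mult) (auto simp: ennreal_power[symmetric])
  then show ?thesis by (simp add: power_mult_distrib)
qed

lemma ball_kernel_convolution_le_larger:
  fixes x y :: "'a::euclidean_space"
  assumes "0 < r" "r \<le> s"
  shows "(\<integral>\<^sup>+z. ball_kernel r (x - z) * ball_kernel s (y - z) \<partial>lborel) \<le> 2 ^ DIM('a) * ball_kernel (2 * s) (x - y)"
proof -
  have "ball_kernel r (x - z) * ball_kernel s (y - z)
      \<le> ball_kernel r (x - z) * (2 ^ DIM('a) * ball_kernel (2 * s) (x - y))" for z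
  proof (cases "norm (x - z) \<le> r \<and> norm (y - z) \<le> s")
    case True
    then have "norm (x - y) \<le> 2 * s"
      using norm_triangle_ineq4[of "x - z" "y - z"] assms by simp
    moreover have "0 < s" using assms by simp
    ultimately show ?thesis
      unfolding ball_kernel_double[OF \<open>0 < s\<close>] by (intro mult_left_mono) (simp_all add: ball_kernel_def True)
  qed (auto simp: ball_kernel_def)
  then have "(\<integral>\<^sup>+z. ball_kernel r (x - z) * ball_kernel s (y - z) \<partial>lborel)
      \<le> (\<integral>\<^sup>+z. ball_kernel r (x - z) * (2 ^ DIM('a) * ball_kernel (2 * s) (x - y)) \<partial>lborel)"
    by (rule nn_integral_mono)
  then show ?thesis
    using assms by (simp add: nn_integral_multc nn_integral_ball_kernel)
qed

lemma ball_kernel_convolution_le: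
  fixes x y :: "'a::euclidean_space"
  assumes "0 < r" "0 < s"
  shows "(\<integral>\<^sup>+z. ball_kernel r (x - z) * ball_kernel s (y - z) \<partial>lborel)
      \<le> 2 ^ DIM('a) * (ball_kernel (2 * r) (x - y) + ball_kernel (2 * s) (x - y))"
proof (cases "r \<le> s")
  case True
  then show ?thesis
    using ball_kernel_convolution_le_larger[of r s x y] assms by (simp add: distrib_left add_increasing)
next
  case False
  then have "(\<integral>\<^sup>+z. ball_kernel s (y - z) * ball_kernel r (x - z) \<partial>lborel)
      \<le> 2 ^ DIM('a) * ball_kernel (2 * r) (y - x)"
    using assms by (intro ball_kernel_convolution_le_larger) auto
  then show ?thesis
    by (simp add: distrib_left add_increasing2 mult.commute ball_kernel_minus_commute[of _ x y])
qed

definition ball_avg_adjoint :: "('a::euclidean_space \<Rightarrow> real) \<Rightarrow> ('a \<Rightarrow> ennreal) \<Rightarrow> 'a \<Rightarrow> ennreal" where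
  "ball_avg_adjoint \<rho> u y = (\<integral>\<^sup>+x. u x * ball_kernel (\<rho> x) (x - y) \<partial>lborel)"

lemma measurable_ball_avg_adjoint [measurable]:
  assumes [measurable]: "\<rho> \<in> borel_measurable borel" "u \<in> borel_measurable borel"
  shows "ball_avg_adjoint \<rho> u \<in> borel_measurable borel"
  unfolding ball_avg_adjoint_def[abs_def] by measurable

lemma nn_integral_ball_avg_adjoint:
  assumes [measurable]: "\<rho> \<in> borel_measurable borel" "u \<in> borel_measurable borel" "h \<in> borel_measurable borel"
  shows "(\<integral>\<^sup>+x. u x * ball_avg (\<rho> x) h x \<partial>lborel) = (\<integral>\<^sup>+y. h y * ball_avg_adjoint \<rho> u y \<partial>lborel)"
proof -
  have "(\<integral>\<^sup>+x. u x * ball_avg (\<rho> x) h x \<partial>lborel)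
      = (\<integral>\<^sup>+x. \<integral>\<^sup>+y. h y * (u x * ball_kernel (\<rho> x) (x - y)) \<partial>lborel \<partial>lborel)"
    unfolding ball_avg_def
    by (intro nn_integral_cong, subst nn_integral_cmult[symmetric]) (auto intro!: nn_integral_cong simp: ac_simps)
  also have "\<dots> = (\<integral>\<^sup>+y. \<integral>\<^sup>+x. h y * (u x * ball_kernel (\<rho> x) (x - y)) \<partial>lborel \<partial>lborel)"
    by (intro lborel_pair.Fubini') measurable
  also have "\<dots> = (\<integral>\<^sup>+y. h y * ball_avg_adjoint \<rho> u y \<partial>lborel)"
    unfolding ball_avg_adjoint_def by (intro nn_integral_cong nn_integral_cmult) measurable
  finally show ?thesis .
qed

lemma ball_avg_ball_avg_adjoint_le:
  fixes u :: "'a::euclidean_space \<Rightarrow> ennreal"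
  assumes [measurable]: "\<rho> \<in> borel_measurable borel" "u \<in> borel_measurable borel"
    and \<rho>: "\<And>x. 0 < \<rho> x"
  shows "ball_avg (\<rho> x) (ball_avg_adjoint \<rho> u) x
      \<le> 2 ^ DIM('a) * (ball_avg (2 * \<rho> x) u x + ball_avg_adjoint (\<lambda>x. 2 * \<rho> x) u x)"
proof -
  have "ball_avg (\<rho> x) (ball_avg_adjoint \<rho> u) x
      = (\<integral>\<^sup>+y. \<integral>\<^sup>+x'. u x' * (ball_kernel (\<rho> x) (x - y) * ball_kernel (\<rho> x') (x' - y)) \<partial>lborel \<partial>lborel)"
    unfolding ball_avg_def ball_avg_adjoint_def
    by (intro nn_integral_cong, subst nn_integral_cmult[symmetric]) (auto intro!: nn_integral_cong simp: ac_simps)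
  also have "\<dots> = (\<integral>\<^sup>+x'. \<integral>\<^sup>+y. u x' * (ball_kernel (\<rho> x) (x - y) * ball_kernel (\<rho> x') (x' - y)) \<partial>lborel \<partial>lborel)"
    by (intro lborel_pair.Fubini') measurable
  also have "\<dots> = (\<integral>\<^sup>+x'. u x' * (\<integral>\<^sup>+y. ball_kernel (\<rho> x) (x - y) * ball_kernel (\<rho> x') (x' - y) \<partial>lborel) \<partial>lborel)"
    by (intro nn_integral_cong nn_integral_cmult) measurable
  also have "\<dots> \<le> (\<integral>\<^sup>+x'. u x' * (2 ^ DIM('a)
        * (ball_kernel (2 * \<rho> x) (x - x') + ball_kernel (2 * \<rho> x') (x - x'))) \<partial>lborel)"
    by (intro nn_integral_mono mult_left_mono ball_kernel_convolution_le \<rho>) auto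
  also have "\<dots> = (\<integral>\<^sup>+x'. 2 ^ DIM('a)
        * (ball_kernel (2 * \<rho> x) (x - x') * u x' + u x' * ball_kernel (2 * \<rho> x') (x' - x)) \<partial>lborel)"
    by (intro nn_integral_cong) (simp add: distrib_left ac_simps ball_kernel_minus_commute[of _ x])
  also have "\<dots> = 2 ^ DIM('a) * (ball_avg (2 * \<rho> x) u x + ball_avg_adjoint (\<lambda>x. 2 * \<rho> x) u x)"
    unfolding ball_avg_def ball_avg_adjoint_def by (simp add: nn_integral_cmult nn_integral_add)
  finally show ?thesis .
qed

lemma L2_sq_ball_avg_adjoint_le:
  fixes u :: "'a::euclidean_space \<Rightarrow> ennreal"
  assumes [measurable]: "\<rho> \<in> borel_measurable borel" "u \<in> borel_measurable borel"
    and "\<And>x. 0 < \<rho> x"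
  shows "L2_sq (ball_avg_adjoint \<rho> u) \<le> 2 ^ (DIM('a) + 1) * (\<integral>\<^sup>+x. u x * ball_avg (2 * \<rho> x) u x \<partial>lborel)"
proof -
  define W where "W = (\<integral>\<^sup>+x. u x * ball_avg (2 * \<rho> x) u x \<partial>lborel)"
  have "L2_sq (ball_avg_adjoint \<rho> u) = (\<integral>\<^sup>+x. u x * ball_avg (\<rho> x) (ball_avg_adjoint \<rho> u) x \<partial>lborel)"
    by (simp add: L2_sq_def power2_eq_square nn_integral_ball_avg_adjoint)
  also have "\<dots> \<le> (\<integral>\<^sup>+x. u x * (2 ^ DIM('a)
        * (ball_avg (2 * \<rho> x) u x + ball_avg_adjoint (\<lambda>x. 2 * \<rho> x) u x)) \<partial>lborel)"
    by (intro nn_integral_mono mult_left_mono ball_avg_ball_avg_adjoint_le assms) auto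
  also have "\<dots> = (\<integral>\<^sup>+x. 2 ^ DIM('a)
        * (u x * ball_avg (2 * \<rho> x) u x + u x * ball_avg_adjoint (\<lambda>x. 2 * \<rho> x) u x) \<partial>lborel)"
    by (intro nn_integral_cong) (simp add: distrib_left ac_simps)
  also have "\<dots> = 2 ^ DIM('a) * (W + (\<integral>\<^sup>+x. u x * ball_avg_adjoint (\<lambda>x. 2 * \<rho> x) u x \<partial>lborel))"
    unfolding W_def by (simp add: nn_integral_cmult nn_integral_add)
  also have "(\<integral>\<^sup>+x. u x * ball_avg_adjoint (\<lambda>x. 2 * \<rho> x) u x \<partial>lborel) = W"
    unfolding W_def by (rule nn_integral_ball_avg_adjoint[symmetric]) measurable
  finally show ?thesis by (simp add: W_def mult_2[symmetric] ac_simps)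
qed

text \<open>The \<open>T T*\<close> argument for the maximal operator \<open>T\<close> linearised by a choice of radii \<open>\<rho>\<close>: the kernel of
  \<open>T T*\<close> is dominated by the kernels with radii \<open>2 \<rho>\<close>, so \<open>\<parallel>T\<parallel>\<^sup>2\<close> is controlled by the norm of a maximal
  operator of the same kind, and the best constant \<open>N\<close> of the truncated operator satisfies
  \<open>N\<^sup>2 \<le> A (N + 1)\<close>.\<close>

lemma L2_sq_linearized_maximal_le:
  fixes h :: "'a::euclidean_space \<Rightarrow> ennreal"
  assumes [measurable]: "h \<in> borel_measurable borel" "\<rho> \<in> borel_measurable borel" and \<rho>: "\<And>x. 0 < \<rho> x"
  defines "u \<equiv> \<lambda>x. ball_avg (\<rho> x) h x"
  shows "L2_sq u ^ 4 \<le> (L2_sq h)\<^sup>2 * ((2 ^ (DIM('a) + 1))\<^sup>2 * (L2_sq u * L2_sq (\<lambda>x. ball_avg (2 * \<rho> x) u x)))"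
proof -
  have [measurable]: "u \<in> borel_measurable borel" unfolding u_def by measurable
  define W where "W = (\<integral>\<^sup>+x. u x * ball_avg (2 * \<rho> x) u x \<partial>lborel)"
  have "L2_sq u = (\<integral>\<^sup>+x. u x * ball_avg (\<rho> x) h x \<partial>lborel)"
    by (simp add: L2_sq_def power2_eq_square u_def)
  also have "\<dots> = (\<integral>\<^sup>+y. h y * ball_avg_adjoint \<rho> u y \<partial>lborel)"
    by (rule nn_integral_ball_avg_adjoint) measurable
  finally have "(L2_sq u)\<^sup>2 \<le> L2_sq h * L2_sq (ball_avg_adjoint \<rho> u)"
    using Cauchy_Schwarz_nn_integral[of h lborel "ball_avg_adjoint \<rho> u"] by (simp add: L2_sq_def)
  also have "\<dots> \<le> L2_sq h * (2 ^ (DIM('a) + 1) * W)"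
    unfolding W_def by (intro mult_left_mono L2_sq_ball_avg_adjoint_le \<rho>) auto
  finally have "((L2_sq u)\<^sup>2)\<^sup>2 \<le> (L2_sq h * (2 ^ (DIM('a) + 1) * W))\<^sup>2"
    by (rule power_mono_ennreal)
  also have "\<dots> = (L2_sq h)\<^sup>2 * ((2 ^ (DIM('a) + 1))\<^sup>2 * W\<^sup>2)"
    by (simp only: power_mult_distrib)
  also have "W\<^sup>2 \<le> L2_sq u * L2_sq (\<lambda>x. ball_avg (2 * \<rho> x) u x)"
    unfolding W_def L2_sq_def by (intro Cauchy_Schwarz_nn_integral) (auto intro: measurable_ball_avg)
  finally show ?thesis by (simp add: mult_left_mono flip: power_mult)
qed

lemma maximal_radius_exists:
  assumes "finite F" "F \<noteq> {}" and [measurable]: "h \<in> borel_measurable borel"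
  shows "\<exists>\<rho>. \<rho> \<in> borel_measurable borel \<and> (\<forall>x. \<rho> x \<in> F \<and> (\<forall>r\<in>F. ball_avg r h x \<le> ball_avg (\<rho> x) h x))"
  using assms(1,2)
proof (induction F rule: finite_ne_induct)
  case (singleton r)
  then show ?case by (intro exI[of _ "\<lambda>_. r"]) auto
next
  case (insert r F)
  then obtain \<rho> where [measurable]: "\<rho> \<in> borel_measurable borel"
    and \<rho>: "\<And>x. \<rho> x \<in> F" "\<And>x s. s \<in> F \<Longrightarrow> ball_avg s h x \<le> ball_avg (\<rho> x) h x" by blast
  define \<rho>' where "\<rho>' x = (if ball_avg (\<rho> x) h x \<le> ball_avg r h x then r else \<rho> x)" for x
  have "\<rho>' \<in> borel_measurable borel" unfolding \<rho>'_def by measurable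
  moreover have "\<rho>' x \<in> insert r F \<and> (\<forall>s\<in>insert r F. ball_avg s h x \<le> ball_avg (\<rho>' x) h x)" for x
    using \<rho>(1)[of x] \<rho>(2)[of _ x] by (auto simp: \<rho>'_def intro: order_trans)
  ultimately show ?case by blast
qed

definition dyadic_max :: "nat \<Rightarrow> ('a::euclidean_space \<Rightarrow> ennreal) \<Rightarrow> 'a \<Rightarrow> ennreal" where
  "dyadic_max n h x = (SUP k\<in>{- int n..int n}. ball_avg (2 powr k) h x)"

lemma measurable_dyadic_max [measurable]:
  "h \<in> borel_measurable borel \<Longrightarrow> dyadic_max n h \<in> borel_measurable borel"
  unfolding dyadic_max_def by (intro borel_measurable_SUP measurable_ball_avg) auto

lemma ball_avg_le_dyadic_max:
  fixes k :: int
  shows "k \<in> {- int n..int n} \<Longrightarrow> ball_avg (2 powr k) h x \<le> dyadic_max n h x"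
  unfolding dyadic_max_def by (rule SUP_upper)

lemma dyadic_max_linearization:
  assumes "h \<in> borel_measurable borel"
  obtains \<rho> where "\<rho> \<in> borel_measurable borel" "\<And>x. \<exists>k\<in>{- int n..int n}. \<rho> x = 2 powr k"
    "dyadic_max n h = (\<lambda>x. ball_avg (\<rho> x) h x)"
proof -
  define F where "F = (\<lambda>k::int. 2 powr k) ` {- int n..int n}"
  obtain \<rho> where \<rho>: "\<rho> \<in> borel_measurable borel" "\<And>x. \<rho> x \<in> F"
    and maximal: "\<And>x r. r \<in> F \<Longrightarrow> ball_avg r h x \<le> ball_avg (\<rho> x) h x"
    using maximal_radius_exists[of F h] assms by (auto simp: F_def)
  have range: "\<exists>k\<in>{- int n..int n}. \<rho> x = 2 powr k" for x
    using \<rho>(2)[of x] by (auto simp: F_def)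
  have "dyadic_max n h x = ball_avg (\<rho> x) h x" for x
  proof (rule antisym)
    show "dyadic_max n h x \<le> ball_avg (\<rho> x) h x"
      unfolding dyadic_max_def by (intro SUP_least maximal) (auto simp: F_def)
    show "ball_avg (\<rho> x) h x \<le> dyadic_max n h x"
      using range[of x] ball_avg_le_dyadic_max[of _ n h x] by auto
  qed
  then show thesis using that \<rho>(1) range by blast
qed

definition dyadic_max_constants :: "'a::euclidean_space itself \<Rightarrow> nat \<Rightarrow> real set" where
  "dyadic_max_constants _ n = {N. 0 < N \<and>
     (\<forall>h::'a \<Rightarrow> ennreal. h \<in> borel_measurable borel \<longrightarrow> L2_sq (dyadic_max n h) \<le> ennreal N * L2_sq h)}"

lemma L2_sq_doubled_radius_le:
  fixes u :: "'a::euclidean_space \<Rightarrow> ennreal"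
  assumes N: "N \<in> dyadic_max_constants TYPE('a) n" and [measurable]: "u \<in> borel_measurable borel"
    and \<rho>: "\<And>x. \<exists>k\<in>{- int n..int n}. \<rho> x = 2 powr k"
  shows "L2_sq (\<lambda>x. ball_avg (2 * \<rho> x) u x) \<le> ennreal (2 * (N + 1)) * L2_sq u"
proof -
  have "ball_avg (2 * \<rho> x) u x \<le> dyadic_max n u x + ball_avg (2 powr (int n + 1)) u x" for x
  proof -
    obtain k where k: "k \<in> {- int n..int n}" "\<rho> x = 2 powr k" using \<rho> by blast
    then have double: "2 * \<rho> x = 2 powr (k + 1)" by (simp add: powr_add)
    show ?thesis
    proof (cases "k = int n")
      case True
      then show ?thesis using double by (simp add: add_increasing)
    next
      case False
      then have "ball_avg (2 powr (k + 1)) u x \<le> dyadic_max n u x"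
        using k by (intro ball_avg_le_dyadic_max) auto
      then show ?thesis using double by (simp add: add_increasing2)
    qed
  qed
  then have "L2_sq (\<lambda>x. ball_avg (2 * \<rho> x) u x)
      \<le> L2_sq (\<lambda>x. dyadic_max n u x + ball_avg (2 powr (int n + 1)) u x)"
    by (rule L2_sq_mono)
  also have "\<dots> \<le> 2 * L2_sq (dyadic_max n u) + 2 * L2_sq (ball_avg (2 powr (int n + 1)) u)"
    by (intro L2_sq_add_le) measurable
  also have "\<dots> \<le> 2 * (ennreal N * L2_sq u) + 2 * L2_sq u"
    using N by (intro add_mono mult_left_mono L2_sq_ball_avg_le) (auto simp: dyadic_max_constants_def)
  also have "\<dots> = ennreal (2 * (N + 1)) * L2_sq u"
    using N by (simp add: dyadic_max_constants_def distrib_left distrib_right ennreal_mult ennreal_plus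
        mult.assoc)
  finally show ?thesis .
qed

lemma le_sqrt_mult_of_fourth_power_le:
  fixes S H :: ennreal
  assumes "S < \<infinity>" "H < \<infinity>" "0 \<le> c" and le: "S ^ 4 \<le> H\<^sup>2 * (ennreal c * S\<^sup>2)"
  shows "S \<le> ennreal (sqrt c) * H"
proof -
  obtain s t where s: "S = ennreal s" "0 \<le> s" and t: "H = ennreal t" "0 \<le> t"
    using assms(1,2) by (cases S; cases H) auto
  have "ennreal (s ^ 4) \<le> ennreal (t\<^sup>2 * (c * s\<^sup>2))"
    using le s(2) t(2) \<open>0 \<le> c\<close> by (simp add: s(1) t(1) ennreal_power ennreal_mult[symmetric])
  then have "s\<^sup>2 * s\<^sup>2 \<le> (c * t\<^sup>2) * s\<^sup>2"
    using \<open>0 \<le> c\<close> by (simp add: ennreal_le_iff mult_ac flip: power_add)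
  then have "s = 0 \<or> s\<^sup>2 \<le> c * t\<^sup>2"
    by (metis mult_right_le_imp_le zero_less_power2)
  then have "s \<le> sqrt (c * t\<^sup>2)"
    using s(2) t(2) \<open>0 \<le> c\<close> by (auto intro: real_le_rsqrt)
  then show ?thesis
    using s t \<open>0 \<le> c\<close> by (simp add: real_sqrt_mult ennreal_leI flip: ennreal_mult)
qed

lemma dyadic_max_constants_initial: "real (2 * n + 1) \<in> dyadic_max_constants TYPE('a::euclidean_space) n"
proof -
  have "L2_sq (dyadic_max n h) \<le> ennreal (real (2 * n + 1)) * L2_sq h"
    if [measurable]: "h \<in> borel_measurable borel" for h :: "'a \<Rightarrow> ennreal"
  proof -
    have "L2_sq (dyadic_max n h) \<le> (\<Sum>k\<in>{- int n..int n}. L2_sq (ball_avg (2 powr k) h))"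
      unfolding dyadic_max_def[abs_def] by (intro L2_sq_SUP_le_sum) auto
    also have "\<dots> \<le> (\<Sum>k\<in>{- int n..int n}. L2_sq h)"
      by (intro sum_mono L2_sq_ball_avg_le that) auto
    also have "\<dots> = ennreal (real (2 * n + 1)) * L2_sq h"
    proof -
      have "card {- int n..int n} = 2 * n + 1" by simp
      then show ?thesis by (simp only: sum_constant ennreal_of_nat_eq_real_of_nat)
    qed
    finally show ?thesis .
  qed
  then show ?thesis by (auto simp: dyadic_max_constants_def)
qed

lemma dyadic_max_constants_mono:
  "N \<in> dyadic_max_constants TYPE('a::euclidean_space) n \<Longrightarrow> N \<le> N' \<Longrightarrow> N' \<in> dyadic_max_constants TYPE('a) n"
  unfolding dyadic_max_constants_def
  by (auto intro: order_trans[OF _ mult_right_mono[OF ennreal_leI]])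

lemma dyadic_max_constants_improve:
  assumes N: "N \<in> dyadic_max_constants TYPE('a::euclidean_space) n"
  shows "sqrt (2 * (2 ^ (DIM('a) + 1))\<^sup>2 * (N + 1)) \<in> dyadic_max_constants TYPE('a) n"
proof -
  let ?c = "2 * (2 ^ (DIM('a) + 1))\<^sup>2 * (N + 1) :: real"
  have pos: "0 < N" using N by (simp add: dyadic_max_constants_def)
  have "L2_sq (dyadic_max n h) \<le> ennreal (sqrt ?c) * L2_sq h"
    if h[measurable]: "h \<in> borel_measurable borel" for h :: "'a \<Rightarrow> ennreal"
  proof (cases "L2_sq h < \<infinity>")
    case True
    obtain \<rho> where [measurable]: "\<rho> \<in> borel_measurable borel"
      and \<rho>: "\<And>x. \<exists>k\<in>{- int n..int n}. \<rho> x = 2 powr k" "dyadic_max n h = (\<lambda>x. ball_avg (\<rho> x) h x)"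
      by (rule dyadic_max_linearization[OF h, of n]) (rule that)
    let ?u = "\<lambda>x. ball_avg (\<rho> x) h x"
    have u_le: "L2_sq ?u \<le> ennreal N * L2_sq h"
      unfolding \<rho>(2)[symmetric] using N h by (simp add: dyadic_max_constants_def)
    have "0 < \<rho> x" for x using \<rho>(1)[of x] by auto
    then have "L2_sq ?u ^ 4 \<le> (L2_sq h)\<^sup>2
        * ((2 ^ (DIM('a) + 1))\<^sup>2 * (L2_sq ?u * L2_sq (\<lambda>x. ball_avg (2 * \<rho> x) ?u x)))"
      by (intro L2_sq_linearized_maximal_le) measurable
    also have "\<dots> \<le> (L2_sq h)\<^sup>2 * ((2 ^ (DIM('a) + 1))\<^sup>2 * (L2_sq ?u * (ennreal (2 * (N + 1)) * L2_sq ?u)))"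
      by (intro mult_left_mono L2_sq_doubled_radius_le[OF N] \<rho>(1)) auto
    also have "\<dots> = (L2_sq h)\<^sup>2 * (((2 ^ (DIM('a) + 1))\<^sup>2 * ennreal (2 * (N + 1))) * (L2_sq ?u)\<^sup>2)"
      by (simp add: power2_eq_square mult_ac)
    also have "(2 ^ (DIM('a) + 1))\<^sup>2 * ennreal (2 * (N + 1)) = ennreal ?c"
    proof -
      have "((2 ^ (DIM('a) + 1))\<^sup>2 :: ennreal) = ennreal ((2 ^ (DIM('a) + 1))\<^sup>2)"
        by (simp add: ennreal_power[symmetric] ennreal_mult)
      then show ?thesis
        using pos ennreal_mult[of "(2 ^ (DIM('a) + 1))\<^sup>2" "2 * (N + 1)"] by (simp only: mult_ac) simp
    qed
    finally show ?thesis
      unfolding \<rho>(2) using u_le True pos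
      by (intro le_sqrt_mult_of_fourth_power_le) (auto simp: ennreal_mult_less_top intro: le_less_trans)
  next
    case False
    then show ?thesis using pos by (auto simp: less_top[symmetric] ennreal_mult_top)
  qed
  then show ?thesis using pos by (simp add: dyadic_max_constants_def)
qed

lemma self_improving_constant:
  fixes V :: "real set"
  assumes "V \<noteq> {}" and nonneg: "\<And>N. N \<in> V \<Longrightarrow> 0 \<le> N" and upward: "\<And>N N'. N \<in> V \<Longrightarrow> N \<le> N' \<Longrightarrow> N' \<in> V"
    and improve: "\<And>N. N \<in> V \<Longrightarrow> sqrt (A * (N + 1)) \<in> V" and "0 < A"
  shows "A + 2 \<in> V"
proof (rule ccontr)
  assume "A + 2 \<notin> V"
  then have above: "A + 2 \<le> N" if "N \<in> V" for N using upward[OF that, of "A + 2"] by force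
  have bdd: "bdd_below V" by (intro bdd_belowI[of _ 0] nonneg)
  have Inf_ge: "A + 2 \<le> Inf V" using \<open>V \<noteq> {}\<close> above by (rule cInf_greatest)
  obtain N where N: "N \<in> V" "N < Inf V + 1"
    using cInf_lessD[OF \<open>V \<noteq> {}\<close>, of "Inf V + 1"] by auto
  have "Inf V \<le> sqrt (A * (N + 1))" using improve[OF N(1)] bdd by (rule cInf_lower)
  then have "(Inf V)\<^sup>2 \<le> (sqrt (A * (N + 1)))\<^sup>2" using Inf_ge \<open>0 < A\<close> by (intro power_mono) auto
  also have "\<dots> = A * (N + 1)" using \<open>0 < A\<close> nonneg[OF N(1)] by simp
  also have "\<dots> < A * (Inf V + 2)" using N(2) \<open>0 < A\<close> by simp
  also have "\<dots> \<le> A * Inf V + 2 * Inf V" using Inf_ge \<open>0 < A\<close> by (simp add: distrib_left)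
  also have "\<dots> \<le> (Inf V)\<^sup>2" using mult_right_mono[OF Inf_ge, of "Inf V"] Inf_ge \<open>0 < A\<close>
    by (simp add: power2_eq_square distrib_right)
  finally show False by simp
qed

definition ball_max_constant :: "'a::euclidean_space itself \<Rightarrow> real" where
  "ball_max_constant _ = 2 * (2 ^ (DIM('a) + 1))\<^sup>2 + 2"

lemma L2_sq_dyadic_max_le:
  fixes h :: "'a::euclidean_space \<Rightarrow> ennreal"
  assumes "h \<in> borel_measurable borel"
  shows "L2_sq (dyadic_max n h) \<le> ennreal (ball_max_constant TYPE('a)) * L2_sq h"
proof -
  have "2 * (2 ^ (DIM('a) + 1))\<^sup>2 + 2 \<in> dyadic_max_constants TYPE('a) n"
  proof (rule self_improving_constant)
    show "dyadic_max_constants TYPE('a) n \<noteq> {}"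
      using dyadic_max_constants_initial by blast
    show "0 \<le> N" if "N \<in> dyadic_max_constants TYPE('a) n" for N
      using that by (simp add: dyadic_max_constants_def)
  qed (rule dyadic_max_constants_mono dyadic_max_constants_improve; assumption | simp)+
  then show ?thesis using assms by (simp add: ball_max_constant_def dyadic_max_constants_def)
qed

section \<open>Dini integrals and dyadic sums\<close>

definition dini_measure :: "(real \<Rightarrow> real) \<Rightarrow> real measure" where
  "dini_measure H = density lborel (\<lambda>t. ennreal (H t / t))"

lemma sets_dini_measure [simp, measurable_cong]: "sets (dini_measure H) = sets borel"
  by (simp add: dini_measure_def)

lemma emeasure_dini_measure:
  assumes "mono H" "A \<in> sets borel"
  shows "emeasure (dini_measure H) A = (\<integral>\<^sup>+t. ennreal (H t / t) * indicator A t \<partial>lborel)"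
proof -
  have [measurable]: "H \<in> borel_measurable borel" by (rule borel_measurable_mono[OF \<open>mono H\<close>])
  show ?thesis unfolding dini_measure_def using assms(2) by (intro emeasure_density) auto
qed

lemma emeasure_dini_measure_cmult:
  assumes "mono H" "0 \<le> c" "A \<in> sets borel"
  shows "emeasure (dini_measure (\<lambda>t. c * H t)) A = ennreal c * emeasure (dini_measure H) A"
proof -
  have [measurable]: "H \<in> borel_measurable borel" by (rule borel_measurable_mono[OF \<open>mono H\<close>])
  have "mono (\<lambda>t. c * H t)" using assms by (auto intro!: monoI mult_left_mono dest: monoD)
  then have "emeasure (dini_measure (\<lambda>t. c * H t)) A
      = (\<integral>\<^sup>+t. ennreal c * (ennreal (H t / t) * indicator A t) \<partial>lborel)"
    using assms by (simp add: emeasure_dini_measure ennreal_mult' mult.assoc flip: times_divide_eq_right)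
  then show ?thesis
    using assms by (simp add: emeasure_dini_measure nn_integral_cmult)
qed

lemma emeasure_dini_block:
  assumes H: "mono H" "\<And>t. 0 \<le> H t" and a: "0 < a"
  shows "ennreal (H a) \<le> 2 * emeasure (dini_measure H) {a..<2 * a}"
    and "emeasure (dini_measure H) {a..<2 * a} \<le> ennreal (H (2 * a))"
proof -
  have const: "(\<integral>\<^sup>+t. ennreal (c / a) * indicator {a..<2 * a} t \<partial>lborel) = ennreal c" if "0 \<le> c" for c
    using a that by (simp add: nn_integral_cmult flip: ennreal_mult)
  have "ennreal (H a / 2) = (\<integral>\<^sup>+t. ennreal ((H a / 2) / a) * indicator {a..<2 * a} t \<partial>lborel)"
    using H(2)[of a] by (intro const[symmetric]) simp
  also have "\<dots> \<le> (\<integral>\<^sup>+t. ennreal (H t / t) * indicator {a..<2 * a} t \<partial>lborel)"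
  proof (intro nn_integral_mono)
    fix t
    have "H a / (2 * a) \<le> H t / t" if "t \<in> {a..<2 * a}"
      using that a H(2)[of a] monoD[OF H(1), of a t] by (intro frac_le) auto
    then show "ennreal ((H a / 2) / a) * indicator {a..<2 * a} t \<le> ennreal (H t / t) * indicator {a..<2 * a} t"
      by (auto simp: indicator_def intro: ennreal_leI)
  qed
  finally have "2 * ennreal (H a / 2) \<le> 2 * emeasure (dini_measure H) {a..<2 * a}"
    using H(1) by (intro mult_left_mono) (auto simp: emeasure_dini_measure)
  then show "ennreal (H a) \<le> 2 * emeasure (dini_measure H) {a..<2 * a}"
    using ennreal_mult[of 2 "H a / 2"] H(2)[of a] by simp
  have "emeasure (dini_measure H) {a..<2 * a} \<le> (\<integral>\<^sup>+t. ennreal (H (2 * a) / a) * indicator {a..<2 * a} t \<partial>lborel)"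
    unfolding emeasure_dini_measure[OF H(1) atLeastLessThan_borel]
  proof (intro nn_integral_mono)
    fix t
    have "H t / t \<le> H (2 * a) / a" if "t \<in> {a..<2 * a}"
      using that a H(2) monoD[OF H(1), of t "2 * a"] by (intro frac_le) auto
    then show "ennreal (H t / t) * indicator {a..<2 * a} t \<le> ennreal (H (2 * a) / a) * indicator {a..<2 * a} t"
      by (auto simp: indicator_def intro: ennreal_leI)
  qed
  then show "emeasure (dini_measure H) {a..<2 * a} \<le> ennreal (H (2 * a))"
    using const[OF H(2)] by simp
qed

lemma disjoint_dyadic_blocks:
  assumes "0 < d"
  shows "disjoint_family_on (\<lambda>k::int. {d / 2 powr k..<2 * (d / 2 powr k)}) F"
proof -
  have "{d / 2 powr j..<2 * (d / 2 powr j)} \<inter> {d / 2 powr k..<2 * (d / 2 powr k)} = {}" if "j < k" for j k :: int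
  proof -
    have "2 * 2 powr j = 2 powr (real_of_int j + 1)" by (simp add: powr_add)
    also have "\<dots> \<le> 2 powr k" using that by (intro powr_mono) auto
    finally have "2 * (d / 2 powr k) \<le> d / 2 powr j"
      using assms by (simp add: field_simps)
    then show ?thesis by auto
  qed
  then show ?thesis unfolding disjoint_family_on_def by (metis Int_commute linorder_neq_iff)
qed

lemma dyadic_sum_le_dini:
  fixes F :: "int set"
  assumes F: "finite F" and d: "0 < d" and H: "mono H" "\<And>t. 0 \<le> H t"
    and T: "\<And>k. k \<in> F \<Longrightarrow> d / 2 powr k \<le> T"
  shows "(\<Sum>k\<in>F. ennreal (H (d / 2 powr k))) \<le> 2 * emeasure (dini_measure H) {0<..<2 * T}"
proof -
  let ?I = "\<lambda>k::int. {d / 2 powr k..<2 * (d / 2 powr k)}"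
  have "(\<Sum>k\<in>F. ennreal (H (d / 2 powr k))) \<le> (\<Sum>k\<in>F. 2 * emeasure (dini_measure H) (?I k))"
    using d by (intro sum_mono emeasure_dini_block(1) H) simp
  also have "\<dots> = 2 * emeasure (dini_measure H) (\<Union>k\<in>F. ?I k)"
    unfolding sum_distrib_left[symmetric] using disjoint_dyadic_blocks[OF d] F
    by (subst sum_emeasure) auto
  also have "\<dots> \<le> 2 * emeasure (dini_measure H) {0<..<2 * T}"
  proof (intro mult_left_mono emeasure_mono)
    have "0 < d / 2 powr k" for k :: int using d by simp
    then show "(\<Union>k\<in>F. ?I k) \<subseteq> {0<..<2 * T}"
      using T by (fastforce intro: less_le_trans)
  qed auto
  finally show ?thesis .
qed

lemma Ioo_subset_dyadic_blocks:
  fixes d :: real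
  shows "{0<..<2 * d} \<subseteq> (\<Union>k::nat. {d / 2 ^ k..<2 * (d / 2 ^ k)})"
proof
  fix t assume t: "t \<in> {0<..<2 * d}"
  obtain m where "d / t < 2 ^ m" using real_arch_pow[of 2 "d / t"] by auto
  then have ex: "d / 2 ^ m \<le> t" using t by (simp add: field_simps)
  define p where "p = (LEAST m. d / 2 ^ m \<le> t)"
  have p: "d / 2 ^ p \<le> t" unfolding p_def using ex by (rule LeastI)
  have "t < 2 * (d / 2 ^ p)"
  proof (cases p)
    case (Suc j)
    then have "\<not> d / 2 ^ j \<le> t" using not_less_Least[of j "\<lambda>m. d / 2 ^ m \<le> t"] by (auto simp: p_def)
    then show ?thesis by (simp add: Suc)
  qed (use t in simp)
  then show "t \<in> (\<Union>k::nat. {d / 2 ^ k..<2 * (d / 2 ^ k)})" using p by auto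
qed

lemma dini_le_dyadic_sum:
  assumes H: "mono H" "\<And>t. 0 \<le> H t" and e: "0 < e"
  shows "emeasure (dini_measure H) {0<..<e} \<le> (\<Sum>k::nat. ennreal (H (e / 2 ^ k)))"
proof -
  let ?I = "\<lambda>k::nat. {(e / 2) / 2 ^ k..<2 * ((e / 2) / 2 ^ k)}"
  have "emeasure (dini_measure H) {0<..<e} \<le> emeasure (dini_measure H) (\<Union>k. ?I k)"
    using Ioo_subset_dyadic_blocks[of "e / 2"] by (intro emeasure_mono) auto
  also have "\<dots> \<le> (\<Sum>k. emeasure (dini_measure H) (?I k))"
    by (intro emeasure_subadditive_countably) auto
  also have "\<dots> \<le> (\<Sum>k. ennreal (H (2 * ((e / 2) / 2 ^ k))))"
    using e by (intro suminf_le allI summableI emeasure_dini_block(2) H) simp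
  finally show ?thesis by simp
qed

lemma dini_extend:
  assumes mono: "mono H" and H: "\<And>t. 0 \<le> H t" "\<And>t. H t \<le> B" and e: "0 < e" and T: "0 \<le> T"
  shows "emeasure (dini_measure H) {0<..<T} \<le> emeasure (dini_measure H) {0<..<e} + ennreal (B * T / e)"
proof -
  have [measurable]: "H \<in> borel_measurable borel" by (rule borel_measurable_mono[OF mono])
  have B: "0 \<le> B" using H[of 0] by simp
  have "ennreal (H t / t) * indicator {0<..<T} t
      \<le> ennreal (H t / t) * indicator {0<..<e} t + ennreal (B / e) * indicator {0..T} t" for t
  proof (cases "0 < t \<and> t < T")
    case True
    have "H t / t \<le> B / e" if "e \<le> t" using H B e that by (intro frac_le) auto
    then show ?thesis using True by (cases "t < e") (auto simp: ennreal_leI add_increasing2)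
  qed auto
  then have "emeasure (dini_measure H) {0<..<T}
      \<le> (\<integral>\<^sup>+t. ennreal (H t / t) * indicator {0<..<e} t + ennreal (B / e) * indicator {0..T} t \<partial>lborel)"
    by (simp add: emeasure_dini_measure[OF mono] nn_integral_mono)
  also have "\<dots> = emeasure (dini_measure H) {0<..<e} + ennreal (B / e) * ennreal T"
    using T by (simp add: nn_integral_add nn_integral_cmult emeasure_dini_measure[OF mono])
  also have "ennreal (B / e) * ennreal T = ennreal (B * T / e)"
    using B e T by (simp flip: ennreal_mult)
  finally show ?thesis .
qed

lemma dyadic_square_sum_le:
  fixes F :: "int set"
  assumes F: "finite F" and d: "0 < d" and le_1: "\<And>k. k \<in> F \<Longrightarrow> d / 2 powr k \<le> 1"
  shows "(\<Sum>k\<in>F. (d / 2 powr k)\<^sup>2) \<le> 8"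
proof -
  define H :: "real \<Rightarrow> real" where "H t = (max 0 t)\<^sup>2" for t
  have mono: "mono H" unfolding H_def by (auto intro!: monoI power_mono)
  have "emeasure (dini_measure H) {0<..<2} \<le> (\<integral>\<^sup>+t. ennreal 2 * indicator {0..2::real} t \<partial>lborel)"
    unfolding emeasure_dini_measure[OF mono greaterThanLessThan_borel]
    by (intro nn_integral_mono)
      (auto simp: H_def power2_eq_square indicator_def intro!: ennreal_leI[of _ 2, simplified])
  also have "\<dots> = 4"
    by (simp add: nn_integral_cmult flip: ennreal_numeral ennreal_mult)
  finally have "2 * emeasure (dini_measure H) {0<..<2} \<le> 2 * 4" by (rule mult_left_mono) simp
  moreover have "(\<Sum>k\<in>F. ennreal (H (d / 2 powr k))) \<le> 2 * emeasure (dini_measure H) {0<..<2 * 1}"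
    by (rule dyadic_sum_le_dini[OF F d mono _ le_1]) (simp_all add: H_def)
  ultimately have "(\<Sum>k\<in>F. ennreal (H (d / 2 powr k))) \<le> 8" by simp
  then have "ennreal (\<Sum>k\<in>F. H (d / 2 powr k)) \<le> ennreal 8"
    by (subst sum_ennreal[symmetric]) (simp_all add: H_def)
  then show ?thesis using d by (subst (asm) ennreal_le_iff) (simp_all add: H_def)
qed

section \<open>Fourier transforms of measures\<close>

lemma cmod_ft_le: "cmod (ft f \<xi>) \<le> (\<integral>x. \<bar>f x\<bar> \<partial>lborel)"
  unfolding ft_def by (rule order_trans[OF integral_norm_bound]) (simp add: norm_mult)

lemma ft_translate:
  assumes "integrable lborel f"
  shows "ft (\<lambda>x. f (x - a)) \<xi> = cis (\<xi> \<bullet> a) * ft f \<xi>"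
proof -
  have "ft (\<lambda>x. f (x - a)) \<xi>
      = (\<integral>x. cis (\<xi> \<bullet> a) * (complex_of_real (f (x - a)) * cis (\<xi> \<bullet> (x - a))) \<partial>lborel)"
    unfolding ft_def
    by (intro Bochner_Integration.integral_cong refl) (simp add: inner_diff_right mult_ac cis_mult)
  also have "\<dots> = cis (\<xi> \<bullet> a) * (\<integral>x. complex_of_real (f (x - a)) * cis (\<xi> \<bullet> (x - a)) \<partial>lborel)"
    by (rule integral_mult_right_zero)
  also have "(\<integral>x. complex_of_real (f (x - a)) * cis (\<xi> \<bullet> (x - a)) \<partial>lborel) = ft f \<xi>"
    unfolding ft_def by (rule lborel_translate(2)[OF integrable_mult_cis[OF assms]])
  finally show ?thesis .
qed

lemma ft_diff_cmult:
  assumes "integrable lborel f" "integrable lborel g"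
  shows "ft (\<lambda>x. f x - c * g x) \<xi> = ft f \<xi> - complex_of_real c * ft g \<xi>"
proof -
  have "ft (\<lambda>x. f x - c * g x) \<xi>
      = (\<integral>x. complex_of_real (f x) * cis (\<xi> \<bullet> x) - complex_of_real c * (complex_of_real (g x) * cis (\<xi> \<bullet> x))
          \<partial>lborel)"
    unfolding ft_def by (intro Bochner_Integration.integral_cong) (auto simp: algebra_simps)
  also have "\<dots> = ft f \<xi> - (\<integral>x. complex_of_real c * (complex_of_real (g x) * cis (\<xi> \<bullet> x)) \<partial>lborel)"
    unfolding ft_def by (intro Bochner_Integration.integral_diff integrable_mult_right integrable_mult_cis assms)
  also have "(\<integral>x. complex_of_real c * (complex_of_real (g x) * cis (\<xi> \<bullet> x)) \<partial>lborel) = complex_of_real c * ft g \<xi>"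
    unfolding ft_def by (rule integral_mult_right_zero)
  finally show ?thesis .
qed

lemma ft_half_period_le:
  assumes f: "integrable lborel f" and h: "\<xi> \<bullet> h = pi"
  shows "2 * cmod (ft f \<xi>) \<le> (\<integral>x. \<bar>f x - f (x - h)\<bar> \<partial>lborel)"
proof -
  have "ft (\<lambda>x. f x - 1 * f (x - h)) \<xi> = 2 * ft f \<xi>"
    using f by (subst ft_diff_cmult) (simp_all add: lborel_translate(1) ft_translate h)
  then have "2 * cmod (ft f \<xi>) = cmod (ft (\<lambda>x. f x - f (x - h)) \<xi>)"
    by (simp add: norm_mult)
  then show ?thesis using cmod_ft_le by simp
qed

definition measure_ft :: "'a::euclidean_space measure \<Rightarrow> 'a \<Rightarrow> complex" where
  "measure_ft M \<xi> = (\<integral>y. cis (\<xi> \<bullet> y) \<partial>M)"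

lemma cmod_measure_ft_le: "cmod (measure_ft M \<xi>) \<le> measure M (space M)"
  unfolding measure_ft_def by (rule order_trans[OF integral_norm_bound]) simp

lemma measure_ft_unit_ball:
  fixes \<xi> :: "'a::euclidean_space"
  shows "measure_ft unit_ball_measure \<xi> = ft (indicator (cball 0 1)) \<xi> / complex_of_real (ball_vol TYPE('a))"
proof -
  let ?V = "ball_vol TYPE('a)" and ?B = "cball (0::'a) 1"
  have V: "0 < ?V" by (rule ball_vol_pos)
  have density: "unit_ball_measure = density lborel (\<lambda>y. ennreal (indicator ?B y / ?V))"
    unfolding unit_ball_measure_def uniform_measure_def emeasure_unit_cball
    using V by (intro density_cong borel_measurable_divide_ennreal borel_measurable_indicator
        measurable_compose[OF _ measurable_ennreal] borel_measurable_divide)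
      (auto simp: divide_ennreal[symmetric] ennreal_indicator)
  have "measure_ft unit_ball_measure \<xi> = (\<integral>y. (indicator ?B y / ?V) *\<^sub>R cis (\<xi> \<bullet> y) \<partial>lborel)"
    unfolding measure_ft_def density using V by (intro integral_density) (simp_all, measurable)
  also have "\<dots> = (\<integral>y. complex_of_real (indicator ?B y) * cis (\<xi> \<bullet> y) / complex_of_real ?V \<partial>lborel)"
    by (simp add: scaleR_conv_of_real)
  finally show ?thesis unfolding ft_def by (simp only: integral_divide_zero)
qed

lemma power_diff_power_le:
  fixes x :: real
  assumes "0 \<le> x" "x \<le> 1"
  shows "(1 + x) ^ n - (1 - x) ^ n \<le> real n * 2 ^ n * x"
proof (induction n)
  case (Suc n)
  have "(1 + x) ^ Suc n - (1 - x) ^ Suc n = (1 + x) * ((1 + x) ^ n - (1 - x) ^ n) + 2 * x * (1 - x) ^ n"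
    by (simp add: algebra_simps)
  also have "\<dots> \<le> 2 * (real n * 2 ^ n * x) + 2 * x * 2 ^ n"
  proof (intro add_mono mult_left_mono)
    have "(1 - x) ^ n \<le> (1 + x) ^ n" using assms by (intro power_mono) auto
    then show "(1 + x) * ((1 + x) ^ n - (1 - x) ^ n) \<le> 2 * (real n * 2 ^ n * x)"
      using assms Suc by (intro mult_mono) auto
    show "(1 - x) ^ n \<le> 2 ^ n" using assms by (intro power_mono) auto
  qed (use assms in auto)
  also have "\<dots> = real (Suc n) * 2 ^ Suc n * x" by (simp add: algebra_simps)
  finally show ?case .
qed simp

lemma integral_indicator_ball_diff_le:
  fixes h :: "'a::euclidean_space"
  assumes "norm h \<le> 1"
  shows "(\<integral>y. \<bar>indicator (cball 0 1) y - indicator (cball 0 1) (y - h)\<bar> \<partial>lborel)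
      \<le> ball_vol TYPE('a) * (real DIM('a) * 2 ^ DIM('a) * norm h)"
proof -
  let ?B = "cball (0::'a) 1" and ?x = "norm h"
  let ?annulus = "cball (0::'a) (1 + ?x) - ball 0 (1 - ?x)"
  have bounded: "emeasure lborel (cball (0::'a) r) < \<infinity>" for r
    by (rule emeasure_bounded_finite) simp
  have ball: "integrable lborel (indicator ?B :: 'a \<Rightarrow> real)"
    by (intro integrable_real_indicator) (auto simp: emeasure_unit_cball)
  have "emeasure lborel ?annulus \<le> emeasure lborel (cball (0::'a) (1 + ?x))"
    by (intro emeasure_mono) auto
  then have annulus: "integrable lborel (indicator ?annulus :: 'a \<Rightarrow> real)"
    using bounded[of "1 + ?x"] by (intro integrable_real_indicator) (auto intro: le_less_trans)
  have "(\<integral>y. \<bar>indicator ?B y - indicator ?B (y - h)\<bar> \<partial>lborel) \<le> (\<integral>y. indicator ?annulus y \<partial>lborel :: real)"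
  proof (rule integral_mono[OF _ annulus])
    show "integrable lborel (\<lambda>y. \<bar>indicator ?B y - indicator ?B (y - h)\<bar> :: real)"
      using ball lborel_translate(1)[OF ball] by auto
    fix y
    have "norm y \<le> norm (y - h) + ?x" "norm (y - h) \<le> norm y + ?x"
      using norm_triangle_ineq[of "y - h" h] norm_triangle_ineq4[of y h] by auto
    then show "\<bar>indicator ?B y - indicator ?B (y - h)\<bar> \<le> (indicator ?annulus y :: real)"
      by (auto simp: indicator_def)
  qed
  also have "\<dots> = measure lborel (cball (0::'a) (1 + ?x)) - measure lborel (ball (0::'a) (1 - ?x))"
  proof -
    have "ball 0 (1 - ?x) \<subseteq> cball (0::'a) (1 + ?x)" using norm_ge_zero[of h] by (auto simp del: norm_ge_zero)
    then show ?thesis using bounded[of "1 + ?x"] by (simp add: measure_Diff)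
  qed
  also have "\<dots> = ball_vol TYPE('a) * ((1 + ?x) ^ DIM('a) - (1 - ?x) ^ DIM('a))"
    using assms by (simp add: ball_vol_def content_cball content_ball right_diff_distrib)
  also have "\<dots> \<le> ball_vol TYPE('a) * (real DIM('a) * 2 ^ DIM('a) * ?x)"
    using assms ball_vol_pos[where 'a='a] by (intro mult_left_mono power_diff_power_le) auto
  finally show ?thesis .
qed

lemma measure_ft_unit_ball_decay:
  fixes \<xi> :: "'a::euclidean_space"
  assumes "\<xi> \<noteq> 0"
  shows "cmod (measure_ft unit_ball_measure \<xi>) \<le> real DIM('a) * 2 ^ DIM('a) * pi / norm \<xi>"
proof (cases "pi / norm \<xi> \<le> 1")
  case True
  define h where "h = (pi / (norm \<xi>)\<^sup>2) *\<^sub>R \<xi>"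
  have h: "norm h = pi / norm \<xi>" "\<xi> \<bullet> h = pi"
    using assms by (simp add: h_def power2_eq_square, simp add: h_def power2_norm_eq_inner)
  have V: "0 < ball_vol TYPE('a)" by (rule ball_vol_pos)
  have "integrable lborel (indicator (cball 0 1) :: 'a \<Rightarrow> real)"
    by (intro integrable_real_indicator) (auto simp: emeasure_unit_cball)
  then have "2 * cmod (ft (indicator (cball 0 1)) \<xi>)
      \<le> (\<integral>y. \<bar>indicator (cball 0 1) y - indicator (cball 0 1) (y - h)\<bar> \<partial>lborel)"
    using h(2) by (rule ft_half_period_le)
  also have "\<dots> \<le> ball_vol TYPE('a) * (real DIM('a) * 2 ^ DIM('a) * norm h)"
    using True h(1) by (intro integral_indicator_ball_diff_le) simp
  finally have "cmod (ft (indicator (cball 0 1)) \<xi>) \<le> ball_vol TYPE('a) * (real DIM('a) * 2 ^ DIM('a) * norm h)"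
    using norm_ge_zero[of "ft (indicator (cball 0 1)) \<xi>"] by linarith
  then show ?thesis
    unfolding measure_ft_unit_ball using V h(1) by (simp add: norm_divide field_simps)
next
  case False
  have "cmod (measure_ft unit_ball_measure \<xi>) \<le> 1 * 1 * 1"
    using cmod_measure_ft_le[of unit_ball_measure \<xi>] unit_ball.prob_space[where 'a='a] by simp
  also have "\<dots> \<le> real DIM('a) * 2 ^ DIM('a) * (pi / norm \<xi>)"
    using False by (intro mult_mono) (auto simp: DIM_positive Suc_le_eq)
  finally show ?thesis by simp
qed

definition conv_measure :: "'a::euclidean_space measure \<Rightarrow> real \<Rightarrow> ('a \<Rightarrow> real) \<Rightarrow> 'a \<Rightarrow> real" where
  "conv_measure M r f x = (\<integral>y. f (x - r *\<^sub>R y) \<partial>M)"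

locale bounded_support_measure = finite_measure M for M :: "'a::euclidean_space measure" +
  fixes D :: real
  assumes sets_eq_borel [simp, measurable_cong]: "sets M = sets borel"
    and support: "AE y in M. norm y \<le> D"
begin

lemma space_eq_UNIV [simp]: "space M = UNIV"
  using sets_eq_imp_space_eq[OF sets_eq_borel] by simp

abbreviation "mass \<equiv> measure M UNIV"

lemma measure_ft_near_zero: "cmod (measure_ft M \<xi> - complex_of_real mass) \<le> mass * (D * norm \<xi>)"
proof -
  have cis: "integrable M (\<lambda>y. cis (\<xi> \<bullet> y))" by (rule integrable_const_bound[of _ 1]) auto
  have "measure_ft M \<xi> - complex_of_real mass = (\<integral>y. cis (\<xi> \<bullet> y) - 1 \<partial>M)"
    unfolding measure_ft_def using cis by simp (simp add: scaleR_conv_of_real)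
  also have "cmod \<dots> \<le> (\<integral>y. cmod (cis (\<xi> \<bullet> y) - 1) \<partial>M)" by (rule integral_norm_bound)
  also have "\<dots> \<le> (\<integral>y. D * norm \<xi> \<partial>M)"
  proof (rule integral_mono_AE)
    show "integrable M (\<lambda>y. cmod (cis (\<xi> \<bullet> y) - 1))" using cis by auto
    show "AE y in M. cmod (cis (\<xi> \<bullet> y) - 1) \<le> D * norm \<xi>"
      using support
    proof eventually_elim
      case (elim y)
      have "cmod (cis (\<xi> \<bullet> y) - 1) \<le> \<bar>\<xi> \<bullet> y\<bar>" by (rule cmod_cis_minus_one_le)
      also have "\<dots> \<le> norm y * norm \<xi>" using Cauchy_Schwarz_ineq2[of \<xi> y] by (simp add: mult.commute)
      also have "\<dots> \<le> D * norm \<xi>" using elim by (rule mult_right_mono) simp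
      finally show ?case .
    qed
  qed auto
  finally show ?thesis by simp
qed

lemma continuous_on_conv_measure:
  assumes "Cc f"
  shows "continuous_on UNIV (conv_measure M r f)"
proof (rule continuous_on_sequentiallyI)
  fix u :: "nat \<Rightarrow> 'a" and a assume u: "u \<longlonglongrightarrow> a"
  have [measurable]: "f \<in> borel_measurable borel" by (rule Cc_measurable[OF assms])
  obtain B where B: "\<And>x. \<bar>f x\<bar> \<le> B" using Cc_bound[OF assms] by metis
  show "(\<lambda>n. conv_measure M r f (u n)) \<longlonglongrightarrow> conv_measure M r f a"
    unfolding conv_measure_def
  proof (rule integral_dominated_convergence[where w="\<lambda>_. B"])
    have "(\<lambda>n. f (u n - r *\<^sub>R y)) \<longlonglongrightarrow> f (a - r *\<^sub>R y)" for y
    proof -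
      have "isCont f (a - r *\<^sub>R y)" using assms by (auto simp: Cc_def continuous_on_eq_continuous_at)
      then show ?thesis by (rule isCont_tendsto_compose) (intro tendsto_intros u)
    qed
    then show "AE y in M. (\<lambda>n. f (u n - r *\<^sub>R y)) \<longlonglongrightarrow> f (a - r *\<^sub>R y)" by simp
  qed (auto simp: B)
qed

lemma Cc_conv_measure:
  assumes "Cc f"
  shows "Cc (conv_measure M r f)"
proof -
  obtain R where R: "\<And>x. R < norm x \<Longrightarrow> f x = 0" using Cc_bound[OF assms] by metis
  have [measurable]: "f \<in> borel_measurable borel" by (rule Cc_measurable[OF assms])
  have "conv_measure M r f x = 0" if x: "R + \<bar>r\<bar> * D < norm x" for x
  proof -
    have "AE y in M. f (x - r *\<^sub>R y) = 0"
      using support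
    proof eventually_elim
      case (elim y)
      have "norm x \<le> norm (x - r *\<^sub>R y) + \<bar>r\<bar> * norm y"
        using norm_triangle_ineq[of "x - r *\<^sub>R y" "r *\<^sub>R y"] by simp
      moreover have "\<bar>r\<bar> * norm y \<le> \<bar>r\<bar> * D" using elim by (intro mult_left_mono) auto
      ultimately show ?case using x by (intro R) simp
    qed
    then have "conv_measure M r f x = (\<integral>y. 0 \<partial>M)"
      unfolding conv_measure_def by (intro integral_cong_AE) auto
    then show ?thesis by simp
  qed
  then show ?thesis using continuous_on_conv_measure[OF assms] by (auto simp: Cc_def)
qed

lemma integrable_conv_measure_kernel:
  assumes f: "integrable lborel f"
  shows "integrable (lborel \<Otimes>\<^sub>M M) (\<lambda>(x, y). complex_of_real (f (x - r *\<^sub>R y)) * cis (\<xi> \<bullet> x))"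
proof (rule integrableI_bounded)
  interpret P: pair_sigma_finite "lborel :: 'a measure" M ..
  let ?h = "\<lambda>(x, y). complex_of_real (f (x - r *\<^sub>R y)) * cis (\<xi> \<bullet> x)"
  have [measurable]: "f \<in> borel_measurable borel" using f by auto
  show "?h \<in> borel_measurable (lborel \<Otimes>\<^sub>M M)" by measurable
  have "(\<integral>\<^sup>+p. ennreal (norm (?h p)) \<partial>(lborel \<Otimes>\<^sub>M M)) = (\<integral>\<^sup>+y. \<integral>\<^sup>+x. ennreal \<bar>f (x - r *\<^sub>R y)\<bar> \<partial>lborel \<partial>M)"
    by (subst P.nn_integral_snd[symmetric]) (auto simp: norm_mult)
  also have "\<dots> = (\<integral>\<^sup>+y. \<integral>\<^sup>+x. ennreal \<bar>f x\<bar> \<partial>lborel \<partial>M)"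
    by (intro nn_integral_cong nn_integral_lborel_translate) measurable
  also have "\<dots> = (\<integral>\<^sup>+x. ennreal \<bar>f x\<bar> \<partial>lborel) * emeasure M UNIV" by simp
  also have "\<dots> < \<infinity>"
    using f emeasure_finite[of UNIV]
    by (auto simp: integrable_iff_bounded less_top[symmetric] ennreal_mult_eq_top_iff)
  finally show "(\<integral>\<^sup>+p. ennreal (norm (?h p)) \<partial>(lborel \<Otimes>\<^sub>M M)) < \<infinity>" .
qed

lemma ft_conv_measure:
  assumes f: "integrable lborel f"
  shows "ft (conv_measure M r f) \<xi> = measure_ft M (r *\<^sub>R \<xi>) * ft f \<xi>"
proof -
  interpret P: pair_sigma_finite "lborel :: 'a measure" M ..
  let ?h = "\<lambda>x y. complex_of_real (f (x - r *\<^sub>R y)) * cis (\<xi> \<bullet> x)"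
  have "complex_of_real (\<integral>y. f (x - r *\<^sub>R y) \<partial>M) * cis (\<xi> \<bullet> x) = (\<integral>y. ?h x y \<partial>M)" for x
  proof -
    have "(\<integral>y. ?h x y \<partial>M) = (\<integral>y. complex_of_real (f (x - r *\<^sub>R y)) \<partial>M) * cis (\<xi> \<bullet> x)"
      by (rule integral_mult_left_zero)
    then show ?thesis by simp
  qed
  then have "ft (conv_measure M r f) \<xi> = (\<integral>x. \<integral>y. ?h x y \<partial>M \<partial>lborel)"
    unfolding ft_def conv_measure_def by simp
  also have "\<dots> = (\<integral>y. \<integral>x. ?h x y \<partial>lborel \<partial>M)"
    by (rule P.Fubini_integral[OF integrable_conv_measure_kernel[OF f], symmetric])
  also have "\<dots> = (\<integral>y. cis ((r *\<^sub>R \<xi>) \<bullet> y) * ft f \<xi> \<partial>M)"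
    using ft_translate[OF f] unfolding ft_def by (simp add: mult.commute)
  also have "\<dots> = measure_ft M (r *\<^sub>R \<xi>) * ft f \<xi>"
    unfolding measure_ft_def by (rule integral_mult_left_zero)
  finally show ?thesis .
qed

end

interpretation unit_ball: bounded_support_measure "unit_ball_measure :: 'a::euclidean_space measure" 1
proof
  show "AE y in (unit_ball_measure :: 'a measure). norm y \<le> 1"
    unfolding unit_ball_measure_def
    using ball_vol_pos[where 'a='a] by (intro AE_uniform_measureI) (auto simp: emeasure_unit_cball)
qed simp

section \<open>Dyadic maximal functions of measures\<close>

lemma L2_sq_abs_eq_integral:
  assumes "integrable lborel (\<lambda>x. (f x)\<^sup>2)"
  shows "L2_sq (\<lambda>x. ennreal \<bar>f x\<bar>) = ennreal (\<integral>x. (f x)\<^sup>2 \<partial>lborel)"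
  using nn_integral_eq_integral[OF assms] by (simp add: L2_sq_def ennreal_power)

lemma SUP_square_ennreal_le:
  fixes S :: "nat \<Rightarrow> ennreal"
  assumes "incseq S"
  shows "(SUP n. S n)\<^sup>2 \<le> (SUP n. (S n)\<^sup>2)"
proof -
  have "(SUP n. S n)\<^sup>2 = (SUP i. (SUP j. S j) * S i)"
    unfolding power2_eq_square by (rule SUP_mult_left_ennreal)
  also have "\<dots> = (SUP i. SUP j. S j * S i)"
    by (simp add: SUP_mult_right_ennreal)
  also have "\<dots> \<le> (SUP n. (S n)\<^sup>2)"
  proof (intro SUP_least)
    fix i j
    have "S j * S i \<le> S (max i j) * S (max i j)"
      using assms by (intro mult_mono) (auto simp: incseq_def)
    also have "\<dots> \<le> (SUP n. (S n)\<^sup>2)" unfolding power2_eq_square[symmetric] by (rule SUP_upper) simp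
    finally show "S j * S i \<le> (SUP n. (S n)\<^sup>2)" .
  qed
  finally show ?thesis .
qed

lemma L2_sq_SUP_incseq_le:
  assumes S: "\<And>n. S n \<in> borel_measurable borel" and mono: "\<And>x. incseq (\<lambda>n. S n x)"
  shows "L2_sq (\<lambda>x. SUP n. S n x) \<le> (SUP n. L2_sq (S n))"
proof -
  have "L2_sq (\<lambda>x. SUP n. S n x) \<le> (\<integral>\<^sup>+x. (SUP n. (S n x)\<^sup>2) \<partial>lborel)"
    unfolding L2_sq_def by (intro nn_integral_mono SUP_square_ennreal_le mono)
  also have "\<dots> = (SUP n. L2_sq (S n))"
    unfolding L2_sq_def using S mono
    by (intro nn_integral_monotone_convergence_SUP) (auto simp: incseq_def le_fun_def intro!: power_mono_ennreal)
  finally show ?thesis .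
qed

lemma L2_sq_tendsto_of_bounded:
  fixes u :: "nat \<Rightarrow> 'a::euclidean_space \<Rightarrow> real"
  assumes [measurable]: "\<And>n. u n \<in> borel_measurable borel" "v \<in> borel_measurable borel"
    and bound: "\<And>n x. \<bar>u n x\<bar> \<le> B" and support: "\<And>n x. R < norm x \<Longrightarrow> u n x = 0"
    and lim: "AE x in lborel. (\<lambda>n. u n x) \<longlonglongrightarrow> v x"
  shows "(\<lambda>n. L2_sq (\<lambda>x. ennreal \<bar>u n x\<bar>)) \<longlonglongrightarrow> L2_sq (\<lambda>x. ennreal \<bar>v x\<bar>)"
proof -
  let ?w = "\<lambda>x::'a. ennreal (B\<^sup>2) * indicator (cball 0 R) x"
  have "(\<lambda>n. \<integral>\<^sup>+x. ennreal ((u n x)\<^sup>2) \<partial>lborel) \<longlonglongrightarrow> (\<integral>\<^sup>+x. ennreal ((v x)\<^sup>2) \<partial>lborel)"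
  proof (rule nn_integral_dominated_convergence[where w = ?w])
    have "emeasure lborel (cball (0::'a) R) < \<infinity>" by (rule emeasure_bounded_finite) simp
    then show "(\<integral>\<^sup>+x. ?w x \<partial>lborel) < \<infinity>"
      by (simp add: nn_integral_cmult ennreal_mult_less_top)
    have "(u n x)\<^sup>2 \<le> B\<^sup>2" for n x
      using power_mono[OF bound[of n x], of 2] by simp
    then show "AE x in lborel. ennreal ((u n x)\<^sup>2) \<le> ?w x" for n
      using support by (intro AE_I2) (auto simp: indicator_def not_le intro: ennreal_leI)
    show "AE x in lborel. (\<lambda>n. ennreal ((u n x)\<^sup>2)) \<longlonglongrightarrow> ennreal ((v x)\<^sup>2)"
      using lim by eventually_elim (intro tendsto_ennrealI tendsto_intros)
  qed measurable
  then show ?thesis by (simp add: L2_sq_def ennreal_power)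
qed

lemma Cc_AE_approximation:
  fixes f :: "'a::euclidean_space \<Rightarrow> real"
  assumes [measurable]: "f \<in> borel_measurable borel"
    and B: "\<And>x. \<bar>f x\<bar> \<le> B" and R: "\<And>x. R < norm x \<Longrightarrow> f x = 0"
  obtains h where "\<And>n::nat. Cc (h n)" "\<And>n x. \<bar>h n x\<bar> \<le> B" "\<And>n x. R + 1 < norm x \<Longrightarrow> h n x = 0"
    "AE x in lborel. (\<lambda>n. h n x) \<longlonglongrightarrow> f x"
proof -
  have "f measurable_on UNIV"
    by (intro lebesgue_measurable_imp_measurable_on measurable_completion) auto
  then obtain N g where N: "negligible N" and g: "\<And>n. continuous_on UNIV (g n)"
    and lim: "\<And>x. x \<notin> N \<Longrightarrow> (\<lambda>n. g n x) \<longlonglongrightarrow> f x"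
    unfolding measurable_on_def by auto
  define cutoff where "cutoff x = max 0 (1 - max 0 (norm x - R))" for x :: 'a
  define h where "h n x = cutoff x * max (- B) (min B (g n x))" for n x
  have outside: "h n x = 0" if "R + 1 < norm x" for n x using that by (simp add: h_def cutoff_def)
  have "continuous_on UNIV (h n)" for n
    unfolding h_def cutoff_def by (intro continuous_intros g)
  then have "Cc (h n)" for n
    unfolding Cc_def using outside by blast
  moreover have "\<bar>h n x\<bar> \<le> B" for n x
  proof -
    have "0 \<le> cutoff x" "cutoff x \<le> 1" "0 \<le> B" using B[of 0] by (auto simp: cutoff_def)
    then have "cutoff x * \<bar>max (- B) (min B (g n x))\<bar> \<le> 1 * B" by (intro mult_mono) auto
    then show ?thesis using \<open>0 \<le> cutoff x\<close> by (simp add: h_def abs_mult)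
  qed
  moreover have "AE x in lborel. (\<lambda>n. h n x) \<longlonglongrightarrow> f x"
  proof -
    have "AE x in lebesgue. x \<notin> N"
      using N by (intro AE_not_in) (simp add: negligible_iff_null_sets)
    then have "AE x in lebesgue. (\<lambda>n. h n x) \<longlonglongrightarrow> f x"
    proof eventually_elim
      case (elim x)
      have "(\<lambda>n. h n x) \<longlonglongrightarrow> cutoff x * max (- B) (min B (f x))"
        unfolding h_def by (intro tendsto_intros tendsto_max tendsto_min lim elim)
      also have "max (- B) (min B (f x)) = f x" using B[of x] by auto
      also have "cutoff x * f x = f x" using R[of x] by (cases "norm x \<le> R") (auto simp: cutoff_def)
      finally show ?case .
    qed
    then show ?thesis by (simp add: AE_completion_iff)
  qed
  ultimately show thesis using outside that by blast
qed

lemma Cc_L2_approximation: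
  fixes f :: "'a::euclidean_space \<Rightarrow> real"
  assumes f[measurable]: "f \<in> borel_measurable borel"
    and B: "\<And>x. \<bar>f x\<bar> \<le> B" and R: "\<And>x. R < norm x \<Longrightarrow> f x = 0"
  obtains h where "\<And>n::nat. Cc (h n)"
    "(\<lambda>n. L2_sq (\<lambda>x. ennreal \<bar>h n x\<bar>)) \<longlonglongrightarrow> L2_sq (\<lambda>x. ennreal \<bar>f x\<bar>)"
    "(\<lambda>n. L2_sq (\<lambda>x. ennreal \<bar>f x - h n x\<bar>)) \<longlonglongrightarrow> 0"
proof -
  obtain h where h: "\<And>n. Cc (h n)" "\<And>n x. \<bar>h n x\<bar> \<le> B" "\<And>n x. R + 1 < norm x \<Longrightarrow> h n x = 0"
    and lim: "AE x in lborel. (\<lambda>n. h n x) \<longlonglongrightarrow> f x"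
    by (rule Cc_AE_approximation[of f B R]) (use f B R that in auto)
  have [measurable]: "h n \<in> borel_measurable borel" for n by (rule Cc_measurable[OF h(1)])
  have "(\<lambda>n. L2_sq (\<lambda>x. ennreal \<bar>h n x\<bar>)) \<longlonglongrightarrow> L2_sq (\<lambda>x. ennreal \<bar>f x\<bar>)"
    by (rule L2_sq_tendsto_of_bounded[OF _ f h(2,3) lim]) measurable
  moreover have "(\<lambda>n. L2_sq (\<lambda>x. ennreal \<bar>f x - h n x\<bar>)) \<longlonglongrightarrow> L2_sq (\<lambda>x::'a. ennreal \<bar>0\<bar>)"
  proof (rule L2_sq_tendsto_of_bounded)
    show "\<bar>f x - h n x\<bar> \<le> B + B" for n x using B[of x] h(2)[of n x] by linarith
    show "f x - h n x = 0" if "R + 1 < norm x" for n x using that R[of x] h(3)[of x n] by simp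
    show "AE x in lborel. (\<lambda>n. f x - h n x) \<longlonglongrightarrow> 0"
      using lim
    proof eventually_elim
      case (elim x)
      show ?case using tendsto_diff[OF tendsto_const elim, of "f x"] by simp
    qed
  qed measurable
  then have "(\<lambda>n. L2_sq (\<lambda>x. ennreal \<bar>f x - h n x\<bar>)) \<longlonglongrightarrow> 0"
    by (simp add: L2_sq_def[of "\<lambda>_. 0"])
  ultimately show thesis using h(1) by (intro that)
qed

definition truncation :: "nat \<Rightarrow> ('a::real_normed_vector \<Rightarrow> real) \<Rightarrow> 'a \<Rightarrow> real" where
  "truncation n f x = (if \<bar>f x\<bar> \<le> real n \<and> norm x \<le> real n then \<bar>f x\<bar> else 0)"

lemma measurable_truncation [measurable]:
  fixes f :: "'a::euclidean_space \<Rightarrow> real"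
  assumes [measurable]: "f \<in> borel_measurable borel"
  shows "truncation n f \<in> borel_measurable borel"
  unfolding truncation_def[abs_def] by measurable

lemma truncation_mono: "m \<le> n \<Longrightarrow> truncation m f x \<le> truncation n f x"
  by (auto simp: truncation_def)

lemma SUP_truncation: "(SUP n. ennreal (truncation n f x)) = ennreal \<bar>f x\<bar>"
proof (rule antisym)
  show "(SUP n. ennreal (truncation n f x)) \<le> ennreal \<bar>f x\<bar>"
    by (intro SUP_least ennreal_leI) (simp add: truncation_def)
  obtain n :: nat where "max \<bar>f x\<bar> (norm x) \<le> real n" using real_arch_simple by blast
  then have "truncation n f x = \<bar>f x\<bar>" by (simp add: truncation_def)
  then show "ennreal \<bar>f x\<bar> \<le> (SUP n. ennreal (truncation n f x))" by (metis SUP_upper UNIV_I)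
qed

definition dyadic_maximal :: "'a::euclidean_space measure \<Rightarrow> ('a \<Rightarrow> real) \<Rightarrow> 'a \<Rightarrow> ennreal" where
  "dyadic_maximal M f x = (SUP k::int. ennreal \<bar>conv_measure M (2 powr k) f x\<bar>)"

context bounded_support_measure
begin

definition truncated_max :: "nat \<Rightarrow> ('a \<Rightarrow> real) \<Rightarrow> 'a \<Rightarrow> ennreal" where
  "truncated_max n f x = (SUP k\<in>{- int n..int n}. dilation_avg M (2 powr k) (\<lambda>x. ennreal (f x)) x)"

lemma measurable_dilation_avg_M [measurable]:
  "h \<in> borel_measurable borel \<Longrightarrow> dilation_avg M r h \<in> borel_measurable borel"
  by (rule measurable_dilation_avg[OF finite_measure_axioms sets_eq_borel])

lemma L2_sq_dilation_avg_M_le: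
  "h \<in> borel_measurable borel \<Longrightarrow> L2_sq (dilation_avg M r h) \<le> (ennreal mass)\<^sup>2 * L2_sq h"
  using L2_sq_dilation_avg_le[OF finite_measure_axioms sets_eq_borel] by (simp add: emeasure_eq_measure)

lemma dyadic_maximal_le_truncated_max:
  assumes [measurable]: "f \<in> borel_measurable borel"
  shows "dyadic_maximal M f x \<le> (SUP n. truncated_max n (truncation n f) x)"
  unfolding dyadic_maximal_def
proof (rule SUP_least)
  fix k :: int
  let ?g = "\<lambda>y. f (x - (2 powr k) *\<^sub>R y)"
  have "ennreal \<bar>conv_measure M (2 powr k) f x\<bar> \<le> (\<integral>\<^sup>+y. ennreal \<bar>?g y\<bar> \<partial>M)"
  proof (cases "integrable M ?g")
    case True
    then show ?thesis using integral_norm_bound_ennreal[OF True] by (simp add: conv_measure_def)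
  qed (simp add: conv_measure_def not_integrable_integral_eq)
  also have "\<dots> = (SUP n. dilation_avg M (2 powr k) (\<lambda>x. ennreal (truncation n f x)) x)"
    unfolding dilation_avg_def SUP_truncation[symmetric]
    by (intro nn_integral_monotone_convergence_SUP)
       (auto simp: incseq_def le_fun_def intro!: ennreal_leI truncation_mono)
  also have "\<dots> \<le> (SUP n. truncated_max n (truncation n f) x)"
  proof (rule SUP_least)
    fix n :: nat
    let ?m = "max n (nat \<bar>k\<bar>)"
    have "dilation_avg M (2 powr k) (\<lambda>x. ennreal (truncation n f x)) x
        \<le> dilation_avg M (2 powr k) (\<lambda>x. ennreal (truncation ?m f x)) x"
      unfolding dilation_avg_def by (intro nn_integral_mono ennreal_leI truncation_mono) simp
    also have "\<dots> \<le> truncated_max ?m (truncation ?m f) x" unfolding truncated_max_def by (intro SUP_upper) auto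
    also have "\<dots> \<le> (SUP n. truncated_max n (truncation n f) x)" by (rule SUP_upper) simp
    finally show "dilation_avg M (2 powr k) (\<lambda>x. ennreal (truncation n f x)) x
        \<le> (SUP n. truncated_max n (truncation n f) x)" .
  qed
  finally show "ennreal \<bar>conv_measure M (2 powr k) f x\<bar> \<le> (SUP n. truncated_max n (truncation n f) x)" .
qed

lemma incseq_truncated_max: "incseq (\<lambda>n. truncated_max n (truncation n f) x)"
proof (rule incseq_SucI)
  fix n
  have "dilation_avg M r (\<lambda>x. ennreal (truncation n f x)) x
      \<le> dilation_avg M r (\<lambda>x. ennreal (truncation (Suc n) f x)) x" for r
    unfolding dilation_avg_def by (intro nn_integral_mono ennreal_leI truncation_mono) simp
  then show "truncated_max n (truncation n f) x \<le> truncated_max (Suc n) (truncation (Suc n) f) x"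
    unfolding truncated_max_def by (intro SUP_mono) force
qed

definition defect :: "real \<Rightarrow> ('a \<Rightarrow> real) \<Rightarrow> 'a \<Rightarrow> real" where
  "defect r f x = conv_measure M r f x - mass * conv_measure unit_ball_measure r f x"

definition defect_multiplier :: "'a \<Rightarrow> complex" where
  "defect_multiplier \<xi> = measure_ft M \<xi> - complex_of_real mass * measure_ft unit_ball_measure \<xi>"

definition multiplier_square_bound :: "real \<Rightarrow> bool" where
  "multiplier_square_bound C \<longleftrightarrow>
     (\<forall>\<xi> F. finite F \<longrightarrow> (\<Sum>k::int\<in>F. (cmod (defect_multiplier (2 powr k *\<^sub>R \<xi>)))\<^sup>2) \<le> C)"

lemma Cc_defect:
  assumes "Cc f"
  shows "Cc (defect r f)"
proof -
  obtain R S where "\<forall>x. R < norm x \<longrightarrow> conv_measure M r f x = 0"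
      "\<forall>x. S < norm x \<longrightarrow> conv_measure unit_ball_measure r f x = 0"
    using Cc_conv_measure[OF assms] unit_ball.Cc_conv_measure[OF assms] unfolding Cc_def by blast
  then have "\<forall>x. max R S < norm x \<longrightarrow> defect r f x = 0" by (simp add: defect_def)
  moreover have "continuous_on UNIV (defect r f)"
    unfolding defect_def[abs_def]
    by (intro continuous_intros continuous_on_conv_measure unit_ball.continuous_on_conv_measure assms)
  ultimately show ?thesis unfolding Cc_def by blast
qed

lemma ft_defect:
  assumes "Cc f"
  shows "ft (defect r f) \<xi> = defect_multiplier (r *\<^sub>R \<xi>) * ft f \<xi>"
proof -
  have "ft (defect r f) \<xi>
      = ft (conv_measure M r f) \<xi> - complex_of_real mass * ft (conv_measure unit_ball_measure r f) \<xi>"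
    unfolding defect_def[abs_def]
    by (intro ft_diff_cmult Cc_integrable Cc_conv_measure unit_ball.Cc_conv_measure assms)
  then show ?thesis
    by (simp add: ft_conv_measure unit_ball.ft_conv_measure Cc_integrable[OF assms] defect_multiplier_def
        algebra_simps)
qed

lemma L2_sq_defect_sum_le:
  fixes F :: "int set"
  assumes multiplier: "multiplier_square_bound C" and F: "finite F" and C: "0 \<le> C" and f: "Cc f"
  shows "(\<Sum>k\<in>F. L2_sq (\<lambda>x. ennreal \<bar>defect (2 powr k) f x\<bar>)) \<le> ennreal C * L2_sq (\<lambda>x. ennreal \<bar>f x\<bar>)"
proof -
  have "(\<Sum>k\<in>F. \<integral>x. (defect (2 powr k) f x)\<^sup>2 \<partial>lborel) \<le> C * (\<integral>x. (f x)\<^sup>2 \<partial>lborel)"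
  proof (rule sum_L2_le_of_ft_le[OF f Cc_defect[OF f] C])
    fix \<xi>
    have "(\<Sum>k\<in>F. (cmod (ft (defect (2 powr k) f) \<xi>))\<^sup>2)
        = (\<Sum>k\<in>F. (cmod (defect_multiplier (2 powr k *\<^sub>R \<xi>)))\<^sup>2) * (cmod (ft f \<xi>))\<^sup>2"
      by (simp add: ft_defect[OF f] norm_mult power_mult_distrib sum_distrib_right)
    also have "\<dots> \<le> C * (cmod (ft f \<xi>))\<^sup>2"
      using multiplier F by (intro mult_right_mono) (auto simp: multiplier_square_bound_def)
    finally show "(\<Sum>k\<in>F. (cmod (ft (defect (2 powr k) f) \<xi>))\<^sup>2) \<le> C * (cmod (ft f \<xi>))\<^sup>2" .
  qed
  then have "ennreal (\<Sum>k\<in>F. \<integral>x. (defect (2 powr k) f x)\<^sup>2 \<partial>lborel) \<le> ennreal (C * (\<integral>x. (f x)\<^sup>2 \<partial>lborel))"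
    by (rule ennreal_leI)
  then show ?thesis
    using C by (simp add: L2_sq_abs_eq_integral Cc_square_integrable Cc_defect f sum_ennreal ennreal_mult)
qed

lemma dilation_avg_le_conv_measure:
  assumes [measurable]: "f \<in> borel_measurable borel" and f: "\<And>x. 0 \<le> f x" "\<And>x. f x \<le> B" and h: "Cc h"
  shows "dilation_avg M r (\<lambda>z. ennreal (f z)) x
      \<le> ennreal \<bar>conv_measure M r h x\<bar> + dilation_avg M r (\<lambda>z. ennreal \<bar>f z - h z\<bar>) x"
proof -
  have [measurable]: "h \<in> borel_measurable borel" by (rule Cc_measurable[OF h])
  obtain B' where B': "\<And>x. \<bar>h x\<bar> \<le> B'" using Cc_bound[OF h] by metis
  have f_int: "integrable M (\<lambda>y. f (x - r *\<^sub>R y))"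
    using f by (intro integrable_const_bound[of _ B]) auto
  have h_int: "integrable M (\<lambda>y. h (x - r *\<^sub>R y))"
    using B' by (intro integrable_const_bound[of _ B']) auto
  have "conv_measure M r f x = conv_measure M r h x + (\<integral>y. f (x - r *\<^sub>R y) - h (x - r *\<^sub>R y) \<partial>M)"
    using f_int h_int by (simp add: conv_measure_def)
  also have "\<dots> \<le> \<bar>conv_measure M r h x\<bar> + (\<integral>y. \<bar>f (x - r *\<^sub>R y) - h (x - r *\<^sub>R y)\<bar> \<partial>M)"
    using f_int h_int by (intro add_mono integral_mono) auto
  finally have "ennreal (conv_measure M r f x)
      \<le> ennreal \<bar>conv_measure M r h x\<bar> + ennreal (\<integral>y. \<bar>f (x - r *\<^sub>R y) - h (x - r *\<^sub>R y)\<bar> \<partial>M)"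
    by (simp add: ennreal_leI flip: ennreal_plus)
  moreover have "dilation_avg M r (\<lambda>z. ennreal (f z)) x = ennreal (conv_measure M r f x)"
    unfolding dilation_avg_def conv_measure_def using f by (intro nn_integral_eq_integral f_int) auto
  moreover have "dilation_avg M r (\<lambda>z. ennreal \<bar>f z - h z\<bar>) x
      = ennreal (\<integral>y. \<bar>f (x - r *\<^sub>R y) - h (x - r *\<^sub>R y)\<bar> \<partial>M)"
    unfolding dilation_avg_def using f_int h_int by (intro nn_integral_eq_integral) auto
  ultimately show ?thesis by simp
qed

lemma conv_measure_le_defect:
  assumes h: "Cc h" and r: "0 < r"
  shows "ennreal \<bar>conv_measure M r h x\<bar>
      \<le> ennreal mass * ball_avg r (\<lambda>z. ennreal \<bar>h z\<bar>) x + ennreal \<bar>defect r h x\<bar>"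
proof -
  have [measurable]: "h \<in> borel_measurable borel" by (rule Cc_measurable[OF h])
  obtain B where B: "\<And>x. \<bar>h x\<bar> \<le> B" using Cc_bound[OF h] by metis
  have "integrable unit_ball_measure (\<lambda>y. h (x - r *\<^sub>R y))"
    using B by (intro unit_ball.integrable_const_bound[of _ B]) auto
  then have "ennreal (norm (\<integral>y. h (x - r *\<^sub>R y) \<partial>unit_ball_measure))
      \<le> (\<integral>\<^sup>+y. ennreal (norm (h (x - r *\<^sub>R y))) \<partial>unit_ball_measure)"
    by (rule integral_norm_bound_ennreal)
  then have ball: "ennreal \<bar>conv_measure unit_ball_measure r h x\<bar> \<le> ball_avg r (\<lambda>z. ennreal \<bar>h z\<bar>) x"
    using r by (simp add: ball_avg_eq_dilation_avg dilation_avg_def conv_measure_def)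
  have "\<bar>conv_measure M r h x\<bar> \<le> mass * \<bar>conv_measure unit_ball_measure r h x\<bar> + \<bar>defect r h x\<bar>"
    using abs_triangle_ineq[of "mass * conv_measure unit_ball_measure r h x" "defect r h x"]
    by (simp add: defect_def abs_mult)
  then have "ennreal \<bar>conv_measure M r h x\<bar>
      \<le> ennreal mass * ennreal \<bar>conv_measure unit_ball_measure r h x\<bar> + ennreal \<bar>defect r h x\<bar>"
    by (simp add: ennreal_leI flip: ennreal_plus ennreal_mult)
  also have "\<dots> \<le> ennreal mass * ball_avg r (\<lambda>z. ennreal \<bar>h z\<bar>) x + ennreal \<bar>defect r h x\<bar>"
    by (intro add_right_mono mult_left_mono ball) simp
  finally show ?thesis .
qed

lemma truncated_max_le:
  assumes "f \<in> borel_measurable borel" and "\<And>x. 0 \<le> f x" "\<And>x. f x \<le> B" and h: "Cc h"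
  shows "truncated_max n f x \<le> ennreal mass * dyadic_max n (\<lambda>z. ennreal \<bar>h z\<bar>) x
     + ((SUP k\<in>{- int n..int n}. ennreal \<bar>defect (2 powr k) h x\<bar>)
       + (SUP k\<in>{- int n..int n}. dilation_avg M (2 powr k) (\<lambda>z. ennreal \<bar>f z - h z\<bar>) x))"
  unfolding truncated_max_def
proof (rule SUP_least)
  fix k assume k: "k \<in> {- int n..int n}"
  have "dilation_avg M (2 powr k) (\<lambda>z. ennreal (f z)) x
      \<le> ennreal \<bar>conv_measure M (2 powr k) h x\<bar> + dilation_avg M (2 powr k) (\<lambda>z. ennreal \<bar>f z - h z\<bar>) x"
    using assms by (rule dilation_avg_le_conv_measure)
  also have "\<dots> \<le> (ennreal mass * ball_avg (2 powr k) (\<lambda>z. ennreal \<bar>h z\<bar>) x + ennreal \<bar>defect (2 powr k) h x\<bar>)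
        + dilation_avg M (2 powr k) (\<lambda>z. ennreal \<bar>f z - h z\<bar>) x"
    by (intro add_right_mono conv_measure_le_defect h) simp
  also have "\<dots> \<le> (ennreal mass * dyadic_max n (\<lambda>z. ennreal \<bar>h z\<bar>) x
       + (SUP k\<in>{- int n..int n}. ennreal \<bar>defect (2 powr k) h x\<bar>))
       + (SUP k\<in>{- int n..int n}. dilation_avg M (2 powr k) (\<lambda>z. ennreal \<bar>f z - h z\<bar>) x)"
    using k by (intro add_mono mult_left_mono ball_avg_le_dyadic_max) (auto intro: SUP_upper)
  finally show "dilation_avg M (2 powr k) (\<lambda>z. ennreal (f z)) x
      \<le> ennreal mass * dyadic_max n (\<lambda>z. ennreal \<bar>h z\<bar>) x
     + ((SUP k\<in>{- int n..int n}. ennreal \<bar>defect (2 powr k) h x\<bar>)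
       + (SUP k\<in>{- int n..int n}. dilation_avg M (2 powr k) (\<lambda>z. ennreal \<bar>f z - h z\<bar>) x))"
    by (simp add: add.assoc)
qed

definition maximal_constant :: "real \<Rightarrow> ennreal" where
  "maximal_constant C = 2 * ((ennreal mass)\<^sup>2 * ennreal (ball_max_constant TYPE('a))) + 4 * ennreal C"

lemma L2_sq_truncated_max_le_approximation:
  assumes multiplier: "multiplier_square_bound C" and C: "0 \<le> C"
    and f_meas[measurable]: "f \<in> borel_measurable borel" and f: "\<And>x. 0 \<le> f x" "\<And>x. f x \<le> B" and h: "Cc h"
  shows "L2_sq (truncated_max n f) \<le> maximal_constant C * L2_sq (\<lambda>x. ennreal \<bar>h x\<bar>)
      + 4 * of_nat (2 * n + 1) * (ennreal mass)\<^sup>2 * L2_sq (\<lambda>x. ennreal \<bar>f x - h x\<bar>)"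
proof -
  let ?K = "{- int n..int n}"
  have [measurable]: "h \<in> borel_measurable borel" by (rule Cc_measurable[OF h])
  have [measurable]: "defect r h \<in> borel_measurable borel" for r by (rule Cc_measurable[OF Cc_defect[OF h]])
  define ball_part where "ball_part x = ennreal mass * dyadic_max n (\<lambda>z. ennreal \<bar>h z\<bar>) x" for x
  define defect_part where "defect_part x = (SUP k\<in>?K. ennreal \<bar>defect (2 powr k) h x\<bar>)" for x
  define error_part where "error_part x = (SUP k\<in>?K. dilation_avg M (2 powr k) (\<lambda>z. ennreal \<bar>f z - h z\<bar>) x)" for x
  have [measurable]: "ball_part \<in> borel_measurable borel" "defect_part \<in> borel_measurable borel"
      "error_part \<in> borel_measurable borel"
    unfolding ball_part_def[abs_def] defect_part_def[abs_def] error_part_def[abs_def] by measurable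
  have "L2_sq (truncated_max n f) \<le> L2_sq (\<lambda>x. ball_part x + (defect_part x + error_part x))"
    unfolding ball_part_def defect_part_def error_part_def
    by (intro L2_sq_mono truncated_max_le[where B=B] f_meas f h)
  also have "\<dots> \<le> 2 * L2_sq ball_part + 2 * L2_sq (\<lambda>x. defect_part x + error_part x)"
    by (rule L2_sq_add_le) measurable
  also have "\<dots> \<le> 2 * L2_sq ball_part + 2 * (2 * L2_sq defect_part + 2 * L2_sq error_part)"
    by (intro add_left_mono mult_left_mono L2_sq_add_le) auto
  also have "\<dots> = 2 * L2_sq ball_part + 4 * L2_sq defect_part + 4 * L2_sq error_part"
    by (simp add: distrib_left add.assoc flip: mult.assoc)
  also have "L2_sq ball_part \<le> (ennreal mass)\<^sup>2
      * (ennreal (ball_max_constant TYPE('a)) * L2_sq (\<lambda>x. ennreal \<bar>h x\<bar>))"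
    unfolding ball_part_def[abs_def] by (subst L2_sq_cmult) (auto intro!: mult_left_mono L2_sq_dyadic_max_le)
  also have "L2_sq defect_part \<le> ennreal C * L2_sq (\<lambda>x. ennreal \<bar>h x\<bar>)"
    unfolding defect_part_def[abs_def]
    by (rule order_trans[OF L2_sq_SUP_le_sum L2_sq_defect_sum_le]) (auto intro: multiplier C h)
  also have "L2_sq error_part \<le> (\<Sum>k\<in>?K. (ennreal mass)\<^sup>2 * L2_sq (\<lambda>x. ennreal \<bar>f x - h x\<bar>))"
    unfolding error_part_def[abs_def]
    by (rule order_trans[OF L2_sq_SUP_le_sum sum_mono[OF L2_sq_dilation_avg_M_le]]) auto
  also have "\<dots> = of_nat (2 * n + 1) * ((ennreal mass)\<^sup>2 * L2_sq (\<lambda>x. ennreal \<bar>f x - h x\<bar>))"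
  proof -
    have "card ?K = 2 * n + 1" by simp
    then show ?thesis by (simp only: sum_constant)
  qed
  finally show ?thesis
    by (simp add: maximal_constant_def distrib_right mult.assoc add_right_mono mult_left_mono)
qed

lemma L2_sq_truncated_max_le:
  assumes multiplier: "multiplier_square_bound C" and C: "0 \<le> C"
    and f_meas: "f \<in> borel_measurable borel"
    and f: "\<And>x. 0 \<le> f x" "\<And>x. f x \<le> B" "\<And>x. R < norm x \<Longrightarrow> f x = 0"
  shows "L2_sq (truncated_max n f) \<le> maximal_constant C * L2_sq (\<lambda>x. ennreal \<bar>f x\<bar>)"
proof -
  obtain h where h: "\<And>j. Cc (h j)"
    and lim: "(\<lambda>j. L2_sq (\<lambda>x. ennreal \<bar>h j x\<bar>)) \<longlonglongrightarrow> L2_sq (\<lambda>x. ennreal \<bar>f x\<bar>)"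
      "(\<lambda>j. L2_sq (\<lambda>x. ennreal \<bar>f x - h j x\<bar>)) \<longlonglongrightarrow> 0"
    by (rule Cc_L2_approximation[OF f_meas, of B R]) (use f in auto)
  let ?c = "4 * of_nat (2 * n + 1) * (ennreal mass)\<^sup>2"
  have "maximal_constant C < top" "?c < top"
    by (auto simp: maximal_constant_def ennreal_mult_less_top power_less_top_ennreal of_nat_less_top)
  then have "(\<lambda>j. maximal_constant C * L2_sq (\<lambda>x. ennreal \<bar>h j x\<bar>) + ?c * L2_sq (\<lambda>x. ennreal \<bar>f x - h j x\<bar>))
      \<longlonglongrightarrow> maximal_constant C * L2_sq (\<lambda>x. ennreal \<bar>f x\<bar>) + ?c * 0"
    by (intro tendsto_add ennreal_tendsto_cmult lim)
  moreover have "L2_sq (truncated_max n f)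
      \<le> maximal_constant C * L2_sq (\<lambda>x. ennreal \<bar>h j x\<bar>) + ?c * L2_sq (\<lambda>x. ennreal \<bar>f x - h j x\<bar>)" for j
    by (rule L2_sq_truncated_max_le_approximation[OF multiplier C f_meas f(1,2) h])
  ultimately have "L2_sq (truncated_max n f) \<le> maximal_constant C * L2_sq (\<lambda>x. ennreal \<bar>f x\<bar>) + ?c * 0"
    by (intro LIMSEQ_le_const) auto
  then show ?thesis by simp
qed

lemma L2_sq_dyadic_maximal_le:
  assumes multiplier: "multiplier_square_bound C" and C: "0 \<le> C"
    and f[measurable]: "f \<in> borel_measurable borel"
  shows "L2_sq (dyadic_maximal M f) \<le> maximal_constant C * L2_sq (\<lambda>x. ennreal \<bar>f x\<bar>)"
proof -
  have "L2_sq (dyadic_maximal M f) \<le> L2_sq (\<lambda>x. SUP n. truncated_max n (truncation n f) x)"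
    by (intro L2_sq_mono dyadic_maximal_le_truncated_max f)
  also have "\<dots> \<le> (SUP n. L2_sq (truncated_max n (truncation n f)))"
    by (intro L2_sq_SUP_incseq_le incseq_truncated_max) (simp add: truncated_max_def[abs_def])
  also have "\<dots> \<le> maximal_constant C * L2_sq (\<lambda>x. ennreal \<bar>f x\<bar>)"
  proof (rule SUP_least)
    fix n
    have "L2_sq (truncated_max n (truncation n f)) \<le> maximal_constant C * L2_sq (\<lambda>x. ennreal \<bar>truncation n f x\<bar>)"
      by (rule L2_sq_truncated_max_le[OF multiplier C, where B="real n" and R="real n"])
        (auto simp: truncation_def[of n f])
    also have "\<dots> \<le> maximal_constant C * L2_sq (\<lambda>x. ennreal \<bar>f x\<bar>)"
      by (intro mult_left_mono L2_sq_mono ennreal_leI) (auto simp: truncation_def)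
    finally show "L2_sq (truncated_max n (truncation n f)) \<le> maximal_constant C * L2_sq (\<lambda>x. ennreal \<bar>f x\<bar>)" .
  qed
  finally show ?thesis .
qed

lemma cmod_defect_multiplier_near_zero: "cmod (defect_multiplier \<xi>) \<le> mass * (D + 1) * norm \<xi>"
proof -
  have "cmod (measure_ft unit_ball_measure \<xi> - 1) \<le> norm \<xi>"
    using unit_ball.measure_ft_near_zero[of \<xi>] unit_ball.prob_space[where 'a='a] by simp
  then have "mass * cmod (measure_ft unit_ball_measure \<xi> - 1) \<le> mass * norm \<xi>"
    by (rule mult_left_mono) simp
  moreover have "defect_multiplier \<xi>
      = (measure_ft M \<xi> - complex_of_real mass) - complex_of_real mass * (measure_ft unit_ball_measure \<xi> - 1)"
    by (simp add: defect_multiplier_def algebra_simps)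
  then have "cmod (defect_multiplier \<xi>)
      \<le> cmod (measure_ft M \<xi> - complex_of_real mass) + mass * cmod (measure_ft unit_ball_measure \<xi> - 1)"
    using norm_triangle_ineq4[of "measure_ft M \<xi> - complex_of_real mass"
        "complex_of_real mass * (measure_ft unit_ball_measure \<xi> - 1)"]
    by (simp add: norm_mult)
  ultimately show ?thesis
    using measure_ft_near_zero[of \<xi>] by (simp add: algebra_simps)
qed

abbreviation "decay_constant \<equiv> mass * (real DIM('a) * 2 ^ DIM('a) * pi)"

lemma cmod_defect_multiplier_square_le:
  assumes "\<xi> \<noteq> 0" and decay: "cmod (measure_ft M \<xi>) \<le> b"
  shows "(cmod (defect_multiplier \<xi>))\<^sup>2 \<le> 2 * b\<^sup>2 + 2 * decay_constant\<^sup>2 * (1 / norm \<xi>)\<^sup>2"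
proof -
  have "cmod (defect_multiplier \<xi>) \<le> cmod (measure_ft M \<xi>) + mass * cmod (measure_ft unit_ball_measure \<xi>)"
    unfolding defect_multiplier_def by (rule order_trans[OF norm_triangle_ineq4]) (simp add: norm_mult)
  also have "\<dots> \<le> b + mass * (real DIM('a) * 2 ^ DIM('a) * pi / norm \<xi>)"
    by (intro add_mono mult_left_mono decay measure_ft_unit_ball_decay assms) simp
  also have "\<dots> = b + decay_constant * (1 / norm \<xi>)" by simp
  finally have "(cmod (defect_multiplier \<xi>))\<^sup>2 \<le> (b + decay_constant * (1 / norm \<xi>))\<^sup>2"
    by (intro power_mono) auto
  also have "\<dots> \<le> 2 * b\<^sup>2 + 2 * (decay_constant * (1 / norm \<xi>))\<^sup>2"
    using sum_squares_bound[of b "decay_constant * (1 / norm \<xi>)"] unfolding power2_sum by linarith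
  finally show ?thesis by (simp only: power_mult_distrib mult.assoc)
qed

lemma defect_multiplier_low_frequency_sum_le:
  fixes F :: "int set"
  assumes F: "finite F" "\<And>k. k \<in> F \<Longrightarrow> 2 powr k * norm \<xi> \<le> 1" and "\<xi> \<noteq> 0"
  shows "(\<Sum>k\<in>F. (cmod (defect_multiplier (2 powr k *\<^sub>R \<xi>)))\<^sup>2) \<le> (mass * (D + 1))\<^sup>2 * 8"
proof -
  have "(\<Sum>k\<in>F. (cmod (defect_multiplier (2 powr k *\<^sub>R \<xi>)))\<^sup>2)
      \<le> (\<Sum>k\<in>F. (mass * (D + 1))\<^sup>2 * (norm \<xi> / 2 powr (- real_of_int k))\<^sup>2)"
  proof (intro sum_mono)
    fix k
    have "norm ((2 powr real_of_int k) *\<^sub>R \<xi>) = norm \<xi> / 2 powr (- real_of_int k)"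
      by (simp add: powr_minus field_simps)
    then have "(cmod (defect_multiplier (2 powr real_of_int k *\<^sub>R \<xi>)))\<^sup>2
        \<le> (mass * (D + 1) * (norm \<xi> / 2 powr (- real_of_int k)))\<^sup>2"
      using cmod_defect_multiplier_near_zero[of "(2 powr real_of_int k) *\<^sub>R \<xi>"] by (intro power_mono) auto
    then show "(cmod (defect_multiplier (2 powr real_of_int k *\<^sub>R \<xi>)))\<^sup>2
        \<le> (mass * (D + 1))\<^sup>2 * (norm \<xi> / 2 powr (- real_of_int k))\<^sup>2"
      by (simp only: power_mult_distrib)
  qed
  also have "\<dots> = (mass * (D + 1))\<^sup>2 * (\<Sum>k\<in>uminus ` F. (norm \<xi> / 2 powr real_of_int k)\<^sup>2)"
    by (subst sum.reindex) (simp_all add: sum_distrib_left)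
  also have "\<dots> \<le> (mass * (D + 1))\<^sup>2 * 8"
    using F \<open>\<xi> \<noteq> 0\<close>
    by (intro mult_left_mono dyadic_square_sum_le) (auto simp: powr_minus divide_inverse mult.commute)
  finally show ?thesis .
qed

lemma defect_multiplier_high_frequency_sum_le:
  fixes F :: "int set" and H :: "real \<Rightarrow> real"
  assumes F: "finite F" "\<And>k. k \<in> F \<Longrightarrow> 1 < 2 powr k * norm \<xi>" and "\<xi> \<noteq> 0"
    and H: "mono H" "\<And>t. 0 \<le> H t"
    and decay: "\<And>k::int. cmod (measure_ft M (2 powr k *\<^sub>R \<xi>)) \<le> H (pi / norm \<xi> / 2 powr k)"
    and dini: "emeasure (dini_measure (\<lambda>t. (H t)\<^sup>2)) {0<..<2 * pi} \<le> ennreal G" and G: "0 \<le> G"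
  shows "(\<Sum>k\<in>F. (cmod (defect_multiplier (2 powr k *\<^sub>R \<xi>)))\<^sup>2) \<le> 4 * G + 16 * decay_constant\<^sup>2"
proof -
  have square_mono: "mono (\<lambda>t. (H t)\<^sup>2)" using H by (auto intro!: monoI power_mono dest: monoD)
  have "(\<Sum>k\<in>F. ennreal ((H (pi / norm \<xi> / 2 powr k))\<^sup>2)) \<le> 2 * emeasure (dini_measure (\<lambda>t. (H t)\<^sup>2)) {0<..<2 * pi}"
    using F \<open>\<xi> \<noteq> 0\<close>
    by (intro dyadic_sum_le_dini[OF F(1) _ square_mono]) (auto simp: field_simps intro: less_imp_le)
  also have "\<dots> \<le> 2 * ennreal G" by (intro mult_left_mono dini) simp
  finally have "ennreal (\<Sum>k\<in>F. (H (pi / norm \<xi> / 2 powr k))\<^sup>2) \<le> ennreal (2 * G)"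
    using G by (simp add: sum_ennreal ennreal_mult)
  then have H_sum: "(\<Sum>k\<in>F. (H (pi / norm \<xi> / 2 powr k))\<^sup>2) \<le> 2 * G"
    using G by (subst (asm) ennreal_le_iff) auto
  have "(\<Sum>k\<in>F. (cmod (defect_multiplier (2 powr k *\<^sub>R \<xi>)))\<^sup>2)
      \<le> (\<Sum>k\<in>F. 2 * (H (pi / norm \<xi> / 2 powr k))\<^sup>2 + 2 * decay_constant\<^sup>2 * (1 / norm \<xi> / 2 powr k)\<^sup>2)"
  proof (intro sum_mono)
    fix k :: int
    have "1 / norm ((2 powr k) *\<^sub>R \<xi>) = 1 / norm \<xi> / 2 powr k" by simp
    then show "(cmod (defect_multiplier (2 powr k *\<^sub>R \<xi>)))\<^sup>2
        \<le> 2 * (H (pi / norm \<xi> / 2 powr k))\<^sup>2 + 2 * decay_constant\<^sup>2 * (1 / norm \<xi> / 2 powr k)\<^sup>2"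
      using cmod_defect_multiplier_square_le[OF _ decay[of k]] \<open>\<xi> \<noteq> 0\<close> by (simp add: mult.commute[of "norm \<xi>"])
  qed
  also have "\<dots> = 2 * (\<Sum>k\<in>F. (H (pi / norm \<xi> / 2 powr k))\<^sup>2)
      + 2 * decay_constant\<^sup>2 * (\<Sum>k\<in>F. (1 / norm \<xi> / 2 powr k)\<^sup>2)"
    by (simp only: sum.distrib sum_distrib_left)
  also have "\<dots> \<le> 2 * (2 * G) + 2 * decay_constant\<^sup>2 * 8"
    using F \<open>\<xi> \<noteq> 0\<close>
    by (intro add_mono mult_left_mono H_sum dyadic_square_sum_le) (auto simp: field_simps intro: less_imp_le)
  finally show ?thesis by simp
qed

text \<open>The sum over the scales of the squared multiplier of \<open>\<mu> - mass \<cdot> (uniform measure on the unit ball)\<close>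
  splits at \<open>2^k |\<xi>| = 1\<close>: below, the multiplier is small because the two measures have the same mass; above,
  the decay of both Fourier transforms is summable.\<close>

lemma defect_multiplier_sum_le:
  fixes F :: "int set" and H :: "'a \<Rightarrow> real \<Rightarrow> real"
  assumes H: "\<And>v. norm v = 1 \<Longrightarrow> mono (H v)" "\<And>v t. norm v = 1 \<Longrightarrow> 0 \<le> H v t"
    and decay: "\<And>\<xi>. \<xi> \<noteq> 0 \<Longrightarrow> cmod (measure_ft M \<xi>) \<le> H (\<xi> /\<^sub>R norm \<xi>) (pi / norm \<xi>)"
    and dini: "\<And>v. norm v = 1 \<Longrightarrow> emeasure (dini_measure (\<lambda>t. (H v t)\<^sup>2)) {0<..<2 * pi} \<le> ennreal G"
    and G: "0 \<le> G" and F: "finite F"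
  shows "(\<Sum>k\<in>F. (cmod (defect_multiplier (2 powr k *\<^sub>R \<xi>)))\<^sup>2)
      \<le> (mass * (D + 1))\<^sup>2 * 8 + (4 * G + 16 * decay_constant\<^sup>2)"
proof (cases "\<xi> = 0")
  case True
  have "defect_multiplier 0 = 0" using cmod_defect_multiplier_near_zero[of 0] by simp
  then show ?thesis using True G by simp
next
  case False
  define v where "v = \<xi> /\<^sub>R norm \<xi>"
  have v: "norm v = 1" using False by (simp add: v_def)
  let ?low = "{k \<in> F. 2 powr k * norm \<xi> \<le> 1}" and ?high = "{k \<in> F. 1 < 2 powr k * norm \<xi>}"
  have "cmod (measure_ft M (2 powr k *\<^sub>R \<xi>)) \<le> H v (pi / norm \<xi> / 2 powr k)" for k :: int
  proof -
    have "(2 powr real_of_int k *\<^sub>R \<xi>) /\<^sub>R norm (2 powr real_of_int k *\<^sub>R \<xi>) = v" by (simp add: v_def)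
    moreover have "pi / norm (2 powr real_of_int k *\<^sub>R \<xi>) = pi / norm \<xi> / 2 powr real_of_int k" by simp
    ultimately show ?thesis using decay[of "2 powr real_of_int k *\<^sub>R \<xi>"] False by (simp only: scaleR_eq_0_iff) simp
  qed
  then have high: "(\<Sum>k\<in>?high. (cmod (defect_multiplier (2 powr k *\<^sub>R \<xi>)))\<^sup>2) \<le> 4 * G + 16 * decay_constant\<^sup>2"
    using F False v by (intro defect_multiplier_high_frequency_sum_le[of _ _ "H v"] H dini G) auto
  have low: "(\<Sum>k\<in>?low. (cmod (defect_multiplier (2 powr k *\<^sub>R \<xi>)))\<^sup>2) \<le> (mass * (D + 1))\<^sup>2 * 8"
    using F False by (intro defect_multiplier_low_frequency_sum_le) auto
  have "F = ?low \<union> ?high" by auto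
  then have "(\<Sum>k\<in>F. (cmod (defect_multiplier (2 powr k *\<^sub>R \<xi>)))\<^sup>2)
      = (\<Sum>k\<in>?low. (cmod (defect_multiplier (2 powr k *\<^sub>R \<xi>)))\<^sup>2)
        + (\<Sum>k\<in>?high. (cmod (defect_multiplier (2 powr k *\<^sub>R \<xi>)))\<^sup>2)"
    using F by (subst sum.union_disjoint[symmetric]) auto
  then show ?thesis using add_mono[OF low high] by simp
qed

lemma dyadic_maximal_L2_bounded:
  fixes H :: "'a \<Rightarrow> real \<Rightarrow> real"
  assumes "\<And>v. norm v = 1 \<Longrightarrow> mono (H v)" "\<And>v t. norm v = 1 \<Longrightarrow> 0 \<le> H v t"
    and "\<And>\<xi>. \<xi> \<noteq> 0 \<Longrightarrow> cmod (measure_ft M \<xi>) \<le> H (\<xi> /\<^sub>R norm \<xi>) (pi / norm \<xi>)"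
    and "\<And>v. norm v = 1 \<Longrightarrow> emeasure (dini_measure (\<lambda>t. (H v t)\<^sup>2)) {0<..<2 * pi} \<le> ennreal G"
    and "0 \<le> G"
  shows "\<exists>C. \<forall>f\<in>borel_measurable borel.
      L2_sq (dyadic_maximal M f) \<le> ennreal C * L2_sq (\<lambda>x. ennreal \<bar>f x\<bar>)"
proof -
  define C where "C = (mass * (D + 1))\<^sup>2 * 8 + (4 * G + 16 * decay_constant\<^sup>2)"
  have "maximal_constant C < top"
    by (auto simp: maximal_constant_def ennreal_mult_less_top power_less_top_ennreal)
  moreover have "multiplier_square_bound C"
    unfolding multiplier_square_bound_def C_def
    by (intro allI impI defect_multiplier_sum_le[where H=H] assms)
  moreover have "0 \<le> C" using \<open>0 \<le> G\<close> by (simp add: C_def)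
  ultimately show ?thesis
    using L2_sq_dyadic_maximal_le by (intro exI[of _ "enn2real (maximal_constant C)"] ballI) simp
qed

end

section \<open>Oscillatory integrals of decreasing measures\<close>

lemma cmod_le_of_Re_rotations:
  assumes "\<And>w. cmod w \<le> 1 \<Longrightarrow> Re (w * z) \<le> b"
  shows "cmod z \<le> b"
proof -
  have "cnj (sgn z) * z = complex_of_real (cmod z)"
    using complex_norm_square[of z]
    by (cases "z = 0") (simp_all add: sgn_eq mult.commute power2_eq_square field_simps)
  then show ?thesis
    using assms[of "cnj (sgn z)"] by (simp add: norm_sgn)
qed

lemma integral_diff_le_of_measure_le:
  fixes f :: "'a \<Rightarrow> real"
  assumes "finite_measure M" "finite_measure N" and sets: "sets M = sets N" and "M \<le> N"
    and [measurable]: "f \<in> borel_measurable N" and f: "\<And>x. \<bar>f x\<bar> \<le> 1"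
  shows "(\<integral>x. f x \<partial>N) - (\<integral>x. f x \<partial>M) \<le> measure N (space N) - measure M (space M)"
proof -
  interpret M: finite_measure M by fact
  interpret N: finite_measure N by fact
  note [measurable_cong] = sets
  have [measurable]: "f \<in> borel_measurable M" by (simp cong: measurable_cong_sets add: sets)
  have f_le: "f x \<le> 1" for x using f[of x] by linarith
  have integrable: "integrable N f" "integrable M f"
    using f by (intro N.integrable_const_bound[of _ 1] M.integrable_const_bound[of _ 1]; simp)+
  have "ennreal (\<integral>x. 1 - f x \<partial>M) = (\<integral>\<^sup>+x. ennreal (1 - f x) \<partial>M)"
    using integrable f_le by (intro nn_integral_eq_integral[symmetric]) auto
  also have "\<dots> \<le> (\<integral>\<^sup>+x. ennreal (1 - f x) \<partial>N)"
    by (rule nn_integral_mono_measure[OF sets \<open>M \<le> N\<close>])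
  also have "\<dots> = ennreal (\<integral>x. 1 - f x \<partial>N)"
    using integrable f_le by (intro nn_integral_eq_integral) auto
  finally have "(\<integral>x. 1 - f x \<partial>M) \<le> (\<integral>x. 1 - f x \<partial>N)"
    using f_le by (subst (asm) ennreal_le_iff) auto
  then show ?thesis using integrable by simp
qed

lemma cmod_integral_diff_le_of_measure_le:
  fixes f :: "'a \<Rightarrow> complex"
  assumes "finite_measure M" "finite_measure N" and sets: "sets M = sets N" and "M \<le> N"
    and [measurable]: "f \<in> borel_measurable N" and f: "\<And>x. cmod (f x) \<le> 1"
  shows "cmod ((\<integral>x. f x \<partial>N) - (\<integral>x. f x \<partial>M)) \<le> measure N (space N) - measure M (space M)"
proof (rule cmod_le_of_Re_rotations)
  fix w :: complex assume w: "cmod w \<le> 1"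
  interpret M: finite_measure M by fact
  interpret N: finite_measure N by fact
  note [measurable_cong] = sets
  have [measurable]: "f \<in> borel_measurable M" by (simp cong: measurable_cong_sets add: sets)
  have integrable: "integrable N (\<lambda>x. w * f x)" "integrable M (\<lambda>x. w * f x)"
    using f by (intro integrable_mult_right N.integrable_const_bound[of _ 1]
        M.integrable_const_bound[of _ 1]; simp)+
  have "\<bar>Re (w * f x)\<bar> \<le> 1" for x
  proof -
    have "cmod (w * f x) \<le> 1 * 1" unfolding norm_mult by (intro mult_mono w f) auto
    then show ?thesis using abs_Re_le_cmod order_trans by fastforce
  qed
  then have "(\<integral>x. Re (w * f x) \<partial>N) - (\<integral>x. Re (w * f x) \<partial>M) \<le> measure N (space N) - measure M (space M)"
    using assms by (intro integral_diff_le_of_measure_le) auto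
  then show "Re (w * ((\<integral>x. f x \<partial>N) - (\<integral>x. f x \<partial>M))) \<le> measure N (space N) - measure M (space M)"
    by (simp only: integral_Re[OF integrable(1)] integral_Re[OF integrable(2)] integral_mult_right_zero
        right_diff_distrib minus_complex.sel)
qed

lemma density_above_le_distr_shift:
  fixes \<mu> :: "real measure"
  assumes sets[measurable_cong]: "sets \<mu> = sets borel"
    and decreasing: "\<And>E. E \<in> sets borel \<Longrightarrow> E \<subseteq> {c<..} \<Longrightarrow> emeasure \<mu> E \<le> emeasure \<mu> ((\<lambda>t. t + s) -` E)"
  shows "density \<mu> (indicator {c<..}) \<le> distr \<mu> borel (\<lambda>t. t + s)"
proof (subst le_measure)
  show "sets (density \<mu> (indicator {c<..})) = sets (distr \<mu> borel (\<lambda>t. t + s))" by (simp add: sets)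
  show "\<forall>E\<in>sets (density \<mu> (indicator {c<..})).
      emeasure (density \<mu> (indicator {c<..})) E \<le> emeasure (distr \<mu> borel (\<lambda>t. t + s)) E"
  proof
    fix E assume "E \<in> sets (density \<mu> (indicator {c<..}))"
    then have [measurable]: "E \<in> sets borel" by (simp add: sets)
    have [measurable]: "(\<lambda>t. t + s) -` E \<in> sets borel"
      using measurable_sets[of "\<lambda>t. t + s" borel borel E] by simp
    have "emeasure \<mu> ({c<..} \<inter> E) \<le> emeasure \<mu> ((\<lambda>t. t + s) -` ({c<..} \<inter> E))"
      by (rule decreasing) auto
    also have "\<dots> \<le> emeasure \<mu> ((\<lambda>t. t + s) -` E)" by (rule emeasure_mono) auto
    finally show "emeasure (density \<mu> (indicator {c<..})) E \<le> emeasure (distr \<mu> borel (\<lambda>t. t + s)) E"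
      using sets_eq_imp_space_eq[OF sets]
      by (simp add: emeasure_density emeasure_distr indicator_inter_arith[symmetric])
  qed
qed

lemma antiperiodic_integral_add_le:
  fixes \<mu> :: "real measure" and e :: "real \<Rightarrow> complex"
  assumes "finite_measure \<mu>" and sets[measurable_cong]: "sets \<mu> = sets borel"
    and [measurable]: "e \<in> borel_measurable borel" and e: "\<And>t. cmod (e t) \<le> 1" "\<And>t. e (t + s) = - e t"
    and decreasing: "\<And>E. E \<in> sets borel \<Longrightarrow> E \<subseteq> {c<..} \<Longrightarrow> emeasure \<mu> E \<le> emeasure \<mu> ((\<lambda>t. t + s) -` E)"
  shows "cmod ((\<integral>t. e t \<partial>\<mu>) + (LINT t:{c<..}|\<mu>. e t)) \<le> measure \<mu> {..c}"
proof -
  interpret finite_measure \<mu> by fact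
  have space: "space \<mu> = UNIV" using sets_eq_imp_space_eq[OF sets] by simp
  define above where "above = density \<mu> (indicator {c<..})"
  define shifted where "shifted = distr \<mu> borel (\<lambda>t. t + s)"
  have "above \<le> shifted"
    unfolding above_def shifted_def using sets decreasing by (rule density_above_le_distr_shift)
  moreover have "finite_measure above" "finite_measure shifted"
    unfolding above_def shifted_def
    by (auto intro!: finite_measureI finite_measure_distr simp: emeasure_density space)
  ultimately have "cmod ((\<integral>t. e t \<partial>shifted) - (\<integral>t. e t \<partial>above)) \<le> measure shifted UNIV - measure above UNIV"
    using cmod_integral_diff_le_of_measure_le[of above shifted e]
    by (auto simp: above_def shifted_def sets space e)
  also have "measure shifted UNIV - measure above UNIV = measure \<mu> UNIV - measure \<mu> {c<..}"
    by (simp add: measure_def above_def shifted_def emeasure_density emeasure_distr space)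
  also have "\<dots> = measure \<mu> {..c}"
    using finite_measure_compl[of "{c<..}"] by (simp add: space Compl_eq_Diff_UNIV[symmetric])
  also have "(\<integral>t. e t \<partial>shifted) = - (\<integral>t. e t \<partial>\<mu>)"
    unfolding shifted_def by (simp add: integral_distr e(2))
  also have "(\<integral>t. e t \<partial>above) = (LINT t:{c<..}|\<mu>. e t)"
    unfolding above_def set_lebesgue_integral_def
    by (subst integral_density[where g="indicator {c<..}", symmetric]) (auto simp: ennreal_indicator[abs_def])
  finally show ?thesis
    by (metis minus_add_distrib norm_minus_cancel add_uminus_conv_diff)
qed

text \<open>The oscillating factor changes sign under the shift by half a period \<open>s\<close>. If \<open>\<mu>\<close> decreases under this
  shift above \<open>c\<close>, averaging the integral with the shifted one leaves only the mass below \<open>c\<close>.\<close>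

lemma oscillatory_integral_le:
  fixes \<mu> :: "real measure"
  assumes "finite_measure \<mu>" and sets[measurable_cong]: "sets \<mu> = sets borel" and half_period: "\<bar>r\<bar> * s = pi"
    and "\<And>E. E \<in> sets borel \<Longrightarrow> E \<subseteq> {c<..} \<Longrightarrow> emeasure \<mu> E \<le> emeasure \<mu> ((\<lambda>t. t + s) -` E)"
  shows "cmod (\<integral>t. cis (r * t) \<partial>\<mu>) \<le> measure \<mu> {..c}"
proof -
  interpret finite_measure \<mu> by fact
  define e where "e t = cis (r * t)" for t
  have [measurable]: "e \<in> borel_measurable borel" unfolding e_def[abs_def] by measurable
  have "r * s = pi \<or> r * s = - pi" using half_period by (auto simp: abs_if split: if_splits)
  then have "cis (r * s) = -1" by (auto simp: cis.code complex_eq_iff)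
  then have "e (t + s) = - e t" for t by (simp add: e_def distrib_left flip: cis_mult)
  then have oscillation: "cmod ((\<integral>t. e t \<partial>\<mu>) + (LINT t:{c<..}|\<mu>. e t)) \<le> measure \<mu> {..c}"
    using assms by (intro antiperiodic_integral_add_le) (auto simp: e_def)
  have e_int: "set_integrable \<mu> A e" if "A \<in> sets borel" for A
    unfolding set_integrable_def using that
    by (intro integrable_const_bound[of _ 1]) (auto simp: e_def indicator_def)
  have "{c<..} \<inter> {..c} = {}" "UNIV = {c<..} \<union> {..c}" by auto
  then have "(\<integral>t. e t \<partial>\<mu>) = (LINT t:{c<..}|\<mu>. e t) + (LINT t:{..c}|\<mu>. e t)"
    using set_integral_Un[of "{c<..}" "{..c}" \<mu> e] e_int by (simp add: set_lebesgue_integral_def)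
  then have "2 * (\<integral>t. e t \<partial>\<mu>) = ((\<integral>t. e t \<partial>\<mu>) + (LINT t:{c<..}|\<mu>. e t)) + (LINT t:{..c}|\<mu>. e t)"
    by simp
  then have "2 * cmod (\<integral>t. e t \<partial>\<mu>) \<le> measure \<mu> {..c} + cmod (LINT t:{..c}|\<mu>. e t)"
    using oscillation norm_triangle_le[of _ "LINT t:{..c}|\<mu>. e t"]
    by (metis add_right_mono norm_mult norm_numeral)
  also have "cmod (LINT t:{..c}|\<mu>. e t) \<le> measure \<mu> {..c}"
    using set_integral_norm_bound[OF e_int, of "{..c}"] sets_eq_imp_space_eq[OF sets]
    by (simp add: e_def set_lebesgue_integral_def)
  finally show ?thesis by (simp add: e_def)
qed

section \<open>Boundaries of planar convex domains\<close>

definition perp :: "real^2 \<Rightarrow> real^2" where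
  "perp v = vector [- (v $ 2), v $ 1]"

definition orthonormal_pair :: "real^2 \<Rightarrow> real^2 \<Rightarrow> bool" where
  "orthonormal_pair u v \<longleftrightarrow> norm u = 1 \<and> norm v = 1 \<and> u \<bullet> v = 0 \<and> (\<forall>x. x = (x \<bullet> u) *\<^sub>R u + (x \<bullet> v) *\<^sub>R v)"

lemma orthonormal_pair_perp:
  assumes "norm v = 1"
  shows "orthonormal_pair (perp v) v"
proof -
  have v: "v $ 1 * v $ 1 + v $ 2 * v $ 2 = 1"
    using assms by (simp add: norm_eq_1 inner_vec_def sum_2)
  have "x = (x \<bullet> perp v) *\<^sub>R perp v + (x \<bullet> v) *\<^sub>R v" for x
  proof -
    have "x $ 1 = x $ 1 * (v $ 1 * v $ 1 + v $ 2 * v $ 2)" "x $ 2 = x $ 2 * (v $ 1 * v $ 1 + v $ 2 * v $ 2)"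
      by (simp_all add: v)
    then show ?thesis
      by (simp add: vec_eq_iff forall_2 perp_def inner_vec_def sum_2 algebra_simps)
  qed
  then show ?thesis
    using assms v by (simp add: orthonormal_pair_def norm_eq_1 perp_def inner_vec_def sum_2 algebra_simps)
qed

lemma orthonormal_pair_uminus:
  assumes "orthonormal_pair u v"
  shows "orthonormal_pair (- u) v" "orthonormal_pair u (- v)"
  using assms by (auto simp: orthonormal_pair_def)

lemma orthonormal_pair_nonzero:
  assumes "orthonormal_pair u v"
  shows "u \<noteq> 0" "v \<noteq> 0"
  using assms by (auto simp: orthonormal_pair_def)

lemma orthonormal_pair_inner:
  assumes "orthonormal_pair u v"
  shows "u \<bullet> u = 1" "v \<bullet> v = 1" "u \<bullet> v = 0" "v \<bullet> u = 0"
  using assms by (auto simp: orthonormal_pair_def norm_eq_1 inner_commute)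

lemma orthonormal_pair_dist:
  assumes "orthonormal_pair u v"
  shows "(dist x y)\<^sup>2 = (x \<bullet> u - y \<bullet> u)\<^sup>2 + (x \<bullet> v - y \<bullet> v)\<^sup>2"
proof -
  define a b where "a = x \<bullet> u - y \<bullet> u" and "b = x \<bullet> v - y \<bullet> v"
  have "x - y = a *\<^sub>R u + b *\<^sub>R v"
    using assms unfolding orthonormal_pair_def a_def b_def by (metis inner_diff_left)
  then have "(dist x y)\<^sup>2 = (a *\<^sub>R u + b *\<^sub>R v) \<bullet> (a *\<^sub>R u + b *\<^sub>R v)"
    by (simp add: dist_norm power2_norm_eq_inner)
  also have "\<dots> = a\<^sup>2 + b\<^sup>2"
    by (simp add: inner_add_left inner_add_right orthonormal_pair_inner[OF assms] power2_eq_square)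
  finally show ?thesis by (simp add: a_def b_def)
qed

lemma orthonormal_pair_same_height:
  assumes "orthonormal_pair u v" "x \<bullet> v = y \<bullet> v"
  shows "x = y + (x \<bullet> u - y \<bullet> u) *\<^sub>R u"
proof -
  have "x - y = ((x - y) \<bullet> u) *\<^sub>R u + ((x - y) \<bullet> v) *\<^sub>R v"
    using assms(1) unfolding orthonormal_pair_def by blast
  then show ?thesis using assms(2) by (simp add: inner_diff_left algebra_simps)
qed

lemma infdist_hyperplane:
  fixes v y :: "'a::real_inner"
  assumes v: "norm v = 1"
  shows "infdist y {z. z \<bullet> v = c} = \<bar>y \<bullet> v - c\<bar>"
proof (rule antisym)
  let ?z = "y - (y \<bullet> v - c) *\<^sub>R v"
  have z: "?z \<in> {z. z \<bullet> v = c}" using v by (simp add: inner_diff_left norm_eq_1)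
  then show "infdist y {z. z \<bullet> v = c} \<le> \<bar>y \<bullet> v - c\<bar>"
    using infdist_le[OF z, of y] v by (simp add: dist_norm)
  have "\<bar>y \<bullet> v - c\<bar> \<le> dist y x" if "x \<bullet> v = c" for x
    using Cauchy_Schwarz_ineq2[of "y - x" v] v that by (simp add: dist_norm inner_diff_left)
  then show "\<bar>y \<bullet> v - c\<bar> \<le> infdist y {z. z \<bullet> v = c}"
    unfolding infdist_def using z by (auto intro!: cINF_greatest)
qed

locale convex_domain =
  fixes \<Omega> :: "(real^2) set"
  assumes convex_domain: "convex \<Omega>" and open_domain: "open \<Omega>" and bounded_domain: "bounded \<Omega>"
    and zero_in_domain: "0 \<in> \<Omega>"
begin

abbreviation "\<sigma> \<equiv> arclength \<Omega>"

lemma frontier_eq: "frontier \<Omega> = closure \<Omega> - \<Omega>"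
  using open_domain by (simp add: frontier_def interior_open)

lemma compact_closure_domain: "compact (closure \<Omega>)"
  using bounded_domain by (simp add: compact_closure)

sublocale arc: finite_measure \<sigma>
  using H1_convex_frontier_finite[OF convex_domain open_domain bounded_domain]
  by (intro finite_measureI) (simp add: emeasure_arclength)

lemma frontier_borel [measurable]: "frontier \<Omega> \<in> sets borel"
  by (simp add: borel_closed)

lemma AE_frontier: "AE p in \<sigma>. p \<in> frontier \<Omega>"
  by (rule AE_I[of _ _ "- frontier \<Omega>"]) (auto simp: emeasure_arclength H1_empty)

lemma measure_arclength_Int_frontier:
  "A \<in> sets borel \<Longrightarrow> measure \<sigma> (A \<inter> frontier \<Omega>) = measure \<sigma> A"
  by (simp add: measure_def emeasure_arclength Int_assoc)

definition support_fun :: "real^2 \<Rightarrow> real" where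
  "support_fun v = (SUP x\<in>closure \<Omega>. x \<bullet> v)"

lemma support_fun_ge: "x \<in> closure \<Omega> \<Longrightarrow> x \<bullet> v \<le> support_fun v"
  unfolding support_fun_def
  by (intro cSUP_upper bounded_imp_bdd_above compact_imp_bounded compact_continuous_image compact_closure_domain)
     (auto intro!: continuous_intros)

lemma support_fun_gt:
  assumes v: "v \<noteq> 0" and x: "x \<in> \<Omega>"
  shows "x \<bullet> v < support_fun v"
proof -
  obtain e where e: "0 < e" "ball x e \<subseteq> \<Omega>" using open_domain x by (auto simp: open_contains_ball)
  define y where "y = x + (e / (2 * norm v)) *\<^sub>R v"
  have "y \<in> ball x e" using e v by (simp add: y_def dist_norm)
  then have "y \<in> closure \<Omega>" using e(2) closure_subset[of \<Omega>] by (meson subsetD)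
  then have "y \<bullet> v \<le> support_fun v" by (rule support_fun_ge)
  moreover have "y \<bullet> v = x \<bullet> v + (e / (2 * norm v)) * (v \<bullet> v)" by (simp add: y_def inner_add_left)
  moreover have "0 < (e / (2 * norm v)) * (v \<bullet> v)" using e v by simp
  ultimately show ?thesis by linarith
qed

lemma support_fun_attained:
  assumes v: "v \<noteq> 0"
  obtains p where "p \<in> frontier \<Omega>" "p \<bullet> v = support_fun v"
proof -
  have nonempty: "closure \<Omega> \<noteq> {}" using zero_in_domain closure_subset by blast
  have "continuous_on (closure \<Omega>) (\<lambda>x. x \<bullet> v)" by (intro continuous_intros)
  from continuous_attains_sup[OF compact_closure_domain nonempty this]
  obtain p where p: "p \<in> closure \<Omega>" "\<And>x. x \<in> closure \<Omega> \<Longrightarrow> x \<bullet> v \<le> p \<bullet> v" by blast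
  have "p \<bullet> v = support_fun v"
    using p nonempty by (intro antisym support_fun_ge) (auto simp: support_fun_def intro!: cSUP_least)
  moreover from this have "p \<notin> \<Omega>" using support_fun_gt[OF v, of p] by auto
  ultimately show thesis using p that by (auto simp: frontier_eq)
qed

lemma support_fun_le:
  assumes "\<And>x. x \<in> \<Omega> \<Longrightarrow> x \<bullet> v \<le> c"
  shows "support_fun v \<le> c"
  unfolding support_fun_def
proof (rule cSUP_least)
  show "closure \<Omega> \<noteq> {}" using zero_in_domain closure_subset by blast
  have "closure \<Omega> \<subseteq> {x. v \<bullet> x \<le> c}"
    using assms by (intro closure_minimal closed_halfspace_le) (auto simp: inner_commute)
  then show "x \<bullet> v \<le> c" if "x \<in> closure \<Omega>" for x using that by (auto simp: inner_commute)
qed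

lemma ell_plus_eq:
  assumes v: "norm v = 1"
  shows "ell_plus \<Omega> v = {y. y \<bullet> v = support_fun v}"
  unfolding ell_plus_def
proof (rule the_equality)
  have nonzero: "v \<noteq> 0" and unit: "v \<bullet> v = 1" using v by (auto simp: norm_eq_1)
  obtain p where p: "p \<in> frontier \<Omega>" "p \<bullet> v = support_fun v" by (rule support_fun_attained[OF nonzero])
  have "x \<in> {y - t *\<^sub>R v |y t. 0 < t \<and> y \<in> {y. y \<bullet> v = support_fun v}}" if "x \<in> \<Omega>" for x
    using support_fun_gt[OF nonzero that] unit
    by (intro CollectI exI[of _ "x + (support_fun v - x \<bullet> v) *\<^sub>R v"] exI[of _ "support_fun v - x \<bullet> v"])
       (auto simp: inner_add_left)
  then show "(\<exists>c. {y. y \<bullet> v = support_fun v} = {y. y \<bullet> v = c}) \<and> {y. y \<bullet> v = support_fun v} \<inter> frontier \<Omega> \<noteq> {} \<and>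
     \<Omega> \<subseteq> {y - t *\<^sub>R v |y t. 0 < t \<and> y \<in> {y. y \<bullet> v = support_fun v}}"
    using p by blast
  fix L assume L: "(\<exists>c. L = {y. y \<bullet> v = c}) \<and> L \<inter> frontier \<Omega> \<noteq> {} \<and> \<Omega> \<subseteq> {y - t *\<^sub>R v |y t. 0 < t \<and> y \<in> L}"
  then obtain c q where L_eq: "L = {y. y \<bullet> v = c}" and q: "q \<in> frontier \<Omega>" "q \<bullet> v = c" by blast
  have "x \<bullet> v \<le> c" if "x \<in> \<Omega>" for x
  proof -
    from L that have "x \<in> {y - t *\<^sub>R v |y t. 0 < t \<and> y \<in> L}" by blast
    then obtain y t where "x = y - t *\<^sub>R v" "0 < t" "y \<bullet> v = c" using L_eq by blast
    then show ?thesis using unit by (simp add: inner_diff_left)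
  qed
  then have "support_fun v \<le> c" by (rule support_fun_le)
  moreover have "c \<le> support_fun v" using support_fun_ge[of q v] q by (auto simp: frontier_eq)
  ultimately show "L = {y. y \<bullet> v = support_fun v}" using L_eq by simp
qed

lemma ell_minus_eq: "ell_minus \<Omega> v = ell_plus \<Omega> (- v)"
proof -
  have "(\<exists>c. L = {y. y \<bullet> v = c}) \<longleftrightarrow> (\<exists>c. L = {y. y \<bullet> - v = c})" for L :: "(real^2) set"
  proof -
    have "{y. y \<bullet> - v = c} = {y. y \<bullet> v = - c}" for c by auto
    then show ?thesis by (metis minus_minus)
  qed
  then show ?thesis unfolding ell_minus_def ell_plus_def by simp
qed

definition cap :: "real^2 \<Rightarrow> real \<Rightarrow> (real^2) set" where
  "cap v d = {y \<in> frontier \<Omega>. support_fun v - d \<le> y \<bullet> v}"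

definition cap_mass :: "real^2 \<Rightarrow> real \<Rightarrow> real" where
  "cap_mass v d = measure \<sigma> (cap v d)"

lemma cap_plus_eq:
  assumes v: "norm v = 1"
  shows "cap_plus \<Omega> v d = cap v d"
proof -
  have "\<bar>y \<bullet> v - support_fun v\<bar> = support_fun v - y \<bullet> v" if "y \<in> frontier \<Omega>" for y
    using support_fun_ge[of y v] that by (simp add: frontier_eq)
  then show ?thesis
    unfolding cap_plus_def cap_def ell_plus_eq[OF v] infdist_hyperplane[OF v] by auto
qed

lemma cap_minus_eq: "cap_minus \<Omega> v d = cap_plus \<Omega> (- v) d"
  unfolding cap_plus_def cap_minus_def ell_minus_eq ..

lemma cap_borel [measurable]: "cap v d \<in> sets borel"
  unfolding cap_def by measurable

lemma cap_mass_mono: "d \<le> e \<Longrightarrow> cap_mass v d \<le> cap_mass v e"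
  unfolding cap_mass_def by (intro arc.finite_measure_mono) (auto simp: cap_def)

lemma cap_mass_nonneg: "0 \<le> cap_mass v d"
  by (simp add: cap_mass_def)

lemma Lambda_eq: "norm v = 1 \<Longrightarrow> Lambda \<Omega> v d = max (cap_mass v d) (cap_mass (- v) d)"
  by (simp add: Lambda_def cap_minus_eq cap_plus_eq cap_mass_def)

lemma Lambda_nonneg: "norm v = 1 \<Longrightarrow> 0 \<le> Lambda \<Omega> v d"
  by (simp add: Lambda_eq le_max_iff_disj cap_mass_nonneg)

lemma Lambda_le: "norm v = 1 \<Longrightarrow> Lambda \<Omega> v d \<le> measure \<sigma> UNIV"
  by (auto simp: Lambda_eq cap_mass_def intro: arc.finite_measure_mono)

lemma mono_Lambda: "norm v = 1 \<Longrightarrow> mono (Lambda \<Omega> v)"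
  by (intro monoI) (simp only: Lambda_eq norm_minus_cancel max.mono cap_mass_mono)

lemma mono_Lambda_square: "norm v = 1 \<Longrightarrow> mono (\<lambda>d. (Lambda \<Omega> v d)\<^sup>2)"
  using mono_Lambda by (auto intro!: monoI power_mono Lambda_nonneg dest: monoD)

definition cap_energy :: "real^2 \<Rightarrow> real \<Rightarrow> ennreal" where
  "cap_energy v T = emeasure (dini_measure (\<lambda>d. (Lambda \<Omega> v d)\<^sup>2)) {0<..<T}"

lemma cap_energy_extend:
  assumes "norm v = 1" "0 < e" "0 \<le> T"
  shows "cap_energy v T \<le> cap_energy v e + ennreal ((measure \<sigma> UNIV)\<^sup>2 * T / e)"
  unfolding cap_energy_def using assms
  by (intro dini_extend mono_Lambda_square) (auto intro!: power_mono Lambda_le Lambda_nonneg)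

definition heights :: "real^2 \<Rightarrow> real set" where
  "heights v = {- support_fun (- v)<..<support_fun v}"

lemma height_in_heights:
  assumes "v \<noteq> 0" "x \<in> \<Omega>"
  shows "x \<bullet> v \<in> heights v"
  using support_fun_gt[OF assms] support_fun_gt[of "- v" x] assms by (auto simp: heights_def)

lemma heights_attained:
  assumes v: "v \<noteq> 0" and t: "t \<in> heights v"
  obtains q where "q \<in> \<Omega>" "q \<bullet> v = t"
proof -
  obtain x where x: "x \<in> \<Omega>" "t < x \<bullet> v"
    using support_fun_le[of v t] t by (force simp: heights_def)
  obtain y where y: "y \<in> \<Omega>" "- t < y \<bullet> (- v)"
    using support_fun_le[of "- v" "- t"] t by (force simp: heights_def)
  have "\<exists>z\<in>\<Omega>. v \<bullet> z = t"
    using x y by (intro connected_ivt_hyperplane[OF convex_connected[OF convex_domain] y(1) x(1)])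
      (auto simp: inner_commute)
  then show thesis using that by (auto simp: inner_commute)
qed

definition side :: "real^2 \<Rightarrow> (real^2) set" where
  "side u = {p \<in> frontier \<Omega>. \<exists>t>0. p - t *\<^sub>R u \<in> \<Omega>}"

lemma side_borel [measurable]: "side u \<in> sets borel"
proof -
  have "side u = frontier \<Omega> \<inter> (\<Union>t\<in>{0<..}. (\<lambda>p. p - t *\<^sub>R u) -` \<Omega>)" by (auto simp: side_def)
  moreover have "open (\<Union>t\<in>{0<..}. (\<lambda>p. p - t *\<^sub>R u) -` \<Omega>)"
    by (intro open_UN ballI open_vimage open_domain continuous_intros)
  ultimately show ?thesis by (simp add: borel_open sets.Int)
qed

lemma side_subset_frontier: "side u \<subseteq> frontier \<Omega>"
  by (auto simp: side_def)

lemma side_in_closure: "p \<in> side u \<Longrightarrow> p \<in> closure \<Omega>"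
  by (auto simp: side_def frontier_eq)

lemma side_maximal:
  assumes uv: "orthonormal_pair u v" and p: "p \<in> side u" and k: "k \<in> closure \<Omega>" "k \<bullet> v = p \<bullet> v"
  shows "k \<bullet> u \<le> p \<bullet> u"
proof (rule ccontr)
  assume "\<not> ?thesis"
  then obtain s where s: "0 < s" "k = p + s *\<^sub>R u"
    using orthonormal_pair_same_height[OF uv k(2)] by (metis diff_gt_0_iff_gt not_le)
  obtain t where t: "0 < t" "p - t *\<^sub>R u \<in> \<Omega>" "p \<notin> \<Omega>" using p by (auto simp: side_def frontier_eq)
  have "p = (1 - t / (s + t)) *\<^sub>R (p - t *\<^sub>R u) + (t / (s + t)) *\<^sub>R k"
  proof -
    have "(1 - t / (s + t)) *\<^sub>R (p - t *\<^sub>R u) + (t / (s + t)) *\<^sub>R k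
       = p + ((t / (s + t)) * s - (1 - t / (s + t)) * t) *\<^sub>R u"
      unfolding s(2) by (simp add: algebra_simps)
    also have "(t / (s + t)) * s - (1 - t / (s + t)) * t = 0" using s t by (simp add: field_simps)
    finally show ?thesis by simp
  qed
  moreover have "p - t *\<^sub>R u \<noteq> k"
  proof
    assume "p - t *\<^sub>R u = k"
    then have "(s + t) *\<^sub>R u = 0" unfolding s(2) by (simp add: algebra_simps)
    then show False using s t orthonormal_pair_nonzero[OF uv] by simp
  qed
  ultimately have "p \<in> open_segment (p - t *\<^sub>R u) k"
    unfolding in_segment using s t by (intro conjI exI[of _ "t / (s + t)"]) auto
  then have "p \<in> interior \<Omega>"
    using in_interior_closure_convex_segment[OF convex_domain, of "p - t *\<^sub>R u" k] t k open_domain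
    by (auto simp: interior_open)
  then show False using t open_domain by (simp add: interior_open)
qed

lemma side_disjoint:
  assumes uv: "orthonormal_pair u v"
  shows "side u \<inter> side (- u) = {}"
proof -
  have False if p: "p \<in> side u" and p': "p \<in> side (- u)" for p
  proof -
    obtain t where t: "0 < t" "p + t *\<^sub>R u \<in> \<Omega>" using p' by (auto simp: side_def)
    then have "(p + t *\<^sub>R u) \<bullet> u \<le> p \<bullet> u"
      using closure_subset[of \<Omega>] orthonormal_pair_inner[OF uv]
      by (intro side_maximal[OF uv p]) (auto simp: inner_add_left)
    then show False using t orthonormal_pair_inner[OF uv] by (simp add: inner_add_left)
  qed
  then show ?thesis by blast
qed

lemma side_height:
  assumes uv: "orthonormal_pair u v" and p: "p \<in> side u"
  shows "p \<bullet> v \<in> heights v"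
proof -
  obtain t where t: "0 < t" "p - t *\<^sub>R u \<in> \<Omega>" using p by (auto simp: side_def)
  have "(p - t *\<^sub>R u) \<bullet> v = p \<bullet> v" by (simp add: orthonormal_pair_inner[OF uv] inner_diff_left)
  then show ?thesis using height_in_heights[OF orthonormal_pair_nonzero(2)[OF uv] t(2)] by simp
qed

lemma side_exists:
  assumes uv: "orthonormal_pair u v" and t: "t \<in> heights v"
  obtains p where "p \<in> side u" "p \<bullet> v = t"
proof -
  obtain q where q: "q \<in> \<Omega>" "q \<bullet> v = t"
    by (rule heights_attained[OF orthonormal_pair_nonzero(2)[OF uv] t])
  obtain d where d: "0 < d" "q + d *\<^sub>R u \<in> frontier \<Omega>"
    using ray_to_frontier[OF bounded_domain, of q u] q open_domain orthonormal_pair_nonzero[OF uv]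
    by (auto simp: interior_open)
  then have "q + d *\<^sub>R u \<in> side u" using q by (auto simp: side_def intro!: exI[of _ d])
  moreover have "(q + d *\<^sub>R u) \<bullet> v = t" using q by (simp add: orthonormal_pair_inner[OF uv] inner_add_left)
  ultimately show thesis by (rule that)
qed

lemma frontier_cases:
  assumes uv: "orthonormal_pair u v" and p: "p \<in> frontier \<Omega>"
  shows "p \<in> side u \<or> p \<in> side (- u) \<or> p \<bullet> v = support_fun v \<or> p \<bullet> (- v) = support_fun (- v)"
proof (rule ccontr)
  assume contra: "\<not> ?thesis"
  have "p \<bullet> v \<le> support_fun v" "p \<bullet> (- v) \<le> support_fun (- v)"
    using p by (auto simp: frontier_eq simp del: inner_minus_right intro!: support_fun_ge)
  then have "p \<bullet> v \<in> heights v" using contra by (auto simp: heights_def)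
  then obtain q where q: "q \<in> \<Omega>" "q \<bullet> v = p \<bullet> v"
    using heights_attained orthonormal_pair_nonzero[OF uv] by metis
  define s where "s = p \<bullet> u - q \<bullet> u"
  have q_eq: "q = p - s *\<^sub>R u"
    using orthonormal_pair_same_height[OF uv q(2)] by (simp add: s_def algebra_simps)
  have "s \<noteq> 0" using q_eq q p by (auto simp: frontier_eq)
  then consider "0 < s" | "0 < - s" by linarith
  then have "p \<in> side u \<or> p \<in> side (- u)"
  proof cases
    assume "0 < s"
    then show ?thesis using q_eq q p by (auto simp: side_def)
  next
    assume "0 < - s"
    then show ?thesis using q_eq q p by (auto simp: side_def intro!: exI[of _ "- s"])
  qed
  then show False using contra by blast
qed

lemma chord_at_height:
  assumes "p \<in> closure \<Omega>" "q \<in> closure \<Omega>" "p \<bullet> v \<le> t" "t \<le> q \<bullet> v"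
  obtains k l where "k \<in> closure \<Omega>" "k \<bullet> v = t" "0 \<le> l" "l \<le> 1" "t = (1 - l) * (p \<bullet> v) + l * (q \<bullet> v)"
    "\<And>u. k \<bullet> u = (1 - l) * (p \<bullet> u) + l * (q \<bullet> u)"
proof -
  obtain l where l: "0 \<le> l" "l \<le> 1" "t = (1 - l) * (p \<bullet> v) + l * (q \<bullet> v)"
  proof (cases "p \<bullet> v = q \<bullet> v")
    case True
    then show thesis using assms by (intro that[of 0]) auto
  next
    case False
    then have pos: "0 < q \<bullet> v - p \<bullet> v" using assms by simp
    define l where "l = (t - p \<bullet> v) / (q \<bullet> v - p \<bullet> v)"
    have "l * (q \<bullet> v - p \<bullet> v) = t - p \<bullet> v" using pos by (simp add: l_def)
    then have "t = (1 - l) * (p \<bullet> v) + l * (q \<bullet> v)" by (simp add: algebra_simps)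
    then show thesis using assms pos by (intro that[of l]) (auto simp: l_def)
  qed
  have "(1 - l) *\<^sub>R p + l *\<^sub>R q \<in> closure \<Omega>"
    using l assms by (intro convexD[OF convex_closure[OF convex_domain]]) auto
  then show thesis using l by (intro that[of "(1 - l) *\<^sub>R p + l *\<^sub>R q" l]) (auto simp: inner_add_left)
qed

lemma side_increasing_below_maximum:
  assumes uv: "orthonormal_pair u v" and m: "m \<in> closure \<Omega>" "m \<bullet> u = support_fun u"
    and side: "x \<in> side u" "y \<in> side u" and heights: "x \<bullet> v \<le> y \<bullet> v" "y \<bullet> v \<le> m \<bullet> v"
  shows "x \<bullet> u \<le> y \<bullet> u"
proof -
  obtain k l where k: "k \<in> closure \<Omega>" "k \<bullet> v = y \<bullet> v" "0 \<le> l" "l \<le> 1"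
      "\<And>u. k \<bullet> u = (1 - l) * (x \<bullet> u) + l * (m \<bullet> u)"
    using chord_at_height[OF side_in_closure[OF side(1)] m(1) heights] by metis
  have "x \<bullet> u = (1 - l) * (x \<bullet> u) + l * (x \<bullet> u)" by (simp add: algebra_simps)
  also have "\<dots> \<le> k \<bullet> u"
    unfolding k(5) m(2) using k support_fun_ge[OF side_in_closure[OF side(1)]]
    by (intro add_left_mono mult_left_mono) auto
  also have "\<dots> \<le> y \<bullet> u" by (rule side_maximal[OF uv side(2) k(1,2)])
  finally show ?thesis .
qed

lemma side_concave:
  assumes uv: "orthonormal_pair u v" and side: "x \<in> side u" "x' \<in> side u" "y \<in> side u" "y' \<in> side u"
    and le: "x \<bullet> v \<le> x' \<bullet> v" and shift: "y \<bullet> v = x \<bullet> v + s" "y' \<bullet> v = x' \<bullet> v + s" and "0 < s"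
  shows "y' \<bullet> u - y \<bullet> u \<le> x' \<bullet> u - x \<bullet> u"
proof -
  note in_closure = side_in_closure[OF side(1)] side_in_closure[OF side(4)]
  have between: "x \<bullet> v \<le> x' \<bullet> v" "x' \<bullet> v \<le> y' \<bullet> v" "x \<bullet> v \<le> y \<bullet> v" "y \<bullet> v \<le> y' \<bullet> v"
    using le shift \<open>0 < s\<close> by auto
  obtain k l where k: "k \<in> closure \<Omega>" "k \<bullet> v = x' \<bullet> v" "x' \<bullet> v = (1 - l) * (x \<bullet> v) + l * (y' \<bullet> v)"
      "\<And>u. k \<bullet> u = (1 - l) * (x \<bullet> u) + l * (y' \<bullet> u)"
    using chord_at_height[OF in_closure between(1,2)] by metis
  obtain k' l' where k': "k' \<in> closure \<Omega>" "k' \<bullet> v = y \<bullet> v" "y \<bullet> v = (1 - l') * (x \<bullet> v) + l' * (y' \<bullet> v)"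
      "\<And>u. k' \<bullet> u = (1 - l') * (x \<bullet> u) + l' * (y' \<bullet> u)"
    using chord_at_height[OF in_closure between(3,4)] by metis
  have "(l + l' - 1) * (y' \<bullet> v - x \<bullet> v) = 0"
    using k(3) k'(3) shift by (simp add: algebra_simps)
  moreover have "y' \<bullet> v - x \<bullet> v > 0" using shift le \<open>0 < s\<close> by simp
  ultimately have l': "l' = 1 - l" by simp
  have "x \<bullet> u + y' \<bullet> u = k \<bullet> u + k' \<bullet> u" unfolding k(4) k'(4) l' by (simp add: algebra_simps)
  also have "\<dots> \<le> x' \<bullet> u + y \<bullet> u"
    by (intro add_mono side_maximal[OF uv] side k k')
  finally show ?thesis by simp
qed

text \<open>The side is the graph of a concave function of the height, increasing below the height of its
  maximum \<open>m\<close>, so its increments shrink when the heights are shifted upwards.\<close>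

lemma side_shift_contracts:
  assumes uv: "orthonormal_pair u v" and m: "m \<in> closure \<Omega>" "m \<bullet> u = support_fun u"
    and side: "p \<in> side u" "p' \<in> side u" "q \<in> side u" "q' \<in> side u"
    and shift: "q \<bullet> v = p \<bullet> v + s" "q' \<bullet> v = p' \<bullet> v + s" and s: "0 < s"
    and below: "q \<bullet> v \<le> m \<bullet> v" "q' \<bullet> v \<le> m \<bullet> v"
  shows "dist q q' \<le> dist p p'"
proof -
  have ordered: "\<bar>y \<bullet> u - y' \<bullet> u\<bar> \<le> \<bar>x \<bullet> u - x' \<bullet> u\<bar>"
    if "x \<in> side u" "x' \<in> side u" "y \<in> side u" "y' \<in> side u" "x \<bullet> v \<le> x' \<bullet> v"
      "y \<bullet> v = x \<bullet> v + s" "y' \<bullet> v = x' \<bullet> v + s" "y' \<bullet> v \<le> m \<bullet> v" for x x' y y'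
  proof -
    have "y \<bullet> u \<le> y' \<bullet> u" using that by (intro side_increasing_below_maximum[OF uv m]) auto
    moreover have "y' \<bullet> u - y \<bullet> u \<le> x' \<bullet> u - x \<bullet> u" by (rule side_concave[OF uv that(1-7) s])
    ultimately show ?thesis by linarith
  qed
  have "\<bar>q \<bullet> u - q' \<bullet> u\<bar> \<le> \<bar>p \<bullet> u - p' \<bullet> u\<bar>"
  proof (cases "p \<bullet> v \<le> p' \<bullet> v")
    case True
    then show ?thesis using ordered[of p p' q q'] side shift below by simp
  next
    case False
    then show ?thesis using ordered[of p' p q' q] side shift below by (simp add: abs_minus_commute)
  qed
  then have "(q \<bullet> u - q' \<bullet> u)\<^sup>2 \<le> (p \<bullet> u - p' \<bullet> u)\<^sup>2" by (simp add: abs_le_square_iff)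
  then have "(dist q q')\<^sup>2 \<le> (dist p p')\<^sup>2" unfolding orthonormal_pair_dist[OF uv] using shift by simp
  then show ?thesis by (simp add: power2_le_iff_abs_le)
qed

lemma H1_side_shift_le:
  assumes uv: "orthonormal_pair u v" and m: "m \<in> closure \<Omega>" "m \<bullet> u = support_fun u" and s: "0 < s"
    and E: "E \<subseteq> {- support_fun (- v) + s<..m \<bullet> v}"
  shows "H1 {q \<in> side u. q \<bullet> v \<in> E} \<le> H1 {p \<in> side u. p \<bullet> v + s \<in> E}"
proof -
  let ?Q = "{q \<in> side u. q \<bullet> v \<in> E}"
  have "\<exists>p. p \<in> side u \<and> p \<bullet> v + s = q \<bullet> v" if q: "q \<in> ?Q" for q
  proof -
    have "q \<bullet> v - s \<in> heights v"
      using q E side_height[OF uv, of q] s by (auto simp: heights_def)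
    then obtain p where "p \<in> side u" "p \<bullet> v = q \<bullet> v - s" by (rule side_exists[OF uv])
    then show ?thesis by auto
  qed
  then have "\<forall>q\<in>?Q. \<exists>p. p \<in> side u \<and> p \<bullet> v + s = q \<bullet> v" by blast
  from bchoice[OF this] obtain f where f: "\<And>q. q \<in> ?Q \<Longrightarrow> f q \<in> side u \<and> f q \<bullet> v + s = q \<bullet> v" by blast
  have "dist x y \<le> dist (f x) (f y)" if "x \<in> ?Q" "y \<in> ?Q" for x y
    using f[OF that(1)] f[OF that(2)] that E s
    by (intro side_shift_contracts[OF uv m]) auto
  then have "H1 ?Q \<le> H1 (f ` ?Q)" by (rule H1_inv_contraction_le)
  also have "\<dots> \<le> H1 {p \<in> side u. p \<bullet> v + s \<in> E}" using f by (intro H1_mono) auto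
  finally show ?thesis .
qed

definition height_measure :: "(real^2) set \<Rightarrow> real^2 \<Rightarrow> real measure" where
  "height_measure A v = distr (density \<sigma> (indicator A)) borel (\<lambda>p. p \<bullet> v)"

lemma emeasure_height_measure:
  assumes [measurable]: "A \<in> sets borel" "E \<in> sets borel" and A: "A \<subseteq> frontier \<Omega>"
  shows "emeasure (height_measure A v) E = H1 {p \<in> A. p \<bullet> v \<in> E}"
proof -
  have vimage [measurable]: "(\<lambda>p. p \<bullet> v) -` E \<in> sets borel"
    using measurable_sets[of "\<lambda>p. p \<bullet> v" borel borel E] by simp
  have "emeasure (height_measure A v) E = emeasure \<sigma> (A \<inter> (\<lambda>p. p \<bullet> v) -` E)"
    unfolding height_measure_def
    by (simp add: emeasure_distr emeasure_density indicator_inter_arith[symmetric])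
  also have "\<dots> = H1 (A \<inter> (\<lambda>p. p \<bullet> v) -` E \<inter> frontier \<Omega>)"
    by (rule emeasure_arclength) measurable
  also have "A \<inter> (\<lambda>p. p \<bullet> v) -` E \<inter> frontier \<Omega> = {p \<in> A. p \<bullet> v \<in> E}" using A by auto
  finally show ?thesis .
qed

lemma integral_height_measure:
  fixes f :: "real \<Rightarrow> complex"
  assumes [measurable]: "A \<in> sets borel" "f \<in> borel_measurable borel"
  shows "(\<integral>t. f t \<partial>height_measure A v) = (LINT p:A|\<sigma>. f (p \<bullet> v))"
  unfolding height_measure_def set_lebesgue_integral_def
  by (subst integral_density[where g="indicator A", symmetric])
     (auto simp: integral_distr ennreal_indicator[abs_def])

lemma finite_measure_height_measure:
  assumes "A \<in> sets borel" "A \<subseteq> frontier \<Omega>"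
  shows "finite_measure (height_measure A v)"
proof (rule finite_measureI)
  have "emeasure (height_measure A v) UNIV \<le> emeasure \<sigma> UNIV"
    using assms by (simp add: emeasure_height_measure emeasure_arclength H1_mono)
  then show "emeasure (height_measure A v) (space (height_measure A v)) \<noteq> \<infinity>"
    using arc.emeasure_finite[of UNIV] by (auto simp: height_measure_def top_unique)
qed

lemma rising_arc_fourier_le:
  assumes uv: "orthonormal_pair u v" and m: "m \<in> closure \<Omega>" "m \<bullet> u = support_fun u"
    and [measurable]: "J \<in> sets borel" and below: "J \<subseteq> {..m \<bullet> v}"
    and down: "\<And>t t'. t \<in> J \<Longrightarrow> t' \<le> t \<Longrightarrow> t' \<in> J"
    and s: "0 < s" and half_period: "\<bar>r\<bar> * s = pi"
  shows "cmod (LINT p:{p \<in> side u. p \<bullet> v \<in> J}|\<sigma>. cis (r * (p \<bullet> v))) \<le> cap_mass (- v) s"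
proof -
  let ?A = "{p \<in> side u. p \<bullet> v \<in> J}" and ?c = "- support_fun (- v) + s"
  let ?\<mu> = "height_measure ?A v"
  have A: "?A \<in> sets borel" "?A \<subseteq> frontier \<Omega>" using side_subset_frontier by auto
  have "(LINT p:?A|\<sigma>. cis (r * (p \<bullet> v))) = (\<integral>t. cis (r * t) \<partial>?\<mu>)"
    by (rule integral_height_measure[symmetric]) measurable
  also have "cmod \<dots> \<le> measure ?\<mu> {..?c}"
  proof (rule oscillatory_integral_le[OF finite_measure_height_measure[OF A] _ half_period])
    show "sets ?\<mu> = sets borel" by (simp add: height_measure_def)
    fix E :: "real set" assume [measurable]: "E \<in> sets borel" and E: "E \<subseteq> {?c<..}"
    have [measurable]: "(\<lambda>t. t + s) -` E \<in> sets borel"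
      using measurable_sets[of "\<lambda>t. t + s" borel borel E] by simp
    have "emeasure ?\<mu> E = H1 {q \<in> side u. q \<bullet> v \<in> E \<inter> J}"
      by (subst emeasure_height_measure[OF A(1) _ A(2)]) (auto intro!: arg_cong[where f=H1])
    also have "\<dots> \<le> H1 {p \<in> side u. p \<bullet> v + s \<in> E \<inter> J}"
      using E below by (intro H1_side_shift_le[OF uv m s]) auto
    also have "\<dots> \<le> H1 {p \<in> ?A. p \<bullet> v + s \<in> E}"
      using s by (intro H1_mono) (auto intro: down)
    also have "\<dots> = emeasure ?\<mu> ((\<lambda>t. t + s) -` E)"
      by (simp add: emeasure_height_measure[OF A(1) _ A(2)])
    finally show "emeasure ?\<mu> E \<le> emeasure ?\<mu> ((\<lambda>t. t + s) -` E)" .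
  qed
  also have "\<dots> \<le> cap_mass (- v) s"
  proof -
    have "emeasure ?\<mu> {..?c} \<le> emeasure \<sigma> (cap (- v) s)"
      using A(2) by (simp add: emeasure_height_measure[OF A(1) _ A(2)] emeasure_arclength)
        (auto intro!: H1_mono simp: cap_def)
    then show ?thesis unfolding cap_mass_def measure_def
      by (intro enn2real_mono) (auto simp: less_top[symmetric])
  qed
  finally show ?thesis .
qed

lemma set_integrable_cis:
  "A \<in> sets borel \<Longrightarrow> set_integrable \<sigma> A (\<lambda>p. cis (r * (p \<bullet> v)))"
  unfolding set_integrable_def by (intro arc.integrable_const_bound[of _ 1]) (auto simp: indicator_def)

lemma side_fourier_le:
  assumes uv: "orthonormal_pair u v" and s: "0 < s" and half_period: "\<bar>r\<bar> * s = pi"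
  shows "cmod (LINT p:side u|\<sigma>. cis (r * (p \<bullet> v))) \<le> cap_mass v s + cap_mass (- v) s"
proof -
  obtain m where "m \<in> frontier \<Omega>" and m: "m \<bullet> u = support_fun u"
    by (rule support_fun_attained[OF orthonormal_pair_nonzero(1)[OF uv]])
  then have in_closure: "m \<in> closure \<Omega>" by (simp add: frontier_eq)
  let ?e = "\<lambda>p. cis (r * (p \<bullet> v))"
  let ?lower = "{p \<in> side u. p \<bullet> v \<in> {..m \<bullet> v}}" and ?upper = "{p \<in> side u. p \<bullet> (- v) \<in> {..<m \<bullet> (- v)}}"
  have lower: "cmod (LINT p:?lower|\<sigma>. ?e p) \<le> cap_mass (- v) s"
    by (rule rising_arc_fourier_le[OF uv in_closure m _ _ _ s half_period]) auto
  have "cmod (LINT p:?upper|\<sigma>. cis ((- r) * (p \<bullet> (- v)))) \<le> cap_mass (- (- v)) s"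
    by (rule rising_arc_fourier_le[OF orthonormal_pair_uminus(2)[OF uv] in_closure m _ _ _ s])
      (use half_period in auto)
  then have upper: "cmod (LINT p:?upper|\<sigma>. ?e p) \<le> cap_mass v s" by simp
  have "side u = ?lower \<union> ?upper" "?lower \<inter> ?upper = {}" by auto
  then have "(LINT p:side u|\<sigma>. ?e p) = (LINT p:?lower|\<sigma>. ?e p) + (LINT p:?upper|\<sigma>. ?e p)"
    using set_integral_Un[of ?lower ?upper \<sigma> ?e] set_integrable_cis by simp
  then show ?thesis using lower upper norm_triangle_mono by fastforce
qed

lemma arclength_fourier_decay:
  assumes v: "norm v = 1" and s: "0 < s" and half_period: "\<bar>r\<bar> * s = pi"
  shows "cmod (\<integral>p. cis (r * (p \<bullet> v)) \<partial>\<sigma>) \<le> 6 * Lambda \<Omega> v s"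
proof -
  define u where "u = perp v"
  have uv: "orthonormal_pair u v" unfolding u_def by (rule orthonormal_pair_perp[OF v])
  let ?e = "\<lambda>p. cis (r * (p \<bullet> v))"
  define ends where "ends = - (side u \<union> side (- u))"
  have [measurable]: "ends \<in> sets borel" unfolding ends_def by measurable
  have "ends \<inter> frontier \<Omega> \<subseteq> cap v s \<union> cap (- v) s"
    using frontier_cases[OF uv] s by (fastforce simp: ends_def cap_def)
  then have ends_le: "measure \<sigma> ends \<le> measure \<sigma> (cap v s \<union> cap (- v) s)"
    by (subst measure_arclength_Int_frontier[symmetric]) (auto intro: arc.finite_measure_mono)
  have "cmod (LINT p:ends|\<sigma>. ?e p) \<le> measure \<sigma> ends"
    using set_integral_norm_bound[OF set_integrable_cis, of ends r v] by (simp add: set_lebesgue_integral_def)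
  also note ends_le
  also have "measure \<sigma> (cap v s \<union> cap (- v) s) \<le> cap_mass v s + cap_mass (- v) s"
    unfolding cap_mass_def by (rule measure_Un_le) auto
  finally have ends: "cmod (LINT p:ends|\<sigma>. ?e p) \<le> cap_mass v s + cap_mass (- v) s" .
  have "(side u \<union> side (- u)) \<union> ends = UNIV" by (auto simp: ends_def)
  then have "(\<integral>p. ?e p \<partial>\<sigma>) = (LINT p:(side u \<union> side (- u)) \<union> ends|\<sigma>. ?e p)"
    by (simp add: set_lebesgue_integral_def)
  also have "\<dots> = (LINT p:side u \<union> side (- u)|\<sigma>. ?e p) + (LINT p:ends|\<sigma>. ?e p)"
    by (intro set_integral_Un set_integrable_cis) (auto simp: ends_def)
  also have "(LINT p:side u \<union> side (- u)|\<sigma>. ?e p) = (LINT p:side u|\<sigma>. ?e p) + (LINT p:side (- u)|\<sigma>. ?e p)"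
    by (intro set_integral_Un set_integrable_cis side_disjoint[OF uv]) auto
  finally have "cmod (\<integral>p. ?e p \<partial>\<sigma>)
      \<le> cmod (LINT p:side u|\<sigma>. ?e p) + cmod (LINT p:side (- u)|\<sigma>. ?e p) + cmod (LINT p:ends|\<sigma>. ?e p)"
    by (simp only: order_trans[OF norm_triangle_ineq add_right_mono[OF norm_triangle_ineq]])
  also have "\<dots> \<le> 3 * (cap_mass v s + cap_mass (- v) s)"
    using side_fourier_le[OF uv s half_period]
      side_fourier_le[OF orthonormal_pair_uminus(1)[OF uv] s half_period] ends by simp
  also have "\<dots> \<le> 6 * Lambda \<Omega> v s" by (simp add: Lambda_eq[OF v])
  finally show ?thesis .
qed

lemma measure_ft_arclength_decay:
  assumes "\<xi> \<noteq> 0"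
  shows "cmod (measure_ft \<sigma> \<xi>) \<le> 6 * Lambda \<Omega> (\<xi> /\<^sub>R norm \<xi>) (pi / norm \<xi>)"
proof -
  have "\<xi> \<bullet> p = norm \<xi> * (p \<bullet> (\<xi> /\<^sub>R norm \<xi>))" for p using assms by (simp add: inner_commute)
  then show ?thesis
    unfolding measure_ft_def
    using arclength_fourier_decay[of "\<xi> /\<^sub>R norm \<xi>" "pi / norm \<xi>" "norm \<xi>"] assms by simp
qed

lemma frontier_norm_le:
  obtains D where "0 < D" "\<And>p. p \<in> frontier \<Omega> \<Longrightarrow> norm p \<le> D"
proof -
  obtain D where D: "\<forall>x\<in>closure \<Omega>. norm x \<le> D"
    using bounded_closure[OF bounded_domain] by (auto simp: bounded_iff)
  show thesis by (rule that[of "max 1 D"]) (use D in \<open>auto simp: frontier_eq le_max_iff_disj\<close>)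
qed

end

section \<open>The maximal function along a convex curve\<close>

lemma maxop_eq_dyadic_maximal: "maxop \<Omega> = dyadic_maximal (arclength \<Omega>)"
  by (intro ext) (simp add: maxop_def dyadic_maximal_def conv_measure_def)

lemma L2_bounded_iff:
  "L2_bounded \<Omega> \<longleftrightarrow> (\<exists>C. \<forall>f. f \<in> borel_measurable borel \<longrightarrow> integrable lborel (\<lambda>x. (f x)\<^sup>2) \<longrightarrow>
      L2_sq (maxop \<Omega> f) \<le> ennreal C * L2_sq (\<lambda>x. ennreal \<bar>f x\<bar>))"
  by (simp add: L2_bounded_def L2_sq_def ennreal_power)

lemma sum_mult_emeasure_le_nn_integral:
  assumes "finite K" and E: "disjoint_family_on E K" "\<And>k. k \<in> K \<Longrightarrow> E k \<in> sets M"
    and le: "\<And>k x. k \<in> K \<Longrightarrow> x \<in> E k \<Longrightarrow> c k \<le> f x"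
  shows "(\<Sum>k\<in>K. c k * emeasure M (E k)) \<le> (\<integral>\<^sup>+x. f x \<partial>M)"
proof -
  have "(\<Sum>k\<in>K. c k * indicator (E k) x) \<le> f x" for x
  proof (cases "\<exists>j\<in>K. x \<in> E j")
    case True
    then obtain j where j: "j \<in> K" "x \<in> E j" by blast
    have "x \<notin> E k" if "k \<in> K - {j}" for k
      using E(1) j that by (auto simp: disjoint_family_on_def)
    then have "(\<Sum>k\<in>K. c k * indicator (E k) x) = (\<Sum>k\<in>{j}. c k * indicator (E k) x)"
      using \<open>finite K\<close> j by (intro sum.mono_neutral_right) auto
    then show ?thesis using le[OF j] j by simp
  qed (simp add: sum.neutral)
  then have "(\<integral>\<^sup>+x. (\<Sum>k\<in>K. c k * indicator (E k) x) \<partial>M) \<le> (\<integral>\<^sup>+x. f x \<partial>M)"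
    by (rule nn_integral_mono)
  also have "(\<integral>\<^sup>+x. (\<Sum>k\<in>K. c k * indicator (E k) x) \<partial>M) = (\<Sum>k\<in>K. c k * emeasure M (E k))"
    using E(2) by (subst nn_integral_sum) (auto simp: nn_integral_cmult)
  finally show ?thesis .
qed

definition frame_map :: "real^2 \<Rightarrow> real^2 \<Rightarrow> real^2 \<Rightarrow> real^2" where
  "frame_map u v y = (y $ 1) *\<^sub>R u + (y $ 2) *\<^sub>R v"

lemma orthogonal_transformation_frame_map:
  assumes "orthonormal_pair u v"
  shows "orthogonal_transformation (frame_map u v)"
  unfolding orthogonal_transformation_def
proof (intro conjI allI)
  show "linear (frame_map u v)" by (rule linearI) (auto simp: frame_map_def algebra_simps)
  show "frame_map u v x \<bullet> frame_map u v y = x \<bullet> y" for x y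
    unfolding frame_map_def by (simp add: inner_add_left inner_add_right orthonormal_pair_inner[OF assms])
      (simp add: inner_vec_def sum_2)
qed

definition rectangle :: "real^2 \<Rightarrow> real^2 \<Rightarrow> real \<Rightarrow> real \<Rightarrow> real \<Rightarrow> real \<Rightarrow> (real^2) set" where
  "rectangle u v a b c d = {x. a \<le> x \<bullet> u \<and> x \<bullet> u \<le> b \<and> c \<le> x \<bullet> v \<and> x \<bullet> v \<le> d}"

lemma rectangle_borel [measurable]: "rectangle u v a b c d \<in> sets borel"
  unfolding rectangle_def by measurable

lemma rectangle_eq_image:
  assumes uv: "orthonormal_pair u v"
  shows "rectangle u v a b c d = frame_map u v ` cbox (vector [a, c]) (vector [b, d])"
proof (intro equalityI subsetI)
  fix x assume x: "x \<in> rectangle u v a b c d"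
  show "x \<in> frame_map u v ` cbox (vector [a, c]) (vector [b, d])"
  proof
    show "x = frame_map u v (vector [x \<bullet> u, x \<bullet> v])"
      using uv by (simp add: orthonormal_pair_def frame_map_def)
    show "vector [x \<bullet> u, x \<bullet> v] \<in> cbox (vector [a, c]) (vector [b, d] :: real^2)"
      using x by (simp add: rectangle_def mem_box_cart forall_2)
  qed
qed (auto simp: rectangle_def frame_map_def inner_add_left orthonormal_pair_inner[OF uv] mem_box_cart forall_2)

lemma emeasure_rectangle:
  assumes uv: "orthonormal_pair u v" and "a \<le> b" "c \<le> d"
  shows "emeasure lborel (rectangle u v a b c d) = ennreal ((b - a) * (d - c))"
proof -
  let ?C = "cbox (vector [a, c]) (vector [b, d]) :: (real^2) set"
  have T: "orthogonal_transformation (frame_map u v)" by (rule orthogonal_transformation_frame_map[OF uv])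
  have "?C \<noteq> {}" using assms(2,3) by (simp add: interval_ne_empty_cart forall_2)
  then have "measure lebesgue ?C = (b - a) * (d - c)"
    by (simp add: content_cbox_cart UNIV_2)
  then have measure: "measure lborel (rectangle u v a b c d) = (b - a) * (d - c)"
    using measure_orthogonal_image[OF T, of ?C] by (simp add: measure_completion flip: rectangle_eq_image[OF uv])
  have "bounded_linear (frame_map u v)"
    using orthogonal_transformation_linear[OF T] by (simp add: linear_conv_bounded_linear)
  then have "bounded (rectangle u v a b c d)"
    unfolding rectangle_eq_image[OF uv] by (intro bounded_linear_image bounded_cbox)
  then have "emeasure lborel (rectangle u v a b c d) \<noteq> \<infinity>"
    using emeasure_bounded_finite by (simp add: less_top)
  then show ?thesis by (simp add: emeasure_eq_ennreal_measure measure)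
qed

lemma L2_sq_indicator:
  assumes "A \<in> sets borel"
  shows "L2_sq (\<lambda>x. ennreal \<bar>indicator A x\<bar>) = emeasure lborel A"
proof -
  have "L2_sq (\<lambda>x. ennreal \<bar>indicator A x\<bar>) = (\<integral>\<^sup>+x. indicator A x \<partial>lborel)"
    unfolding L2_sq_def by (intro nn_integral_cong) (auto simp: indicator_def)
  then show ?thesis using assms by simp
qed

context convex_domain
begin

lemma L2_bounded_of_cap_energy_bound:
  assumes bound: "\<And>v. norm v = 1 \<Longrightarrow> cap_energy v T \<le> B" and "B < \<infinity>" "0 < T"
  shows "L2_bounded \<Omega>"
proof -
  obtain D where D: "0 < D" "\<And>p. p \<in> frontier \<Omega> \<Longrightarrow> norm p \<le> D" using frontier_norm_le by auto
  have "AE p in \<sigma>. norm p \<le> D" using AE_frontier by eventually_elim (rule D(2))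
  then interpret bounded_support_measure \<sigma> D by unfold_locales simp_all
  define G where "G = 36 * (B + ennreal (mass\<^sup>2 * (2 * pi) / T))"
  have G_finite: "G < top" using \<open>B < \<infinity>\<close> by (auto simp: G_def ennreal_mult_less_top)
  have dini_le: "emeasure (dini_measure (\<lambda>d. (6 * Lambda \<Omega> v d)\<^sup>2)) {0<..<2 * pi} \<le> ennreal (enn2real G)"
    if v: "norm v = 1" for v
  proof -
    have "emeasure (dini_measure (\<lambda>d. (6 * Lambda \<Omega> v d)\<^sup>2)) {0<..<2 * pi} = 36 * cap_energy v (2 * pi)"
      using emeasure_dini_measure_cmult[OF mono_Lambda_square[OF v], of 36]
      by (simp add: cap_energy_def power_mult_distrib)
    moreover have "cap_energy v (2 * pi) \<le> cap_energy v T + ennreal (mass\<^sup>2 * (2 * pi) / T)"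
      using \<open>0 < T\<close> by (intro cap_energy_extend v) auto
    then have "cap_energy v (2 * pi) \<le> B + ennreal (mass\<^sup>2 * (2 * pi) / T)"
      using bound[OF v] by (meson add_right_mono order_trans)
    then have "36 * cap_energy v (2 * pi) \<le> G" unfolding G_def by (rule mult_left_mono) simp
    ultimately show ?thesis unfolding ennreal_enn2real[OF G_finite] by (simp only:)
  qed
  have "\<exists>C. \<forall>f\<in>borel_measurable borel. L2_sq (dyadic_maximal \<sigma> f) \<le> ennreal C * L2_sq (\<lambda>x. ennreal \<bar>f x\<bar>)"
  proof (rule dyadic_maximal_L2_bounded[where H = "\<lambda>v d. 6 * Lambda \<Omega> v d" and G = "enn2real G"])
    show "mono (\<lambda>d. 6 * Lambda \<Omega> v d)" if "norm v = 1" for v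
      using mono_Lambda[OF that] by (simp add: mono_def)
  qed (use measure_ft_arclength_decay dini_le Lambda_nonneg in simp_all)
  then show ?thesis unfolding L2_bounded_iff maxop_eq_dyadic_maximal by blast
qed

lemma strip_translate_contains_cap:
  assumes uv: "orthonormal_pair u v" and y: "y \<in> cap v (e / 2 ^ k)" "2 ^ k * norm y \<le> R"
    and x: "x \<in> rectangle u v (- R) R (2 ^ k * support_fun v - e) (2 ^ k * support_fun v)"
  shows "x - (2 ^ k) *\<^sub>R y \<in> rectangle u v (- (2 * R)) (2 * R) (- e) e"
proof -
  have "y \<bullet> v \<le> support_fun v" using y by (intro support_fun_ge) (auto simp: cap_def frontier_eq)
  then have top: "2 ^ k * (y \<bullet> v) \<le> 2 ^ k * support_fun v" by (intro mult_left_mono) auto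
  have "2 ^ k * (support_fun v - e / 2 ^ k) \<le> 2 ^ k * (y \<bullet> v)"
    using y by (intro mult_left_mono) (auto simp: cap_def)
  then have bottom: "2 ^ k * support_fun v - e \<le> 2 ^ k * (y \<bullet> v)" by (simp add: algebra_simps)
  have "\<bar>y \<bullet> u\<bar> \<le> norm y" using Cauchy_Schwarz_ineq2[of y u] uv by (simp add: orthonormal_pair_def)
  then have "\<bar>2 ^ k * (y \<bullet> u)\<bar> \<le> 2 ^ k * norm y" by (simp add: abs_mult)
  then have side: "\<bar>2 ^ k * (y \<bullet> u)\<bar> \<le> R" using y(2) by (rule order_trans)
  show ?thesis
    unfolding rectangle_def mem_Collect_eq inner_diff_left inner_scaleR_left
    using x[unfolded rectangle_def mem_Collect_eq] top bottom side by (intro conjI) linarith+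
qed

lemma cap_mass_le_maxop_strip:
  assumes uv: "orthonormal_pair u v" and R: "\<And>y. y \<in> frontier \<Omega> \<Longrightarrow> 2 ^ k * norm y \<le> R"
    and x: "x \<in> rectangle u v (- R) R (2 ^ k * support_fun v - e) (2 ^ k * support_fun v)"
  shows "ennreal (cap_mass v (e / 2 ^ k)) \<le> maxop \<Omega> (indicator (rectangle u v (- (2 * R)) (2 * R) (- e) e)) x"
proof -
  let ?f = "indicator (rectangle u v (- (2 * R)) (2 * R) (- e) e) :: real^2 \<Rightarrow> real"
  have "cap_mass v (e / 2 ^ k) = (\<integral>y. indicator (cap v (e / 2 ^ k)) y \<partial>\<sigma>)" by (simp add: cap_mass_def)
  also have "\<dots> \<le> (\<integral>y. ?f (x - (2 ^ k) *\<^sub>R y) \<partial>\<sigma>)"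
  proof (intro integral_mono)
    show "integrable \<sigma> (indicator (cap v (e / 2 ^ k)) :: _ \<Rightarrow> real)" "integrable \<sigma> (\<lambda>y. ?f (x - (2 ^ k) *\<^sub>R y))"
      by (auto intro!: arc.integrable_const_bound[of _ 1] simp: indicator_def)
    fix y
    show "indicator (cap v (e / 2 ^ k)) y \<le> ?f (x - (2 ^ k) *\<^sub>R y)"
      using strip_translate_contains_cap[OF uv _ R x, of y] by (auto simp: indicator_def cap_def)
  qed
  finally have "ennreal (cap_mass v (e / 2 ^ k)) \<le> ennreal \<bar>\<integral>y. ?f (x - (2 powr real_of_int (int k)) *\<^sub>R y) \<partial>\<sigma>\<bar>"
    by (intro ennreal_leI) (simp add: powr_realpow)
  also have "\<dots> \<le> maxop \<Omega> ?f x"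
    unfolding maxop_def by (rule SUP_upper) simp
  finally show ?thesis .
qed

lemma disjoint_slabs:
  assumes "e < h" "0 \<le> h"
  shows "disjoint_family_on (\<lambda>k. rectangle u v a b (2 ^ k * h - e) (2 ^ k * h)) K"
proof -
  have "rectangle u v a b (2 ^ j * h - e) (2 ^ j * h) \<inter> rectangle u v a b (2 ^ k * h - e) (2 ^ k * h) = {}"
    if "j < k" for j k
  proof -
    have "2 ^ Suc j * h \<le> 2 ^ k * h" using that assms by (intro mult_right_mono power_increasing) auto
    moreover have "1 * h \<le> 2 ^ j * h" using assms by (intro mult_right_mono) auto
    moreover have "2 ^ Suc j * h = 2 ^ j * h + 2 ^ j * h" by simp
    ultimately have "2 ^ j * h < 2 ^ k * h - e" using assms by linarith
    then show ?thesis by (auto simp: rectangle_def)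
  qed
  then show ?thesis unfolding disjoint_family_on_def by (metis Int_commute linorder_neq_iff)
qed

lemma cap_mass_dyadic_sum_le:
  assumes L2: "\<And>f. f \<in> borel_measurable borel \<Longrightarrow> integrable lborel (\<lambda>x. (f x)\<^sup>2) \<Longrightarrow>
      L2_sq (maxop \<Omega> f) \<le> ennreal C * L2_sq (\<lambda>x. ennreal \<bar>f x\<bar>)"
    and v: "norm v = 1" and e: "0 < e" "e < support_fun v"
  shows "(\<Sum>k<n. ennreal ((cap_mass v (e / 2 ^ k))\<^sup>2)) \<le> 4 * ennreal C"
proof -
  define u where "u = perp v"
  have uv: "orthonormal_pair u v" unfolding u_def by (rule orthonormal_pair_perp[OF v])
  obtain D where D: "0 < D" "\<And>p. p \<in> frontier \<Omega> \<Longrightarrow> norm p \<le> D" using frontier_norm_le by auto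
  define R where "R = 2 ^ n * D"
  have R: "0 < R" "\<And>k p. k < n \<Longrightarrow> p \<in> frontier \<Omega> \<Longrightarrow> 2 ^ k * norm p \<le> R"
    using D by (auto simp: R_def intro!: mult_mono power_increasing)
  define strip where "strip = rectangle u v (- (2 * R)) (2 * R) (- e) e"
  define slab where "slab k = rectangle u v (- R) R (2 ^ k * support_fun v - e) (2 ^ k * support_fun v)"
    for k :: nat
  have [measurable]: "strip \<in> sets borel" by (simp add: strip_def)
  have emeasure_strip: "emeasure lborel strip = 4 * ennreal (2 * e * R)"
    using e R(1) emeasure_rectangle[OF uv, of "- (2 * R)" "2 * R" "- e" e] ennreal_mult[of 4 "2 * e * R"]
    by (simp add: strip_def algebra_simps)
  have emeasure_slab: "emeasure lborel (slab k) = ennreal (2 * e * R)" for k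
    unfolding slab_def using e R(1) by (subst emeasure_rectangle[OF uv]) (auto simp: algebra_simps)
  have "(\<Sum>k<n. ennreal ((cap_mass v (e / 2 ^ k))\<^sup>2)) * ennreal (2 * e * R)
      = (\<Sum>k<n. (ennreal (cap_mass v (e / 2 ^ k)))\<^sup>2 * emeasure lborel (slab k))"
    unfolding emeasure_slab sum_distrib_right by (simp only: ennreal_power cap_mass_nonneg)
  also have "\<dots> \<le> L2_sq (maxop \<Omega> (indicator strip))"
    unfolding L2_sq_def
  proof (rule sum_mult_emeasure_le_nn_integral)
    show "disjoint_family_on slab {..<n}" unfolding slab_def[abs_def] using e by (intro disjoint_slabs) auto
    show "(ennreal (cap_mass v (e / 2 ^ k)))\<^sup>2 \<le> (maxop \<Omega> (indicator strip) x)\<^sup>2"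
      if "k \<in> {..<n}" "x \<in> slab k" for k x
      unfolding strip_def using that
      by (intro power_mono_ennreal cap_mass_le_maxop_strip[OF uv R(2)]) (auto simp: slab_def)
  qed (simp_all add: slab_def)
  also have "\<dots> \<le> ennreal C * L2_sq (\<lambda>x. ennreal \<bar>indicator strip x\<bar>)"
  proof (rule L2)
    have "(\<lambda>x. (indicator strip x :: real)\<^sup>2) = indicator strip" by (auto simp: indicator_def)
    then show "integrable lborel (\<lambda>x. (indicator strip x :: real)\<^sup>2)"
      using emeasure_strip by (simp add: less_top[symmetric] ennreal_mult_eq_top_iff)
  qed simp
  also have "\<dots> = ennreal C * (4 * ennreal (2 * e * R))" by (subst L2_sq_indicator) (simp_all add: emeasure_strip)
  finally have "ennreal (2 * e * R) * (\<Sum>k<n. ennreal ((cap_mass v (e / 2 ^ k))\<^sup>2))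
      \<le> ennreal (2 * e * R) * (4 * ennreal C)"
    by (simp only: ac_simps)
  then show ?thesis
    using e R(1) by (subst (asm) ennreal_mult_le_mult_iff) auto
qed

lemma support_fun_uniformly_positive:
  obtains r where "0 < r" "\<And>v. norm v = 1 \<Longrightarrow> r < support_fun v"
proof -
  obtain r where r: "0 < r" "cball 0 r \<subseteq> \<Omega>" using open_domain zero_in_domain by (meson open_contains_cball)
  have "r < support_fun v" if v: "norm v = 1" for v
  proof -
    have "r *\<^sub>R v \<in> \<Omega>" using r v by (intro subsetD[OF r(2)]) simp
    then have "(r *\<^sub>R v) \<bullet> v < support_fun v" using v by (intro support_fun_gt) auto
    then show ?thesis using v by (simp add: norm_eq_1)
  qed
  then show thesis using r(1) that by blast
qed

lemma cap_energy_bound_of_L2_bounded: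
  assumes "L2_bounded \<Omega>" and T: "0 < T"
  obtains B where "B < \<infinity>" "\<And>v. norm v = 1 \<Longrightarrow> cap_energy v T \<le> B"
proof -
  obtain C where L2: "\<And>f. f \<in> borel_measurable borel \<Longrightarrow> integrable lborel (\<lambda>x. (f x)\<^sup>2) \<Longrightarrow>
      L2_sq (maxop \<Omega> f) \<le> ennreal C * L2_sq (\<lambda>x. ennreal \<bar>f x\<bar>)"
    using assms(1) unfolding L2_bounded_iff by blast
  obtain r where r: "0 < r" "\<And>v. norm v = 1 \<Longrightarrow> r < support_fun v"
    using support_fun_uniformly_positive by auto
  let ?mass = "measure \<sigma> UNIV"
  have "cap_energy v T \<le> 8 * ennreal C + ennreal (?mass\<^sup>2 * T / r)" if v: "norm v = 1" for v
  proof -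
    have "(\<Sum>k<n. ennreal ((Lambda \<Omega> v (r / 2 ^ k))\<^sup>2)) \<le> 8 * ennreal C" for n
    proof -
      have "(\<Sum>k<n. ennreal ((Lambda \<Omega> v (r / 2 ^ k))\<^sup>2))
          \<le> (\<Sum>k<n. ennreal ((cap_mass v (r / 2 ^ k))\<^sup>2) + ennreal ((cap_mass (- v) (r / 2 ^ k))\<^sup>2))"
        using v by (intro sum_mono) (simp add: Lambda_eq max_def add_increasing add_increasing2)
      also have "\<dots> \<le> 4 * ennreal C + 4 * ennreal C"
        unfolding sum.distrib using v r(1) by (intro add_mono cap_mass_dyadic_sum_le[OF L2] r(2)) auto
      finally show ?thesis by (simp flip: distrib_right)
    qed
    then have "(\<Sum>k. ennreal ((Lambda \<Omega> v (r / 2 ^ k))\<^sup>2)) \<le> 8 * ennreal C"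
      by (intro suminf_le_const summableI)
    then have "cap_energy v r \<le> 8 * ennreal C"
      unfolding cap_energy_def
      using dini_le_dyadic_sum[OF mono_Lambda_square[OF v] _ r(1)] order_trans by fastforce
    moreover have "cap_energy v T \<le> cap_energy v r + ennreal (?mass\<^sup>2 * T / r)"
      using T r(1) by (intro cap_energy_extend v) auto
    ultimately show ?thesis by (meson add_right_mono order_trans)
  qed
  moreover have "8 * ennreal C + ennreal (?mass\<^sup>2 * T / r) < \<infinity>" by (simp add: ennreal_mult_less_top)
  ultimately show thesis using that by blast
qed

end

theorem theorem1p2:
  fixes \<Omega> :: "(real^2) set" and \<delta>0 :: real
  assumes "convex \<Omega>" and "open \<Omega>" and "compact (closure \<Omega>)" and "0 \<in> \<Omega>"
    and "\<delta>0 > 0"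
    and "\<forall>\<theta> \<in> sphere 0 1. \<forall>\<delta>. 0 < \<delta> \<and> \<delta> < \<delta>0 \<longrightarrow>
           cap_plus \<Omega> \<theta> \<delta> \<inter> cap_minus \<Omega> \<theta> \<delta> = {}"
  shows "L2_bounded \<Omega> \<longleftrightarrow>
    (SUP \<theta> \<in> sphere 0 1.
       \<integral>\<^sup>+ \<delta>. ennreal ((Lambda \<Omega> \<theta> \<delta>)\<^sup>2 / \<delta>) * indicator {0<..<\<delta>0} \<delta> \<partial>lborel) < \<infinity>"
proof -
  interpret convex_domain \<Omega>
    using assms(1-4) by unfold_locales (auto intro: bounded_subset[OF compact_imp_bounded closure_subset])
  have "L2_bounded \<Omega> \<longleftrightarrow> (SUP \<theta>\<in>sphere 0 1. cap_energy \<theta> \<delta>0) < \<infinity>"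
  proof
    assume "L2_bounded \<Omega>"
    then obtain B where B: "B < \<infinity>" "\<And>\<theta>. norm \<theta> = 1 \<Longrightarrow> cap_energy \<theta> \<delta>0 \<le> B"
      using cap_energy_bound_of_L2_bounded \<open>\<delta>0 > 0\<close> by blast
    then have "(SUP \<theta>\<in>sphere 0 1. cap_energy \<theta> \<delta>0) \<le> B" by (intro SUP_least) simp
    then show "(SUP \<theta>\<in>sphere 0 1. cap_energy \<theta> \<delta>0) < \<infinity>" using B(1) by (rule le_less_trans)
  next
    assume "(SUP \<theta>\<in>sphere 0 1. cap_energy \<theta> \<delta>0) < \<infinity>"
    then show "L2_bounded \<Omega>"
      using \<open>\<delta>0 > 0\<close> by (rule L2_bounded_of_cap_energy_bound[rotated]) (auto intro: SUP_upper)
  qed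
  also have "(SUP \<theta>\<in>sphere 0 1. cap_energy \<theta> \<delta>0)
      = (SUP \<theta>\<in>sphere 0 1. \<integral>\<^sup>+\<delta>. ennreal ((Lambda \<Omega> \<theta> \<delta>)\<^sup>2 / \<delta>) * indicator {0<..<\<delta>0} \<delta> \<partial>lborel)"
    by (intro SUP_cong) (simp_all add: cap_energy_def emeasure_dini_measure mono_Lambda_square)
  finally show ?thesis .
qed

end
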